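(* There exists a set $\mathcal F$ of at most $6854$ partial patterns, each of size at most $80\times 80$, such that the sequence $\{C_n(\mathcal F)\}$ is not P-recursive.
   Context: A partial pattern is a $0$-$1$ matrix in which every row and column contains at most one $1$. An $n\times n$ permutation matrix $M$ contains a partial pattern $L$ if $L$ can be obtained from $M$ by deleting some rows and columns, and avoids it otherwise. $C_n(\mathcal F)$ is the number of $n\times n$ permutation matrices avoiding every partial pattern in $\mathcal F$. An integer sequence $\{a_n\}$ is P-recursive if it satisfies a nontrivial linear recurrence $q_0(n)a_n+q_1(n)a_{n-1}+\dots+q_k(n)a_{n-k}=0$ with polynomials $q_i\in\mathbb Z[x]$ not all zero. *)

theory Defs
  imports "HOL-Combinatorics.Permutations" "HOL-Computational_Algebra.Polynomial"
begin

text \<open>A 0-1 matrix with k rows and l columns (rows/columns indexed from 0) is represented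
  as a triple (k, l, P), where P is the set of positions (i,j) holding a 1.\<close>
type_synonym pattern = "nat \<times> nat \<times> (nat \<times> nat) set"

definition prows :: "pattern \<Rightarrow> nat" where "prows L = fst L"
definition pcols :: "pattern \<Rightarrow> nat" where "pcols L = fst (snd L)"
definition pones :: "pattern \<Rightarrow> (nat \<times> nat) set" where "pones L = snd (snd L)"

definition partial_pattern :: "pattern \<Rightarrow> bool" where
  "partial_pattern L \<longleftrightarrow>
     pones L \<subseteq> {..<prows L} \<times> {..<pcols L} \<and>
     (\<forall>i j j'. (i, j) \<in> pones L \<longrightarrow> (i, j') \<in> pones L \<longrightarrow> j = j') \<and>
     (\<forall>i i' j. (i, j) \<in> pones L \<longrightarrow> (i', j) \<in> pones L \<longrightarrow> i = i')"

text \<open>The n x n permutation matrix of a permutation \<sigma> of {..<n} has a 1 at (i,j) iff \<sigma> i = j.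
  It contains L iff L arises by deleting rows and columns, i.e. there are strictly
  increasing choices of rows and columns whose submatrix equals L.\<close>
definition contains :: "nat \<Rightarrow> (nat \<Rightarrow> nat) \<Rightarrow> pattern \<Rightarrow> bool" where
  "contains n \<sigma> L \<longleftrightarrow>
     (\<exists>r c. strict_mono_on {..<prows L} r \<and> r ` {..<prows L} \<subseteq> {..<n} \<and>
            strict_mono_on {..<pcols L} c \<and> c ` {..<pcols L} \<subseteq> {..<n} \<and>
            (\<forall>i<prows L. \<forall>j<pcols L. (\<sigma> (r i) = c j) \<longleftrightarrow> (i, j) \<in> pones L))"

definition C :: "pattern set \<Rightarrow> nat \<Rightarrow> nat" where
  "C F n = card {\<sigma>. \<sigma> permutes {..<n} \<and> (\<forall>L\<in>F. \<not> contains n \<sigma> L)}"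

definition P_recursive :: "(nat \<Rightarrow> int) \<Rightarrow> bool" where
  "P_recursive a \<longleftrightarrow>
     (\<exists>k (q :: nat \<Rightarrow> int poly). (\<exists>i\<le>k. q i \<noteq> 0) \<and>
        (\<forall>n\<ge>k. (\<Sum>i\<le>k. poly (q i) (int n) * a (n - i)) = 0))"

end

theory Submission
  imports Defs
begin

text \<open>
Compare \<open>forbidden\<close> with \<open>forbidden \<union> start_patterns\<close>: at least one of the
two counting sequences is not P-recursive, because the parity of their difference is too sparse. The difference
counts the permutations that avoid \<open>forbidden\<close> but contain a start pattern.

Seven simple permutations of size 7 serve as letters. Forbidding a letter with an extra empty row or column
inside makes all its occurrences contiguous, so that longer patterns built from letters act as local rules on
an arrangement of blocks. Each of these rules has a block of type 4 or 5, and the patterns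
with type 5 are forbidden. Exchanging 4 and 5 in the first block of this kind to which no rule applies is an
involution, hence modulo 2 only the permutations in which every such block is the site of a rule remain. For these
the rules simulate a queue: the next letter is a copy of the letter at the read position, except that the letter after a
marker is always a plain one and does not advance the read position. The distances between consecutive markers therefore grow by one, and
a run may end only where the next marker would be. So there is exactly one such permutation of size
21 v if v + 3 is a triangular number at least 6, and none otherwise.

If both sequences were P-recursive, linear algebra over the integer polynomials would give a recurrence for the
difference of the subsequences at 21 v. After division by the largest possible power of 2, some coefficient does not vanish
modulo 2 on a residue class modulo a power of 2. Since the triangular numbers meet every residue class modulo a
power of 2 and have increasing gaps, the recurrence fails at some place where exactly one term is odd.
\<close>

section \<open>Recurrences for differences of subsequences\<close>

text \<open>Avoidance can only exclude, whereas a computation must force its next step. That the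
  start is present comes from subtracting two avoidance counts; that the run continues comes from
  cancellation, since an unjustified pointer exists in two forms that are admissible together. Hence
  neither count is evaluated, and stray points or blocks elsewhere need no control: they are ruled
  out only for the permutations that survive the cancellation, where the run grows from the first
  row until the end block reaches the last one. Sparse parity alone would not refute a recurrence,
  because its coefficients might be divisible by high powers of 2 at just the sparse places. This is
  why a queue with triangular numbers is simulated. The factor 21 is three blocks of seven rows per
  letter. The lists hold 347 patterns, the largest with 64 rows or columns, so both bounds of the
  theorem leave ample room.\<close>

lemma homogeneous_system_nontrivial_solution:
  fixes A :: "'e \<Rightarrow> 'i \<Rightarrow> 'a::idom"
  assumes "finite M" "finite J" "card M < card J"
  shows "\<exists>x. (\<exists>j\<in>J. x j \<noteq> 0) \<and> (\<forall>i\<in>M. (\<Sum>j\<in>J. A i j * x j) = 0)"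
  using assms
proof (induction M arbitrary: A J rule: finite_induct)
  case empty
  then obtain j where "j \<in> J" by fastforce
  then show ?case by (intro exI[of _ "\<lambda>_. 1"]) auto
next
  case (insert m M)
  show ?case
  proof (cases "\<forall>j\<in>J. A m j = 0")
    case True
    from insert.IH[of J A] insert.prems insert.hyps obtain x where
      "\<exists>j\<in>J. x j \<noteq> 0" "\<forall>i\<in>M. (\<Sum>j\<in>J. A i j * x j) = 0" by auto
    then show ?thesis using True by (intro exI[of _ x]) auto
  next
    case False
    then obtain p where p: "p \<in> J" "A m p \<noteq> 0" by blast
    let ?J = "J - {p}"
    have cJ: "finite ?J" "card M < card ?J" using insert.prems insert.hyps p by auto
    \<comment> \<open>Elimination without division: row \<open>i\<close> is multiplied by the pivot
      \<open>A m p\<close> before a multiple of row \<open>m\<close> is subtracted. A solution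
      \<open>y\<close> of the smaller system is then scaled by the pivot, which leaves room to solve
      equation \<open>m\<close> for the unknown \<open>p\<close> inside the integral domain.\<close>
    define B where "B i j = A m p * A i j - A i p * A m j" for i j
    from insert.IH[OF cJ, of B] obtain y where
      y: "\<exists>j\<in>?J. y j \<noteq> 0" "\<forall>i\<in>M. (\<Sum>j\<in>?J. B i j * y j) = 0" by auto
    define x where "x j = (if j = p then - (\<Sum>j\<in>?J. A m j * y j) else A m p * y j)" for j
    have split: "(\<Sum>j\<in>J. A i j * x j) = A m p * (\<Sum>j\<in>?J. A i j * y j) - A i p * (\<Sum>j\<in>?J. A m j * y j)" for i
    proof -
      have "(\<Sum>j\<in>J. A i j * x j) = A i p * x p + (\<Sum>j\<in>?J. A i j * x j)"
        using p insert.prems(1) by (simp add: sum.remove)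
      also have "(\<Sum>j\<in>?J. A i j * x j) = (\<Sum>j\<in>?J. A m p * (A i j * y j))"
        by (rule sum.cong) (auto simp: x_def algebra_simps)
      also have "\<dots> = A m p * (\<Sum>j\<in>?J. A i j * y j)" by (simp add: sum_distrib_left)
      finally show ?thesis by (simp add: x_def algebra_simps)
    qed
    have "(\<Sum>j\<in>J. A i j * x j) = 0" if "i \<in> insert m M" for i
    proof (cases "i = m")
      case True
      then show ?thesis by (simp add: split)
    next
      case False
      with that y(2) have "(\<Sum>j\<in>?J. B i j * y j) = 0" by blast
      moreover have "(\<Sum>j\<in>?J. B i j * y j) = A m p * (\<Sum>j\<in>?J. A i j * y j) - A i p * (\<Sum>j\<in>?J. A m j * y j)"
        unfolding B_def sum_distrib_left sum_subtractf[symmetric]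
        by (rule sum.cong) (auto simp: algebra_simps)
      ultimately show ?thesis by (simp add: split)
    qed
    moreover have "\<exists>j\<in>J. x j \<noteq> 0" using y(1) p by (auto simp: x_def)
    ultimately show ?thesis by blast
  qed
qed

text \<open>The coefficient of \<open>a (c * v - j)\<close> in the recurrence taken at the index
  \<open>c * v - i\<close>, as a polynomial in \<open>v\<close>; the inner polynomial is
  \<open>c * v - i\<close>.\<close>

definition shifted_coeff :: "nat \<Rightarrow> nat \<Rightarrow> (nat \<Rightarrow> int poly) \<Rightarrow> nat \<Rightarrow> nat \<Rightarrow> int poly" where
  "shifted_coeff c k q i j =
     (if i \<le> j \<and> j \<le> i + k then pcompose (q (j - i)) [:- int i, int c:] else 0)"

lemma shifted_recurrence:
  assumes rec: "\<forall>n\<ge>k. (\<Sum>l\<le>k. poly (q l) (int n) * a (n - l)) = 0"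
    and "W = I + k" "W \<le> c * v"
  shows "(\<Sum>j\<le>W. poly (\<Sum>i\<le>I. shifted_coeff c k q i j * x i) (int v) * a (c * v - j)) = (0::int)"
proof -
  have inner: "(\<Sum>j\<le>W. poly (shifted_coeff c k q i j) (int v) * a (c * v - j)) = 0" if i: "i \<le> I" for i
  proof -
    have "(\<Sum>j\<le>W. poly (shifted_coeff c k q i j) (int v) * a (c * v - j))
        = (\<Sum>j\<in>{i..i+k}. poly (q (j - i)) (int (c * v - i)) * a (c * v - j))"
      using assms(2,3) i
      by (intro sum.mono_neutral_cong_right) (auto simp: shifted_coeff_def poly_pcompose algebra_simps)
    also have "\<dots> = (\<Sum>l\<le>k. poly (q l) (int (c * v - i)) * a (c * v - i - l))"
      by (rule sum.reindex_bij_witness[of _ "\<lambda>l. i + l" "\<lambda>j. j - i"]) auto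
    also have "\<dots> = 0" by (rule rec[rule_format]) (use assms(2,3) i in linarith)
    finally show ?thesis .
  qed
  have "(\<Sum>j\<le>W. poly (\<Sum>i\<le>I. shifted_coeff c k q i j * x i) (int v) * a (c * v - j))
     = (\<Sum>j\<le>W. \<Sum>i\<le>I. poly (x i) (int v) * (poly (shifted_coeff c k q i j) (int v) * a (c * v - j)))"
    by (simp add: poly_sum sum_distrib_right sum_distrib_left mult_ac)
  also have "\<dots> = (\<Sum>i\<le>I. poly (x i) (int v) * (\<Sum>j\<le>W. poly (shifted_coeff c k q i j) (int v) * a (c * v - j)))"
    by (subst sum.swap) (simp add: sum_distrib_left)
  also have "\<dots> = 0" using inner by simp
  finally show ?thesis .
qed

text \<open>Lowest terms multiply, as in a product of power series: for the least \<open>i0\<close>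
  with \<open>x i0 \<noteq> 0\<close> and the least \<open>l0\<close> with
  \<open>q l0 \<noteq> 0\<close>, the coefficient at \<open>i0 + l0\<close> consists of a single
  product. Composition with a nonconstant linear polynomial keeps \<open>q l0\<close> nonzero, hence
  \<open>0 < c\<close>.\<close>

lemma shifted_combination_nonzero:
  assumes q: "\<exists>l\<le>k. q l \<noteq> 0" and x: "\<exists>i\<le>I. x i \<noteq> 0" and c: "0 < c"
  shows "\<exists>j\<le>I + k. (\<Sum>i\<le>I. shifted_coeff c k q i j * x i) \<noteq> 0"
proof -
  obtain l where "l \<le> k" "q l \<noteq> 0" using q by blast
  then obtain l0 where l0: "q l0 \<noteq> 0" "\<And>l. l < l0 \<Longrightarrow> q l = 0" "l0 \<le> k"
    using exists_least_iff[of "\<lambda>l. q l \<noteq> 0"] by (metis not_le_imp_less le_trans less_imp_le)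
  obtain i where "i \<le> I" "x i \<noteq> 0" using x by blast
  then obtain i0 where i0: "x i0 \<noteq> 0" "\<And>i. i < i0 \<Longrightarrow> x i = 0" "i0 \<le> I"
    using exists_least_iff[of "\<lambda>i. x i \<noteq> 0"] by (metis not_le_imp_less le_trans less_imp_le)
  have vanish: "shifted_coeff c k q i (i0 + l0) * x i = 0" if "i \<noteq> i0" for i
  proof (cases "i < i0")
    case False
    then have "i0 + l0 - i < l0 \<or> i > i0 + l0" using that by auto
    then show ?thesis using l0(2)[of "i0 + l0 - i"] by (auto simp: shifted_coeff_def)
  qed (simp add: i0(2))
  have "(\<Sum>i\<le>I. shifted_coeff c k q i (i0 + l0) * x i) = shifted_coeff c k q i0 (i0 + l0) * x i0"
    using i0(3) by (subst sum.remove[of _ i0]) (auto intro!: sum.neutral simp: vanish simp del: mult_eq_0_iff)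
  moreover have "shifted_coeff c k q i0 (i0 + l0) \<noteq> 0"
    using l0 c by (auto simp: shifted_coeff_def pcompose_eq_0_iff)
  ultimately show ?thesis using i0 l0 by (intro exI[of _ "i0 + l0"]) auto
qed

lemma card_nondivisors_atMost:
  assumes "0 < (c::nat)"
  shows "card {j. j \<le> c * h \<and> \<not> c dvd j} = c * h - h"
proof -
  have multiples: "{j. j \<le> c * h \<and> c dvd j} = (\<lambda>i. c * i) ` {..h}"
    using assms by (auto simp: dvd_def)
  have "inj_on (\<lambda>i. c * i) {..h}" using assms by (auto intro!: inj_onI)
  then have "card {j. j \<le> c * h \<and> c dvd j} = Suc h"
    unfolding multiples by (simp only: card_image card_atMost)
  moreover have "{j. j \<le> c * h \<and> \<not> c dvd j} = {..c * h} - {j. j \<le> c * h \<and> c dvd j}" by blast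
  moreover have "card ({..c * h} - {j. j \<le> c * h \<and> c dvd j}) = card {..c*h} - card {j. j \<le> c * h \<and> c dvd j}"
    by (rule card_Diff_subset) auto
  ultimately show ?thesis by (simp only: card_atMost diff_Suc_Suc)
qed

text \<open>Multiples of shifted recurrences of \<open>a\<close> and of \<open>b\<close> are
  combined so that both combinations have the same coefficients and these vanish at all shifts not
  divisible by \<open>c\<close>. The difference then satisfies the common recurrence along the
  multiples of \<open>c\<close>.\<close>

lemma P_recursive_diff_subsequence:
  assumes "P_recursive a" "P_recursive b" "0 < c"
  shows "\<exists>H v0 (\<gamma> :: nat \<Rightarrow> int poly). (\<exists>h\<le>H. \<gamma> h \<noteq> 0) \<and>
    (\<forall>v\<ge>v0. (\<Sum>h\<le>H. poly (\<gamma> h) (int v) * (a (c * (v - h)) - b (c * (v - h)))) = 0)"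
proof -
  obtain k q where q: "\<exists>l\<le>k. q l \<noteq> 0" "\<forall>n\<ge>k. (\<Sum>l\<le>k. poly (q l) (int n) * a (n - l)) = 0"
    using assms(1) unfolding P_recursive_def by blast
  obtain m s where s: "\<exists>l\<le>m. s l \<noteq> 0" "\<forall>n\<ge>m. (\<Sum>l\<le>m. poly (s l) (int n) * b (n - l)) = 0"
    using assms(2) unfolding P_recursive_def by blast
  \<comment> \<open>There are \<open>I + J + 2 = 2 * W - H + 2\<close> multipliers against
    \<open>W + 1\<close> equations equating coefficients (\<open>Inl\<close>) and
    \<open>W - H\<close> equations removing shifts that \<open>c\<close> does not divide
    (\<open>Inr\<close>). With \<open>H = k + m\<close> the unknowns win by exactly one.\<close>
  define H where "H = k + m"
  define W where "W = c * H"
  have HW: "H \<le> W" using assms(3) by (simp add: W_def)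
  define I where "I = W - k"
  define J where "J = W - m"
  have IJ: "W = I + k" "W = J + m" using HW by (auto simp: I_def J_def H_def)
  define M where "M = Inl ` {..W} \<union> Inr ` {j. j \<le> W \<and> \<not> c dvd j}"
  define U where "U = Inl ` {..I} \<union> Inr ` {..J}"
  define A :: "nat + nat \<Rightarrow> nat + nat \<Rightarrow> int poly" where
    "A e u = (case e of Inl j \<Rightarrow> (case u of Inl i \<Rightarrow> shifted_coeff c k q i j | Inr i \<Rightarrow> - shifted_coeff c m s i j)
               | Inr j \<Rightarrow> (case u of Inl i \<Rightarrow> shifted_coeff c k q i j | Inr i \<Rightarrow> 0))" for e u
  have cardM: "card M = Suc W + (W - H)"
    unfolding M_def using card_nondivisors_atMost[OF assms(3), of H]
    by (subst card_Un_disjoint) (auto simp: card_image W_def)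
  have cardU: "card U = Suc I + Suc J"
    unfolding U_def by (subst card_Un_disjoint) (auto simp: card_image)
  have "finite M" "finite U" "card M < card U"
    using cardM cardU HW IJ by (auto simp: M_def U_def H_def)
  from homogeneous_system_nontrivial_solution[OF this, of A] obtain x where
    x: "\<exists>u\<in>U. x u \<noteq> 0" "\<forall>e\<in>M. (\<Sum>u\<in>U. A e u * x u) = 0" by blast
  define \<alpha> where "\<alpha> j = (\<Sum>i\<le>I. shifted_coeff c k q i j * x (Inl i))" for j
  define \<beta> where "\<beta> j = (\<Sum>i\<le>J. shifted_coeff c m s i j * x (Inr i))" for j
  have sumU: "(\<Sum>u\<in>U. f u) = (\<Sum>i\<le>I. f (Inl i)) + (\<Sum>i\<le>J. f (Inr i))" for f :: "nat + nat \<Rightarrow> int poly"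
    unfolding U_def by (subst sum.union_disjoint) (auto simp: sum.reindex inj_on_def)
  have \<alpha>\<beta>: "\<alpha> j = \<beta> j" if "j \<le> W" for j
    using x(2)[rule_format, of "Inl j"] that
    by (auto simp: M_def sumU A_def \<alpha>_def \<beta>_def sum_negf)
  have \<alpha>0: "\<alpha> j = 0" if "j \<le> W" "\<not> c dvd j" for j
    using x(2)[rule_format, of "Inr j"] that by (auto simp: M_def sumU A_def \<alpha>_def)
  have "\<exists>j\<le>W. \<alpha> j \<noteq> 0"
  proof (cases "\<exists>i\<le>I. x (Inl i) \<noteq> 0")
    case True
    from shifted_combination_nonzero[OF q(1) this assms(3)] show ?thesis by (simp add: IJ(1) \<alpha>_def)
  next
    case False
    then have "\<exists>i\<le>J. x (Inr i) \<noteq> 0" using x(1) by (auto simp: U_def)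
    from shifted_combination_nonzero[OF s(1) this assms(3)] have "\<exists>j\<le>W. \<beta> j \<noteq> 0"
      by (simp add: IJ(2) \<beta>_def)
    then show ?thesis using \<alpha>\<beta> by auto
  qed
  then obtain j where j: "j \<le> W" "\<alpha> j \<noteq> 0" by blast
  then have "c dvd j" using \<alpha>0 by blast
  then obtain h where h: "j = c * h" by blast
  have "h \<le> H" using j(1) h assms(3) by (simp add: W_def)
  have nz: "\<exists>h\<le>H. \<alpha> (c * h) \<noteq> 0" using j h \<open>h \<le> H\<close> by auto
  have "(\<Sum>h\<le>H. poly (\<alpha> (c * h)) (int v) * (a (c * (v - h)) - b (c * (v - h)))) = 0" if v: "v \<ge> W" for v
  proof -
    have cv: "W \<le> c * v" using v assms(3) by (cases c) auto
    have ra: "(\<Sum>j\<le>W. poly (\<alpha> j) (int v) * a (c * v - j)) = 0"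
      unfolding \<alpha>_def by (rule shifted_recurrence[OF q(2) IJ(1) cv])
    have "(\<Sum>j\<le>W. poly (\<beta> j) (int v) * b (c * v - j)) = 0"
      unfolding \<beta>_def by (rule shifted_recurrence[OF s(2) IJ(2) cv])
    moreover have "(\<Sum>j\<le>W. poly (\<beta> j) (int v) * b (c * v - j)) = (\<Sum>j\<le>W. poly (\<alpha> j) (int v) * b (c * v - j))"
      using \<alpha>\<beta> by (intro sum.cong) auto
    ultimately have "(\<Sum>j\<le>W. poly (\<alpha> j) (int v) * (a (c * v - j) - b (c * v - j))) = 0"
      using ra by (simp only: right_diff_distrib sum_subtractf)
    also have "(\<Sum>j\<le>W. poly (\<alpha> j) (int v) * (a (c * v - j) - b (c * v - j)))
      = (\<Sum>j\<in>(\<lambda>h. c * h) ` {..H}. poly (\<alpha> j) (int v) * (a (c * v - j) - b (c * v - j)))"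
    proof (rule sum.mono_neutral_right)
      show "(\<lambda>h. c * h) ` {..H} \<subseteq> {..W}" by (auto simp: W_def)
      show "\<forall>i\<in>{..W} - (\<lambda>h. c * h) ` {..H}. poly (\<alpha> i) (int v) * (a (c * v - i) - b (c * v - i)) = 0"
      proof
        fix i assume i: "i \<in> {..W} - (\<lambda>h. c * h) ` {..H}"
        have "\<not> c dvd i"
        proof
          assume "c dvd i"
          then obtain h where "i = c * h" by blast
          then show False using i assms(3) by (auto simp: W_def)
        qed
        then show "poly (\<alpha> i) (int v) * (a (c * v - i) - b (c * v - i)) = 0"
          using \<alpha>0[of i] i by simp
      qed
    qed simp
    also have "\<dots> = (\<Sum>h\<le>H. poly (\<alpha> (c * h)) (int v) * (a (c * v - c * h) - b (c * v - c * h)))"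
      using assms(3) by (subst sum.reindex) (auto intro!: inj_onI)
    finally show ?thesis by (simp only: diff_mult_distrib2)
  qed
  then show ?thesis
    by (intro exI[of _ H] exI[of _ W] exI[of _ "\<lambda>h. \<alpha> (c * h)"] conjI[OF nz] allI impI)
qed

section \<open>Sparse parity\<close>

primrec tri :: "nat \<Rightarrow> nat" where
  "tri 0 = 0"
| "tri (Suc k) = tri k + Suc k"

lemma tri_add: "tri (j + m) = tri j + j * m + tri m"
  by (induction m) auto

lemma two_tri: "2 * tri k = k * Suc k"
  by (induction k) auto

lemma tri_mono: "j \<le> k \<Longrightarrow> tri j \<le> tri k"
  using tri_add[of j "k - j"] by simp

lemma tri_less: "j < k \<Longrightarrow> tri j + j < tri k"
  using tri_mono[of "Suc j" k] by simp

lemma tri_strict: "tri k < tri m \<Longrightarrow> k < m"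
  using tri_mono[of m k] by (cases "k < m") auto

text \<open>The neighbours of \<open>tri k\<close> among the triangular numbers are at distance
  \<open>k\<close> below and \<open>k + 1\<close> above.\<close>

lemma tri_near:
  assumes "tri j = tri k + d \<or> tri k = tri j + d" "d < k"
  shows "j = k"
proof (rule ccontr)
  assume "j \<noteq> k"
  then consider "j < k" | "k < j" by linarith
  then show False
  proof cases
    case 1
    then obtain k' where k': "k = Suc k'" "j \<le> k'" by (cases k) auto
    then show False using assms tri_mono[of j k'] by auto
  next
    case 2
    then show False using assms tri_less[of k j] by auto
  qed
qed

text \<open>Lifting from one power of 2 to the next: if the residue is wrong modulo
  \<open>2 ^ Suc B\<close>, replacing \<open>j\<close> by \<open>j + 2 ^ Suc B\<close> changes
  \<open>tri j\<close> by an odd multiple of \<open>2 ^ B\<close> and corrects it.\<close>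

lemma tri_surj_mod_two_power: "\<exists>j\<ge>j0. (2::int) ^ B dvd int (tri j) - r"
proof (induction B)
  case 0
  then show ?case by auto
next
  case (Suc B)
  then obtain j where j: "j \<ge> j0" "2 ^ B dvd int (tri j) - r" by blast
  then obtain q where q: "int (tri j) - r = 2 ^ B * q" by blast
  show ?case
  proof (cases "even q")
    case True
    then show ?thesis using j q by (intro exI[of _ j]) (auto elim!: evenE)
  next
    case False
    have "2 * tri (2 * 2 ^ B) = 2 * (2 ^ B * (2 * 2 ^ B + 1))"
      unfolding two_tri by simp
    then have t: "tri (2 * 2 ^ B) = 2 ^ B * (2 * 2 ^ B + 1)" by linarith
    have "int (tri (j + 2 * 2 ^ B)) - r = 2 ^ B * (q + 2 * int j + (2 * 2 ^ B + 1))"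
      unfolding tri_add t using q by (simp add: algebra_simps)
    moreover have "even (q + 2 * int j + (2 * 2 ^ B + 1))" using False by simp
    ultimately have "2 ^ Suc B dvd int (tri (j + 2 * 2 ^ B)) - r"
      by (auto elim!: evenE)
    then show ?thesis using j by (intro exI[of _ "j + 2 * 2 ^ B"]) auto
  qed
qed

lemma int_poly_diff_dvd: "x - y dvd poly p x - poly p (y::int)"
proof (induction p)
  case (pCons a p)
  have "poly (pCons a p) x - poly (pCons a p) y = x * (poly p x - poly p y) + (x - y) * poly p y"
    by (simp add: algebra_simps)
  then show ?case using pCons.IH by (simp add: dvd_add)
qed simp

lemma no_recurrence_sparse_parity:
  fixes d :: "nat \<Rightarrow> int" and \<gamma> :: "nat \<Rightarrow> int poly"
  assumes parity: "\<And>v. odd (d v) \<longleftrightarrow> (\<exists>k\<ge>3. v + 3 = tri k)"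
    and nz: "\<exists>h\<le>H. \<gamma> h \<noteq> 0"
  shows "\<not> (\<forall>v\<ge>v0. (\<Sum>h\<le>H. poly (\<gamma> h) (int v) * d (v - h)) = 0)"
proof
  assume rec: "\<forall>v\<ge>v0. (\<Sum>h\<le>H. poly (\<gamma> h) (int v) * d (v - h)) = 0"
  obtain h1 where h1: "h1 \<le> H" "\<gamma> h1 \<noteq> 0" using nz by blast
  have "finite {x. poly (\<gamma> h1) x = 0}" using h1(2) by (rule poly_roots_finite)
  then have "\<not> range int \<subseteq> {x. poly (\<gamma> h1) x = 0}"
    using finite_subset range_inj_infinite[of int] by (metis inj_of_nat)
  then obtain v1 :: nat where v1: "poly (\<gamma> h1) (int v1) \<noteq> 0" by blast
  \<comment> \<open>The power of 2 is split off from the values of the coefficients at the fixed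
    place \<open>v1\<close>, not from the polynomials themselves. A polynomial with integer
    coefficients respects congruences, so the valuations below \<open>Suc b\<close> are the same at
    every place congruent to \<open>v1\<close> modulo \<open>2 ^ Suc b\<close>.\<close>
  define P where "P b \<longleftrightarrow> (\<forall>h\<le>H. (2::int) ^ b dvd poly (\<gamma> h) (int v1))" for b
  have "\<not> P (nat \<bar>poly (\<gamma> h1) (int v1)\<bar>)"
  proof
    let ?y = "poly (\<gamma> h1) (int v1)"
    assume "P (nat \<bar>?y\<bar>)"
    then have "2 ^ nat \<bar>?y\<bar> dvd ?y" using h1 by (simp add: P_def)
    from dvd_imp_le_int[OF v1 this] have "2 ^ nat \<bar>?y\<bar> \<le> \<bar>?y\<bar>" by simp
    moreover have "int (nat \<bar>?y\<bar>) < 2 ^ nat \<bar>?y\<bar>" by (rule of_nat_less_two_power)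
    ultimately show False by simp
  qed
  then obtain b where b: "P b" "\<not> P (Suc b)"
    using exists_least_iff[of "\<lambda>b. \<not> P b"] by (metis P_def dvd_triv_left lessI not0_implies_Suc one_dvd power_0)
  then obtain h0 where h0: "h0 \<le> H" "\<not> 2 ^ Suc b dvd poly (\<gamma> h0) (int v1)" by (auto simp: P_def)
  \<comment> \<open>The residue makes \<open>v = tri j - 3 + h0\<close> congruent to
    \<open>v1\<close>, so that the term of \<open>h0\<close> falls on an odd value of
    \<open>d\<close>. The size of \<open>j\<close> keeps every other triangular number out of the
    window of the recurrence.\<close>
  obtain j where j: "j \<ge> H + v0 + 3" "(2::int) ^ Suc b dvd int (tri j) - (int v1 - int h0 + 3)"
    using tri_surj_mod_two_power by blast
  have trij: "j \<le> tri j" for j by (induction j) auto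
  define v where "v = tri j - 3 + h0"
  have v: "v \<ge> v0" "v \<ge> H" "v - h0 + 3 = tri j" "int v = int (tri j) - 3 + int h0"
    using j(1) trij[of j] by (auto simp: v_def)
  have "2 ^ Suc b dvd int v - int v1"
  proof -
    have "int v - int v1 = int (tri j) - (int v1 - int h0 + 3)" using v(4) by linarith
    then show ?thesis using j(2) by (simp only:)
  qed
  then have cong: "2 ^ Suc b dvd poly (\<gamma> h) (int v) - poly (\<gamma> h) (int v1)" for h
    using int_poly_diff_dvd dvd_trans by blast
  have congb: "2 ^ b dvd poly (\<gamma> h) (int v)" if "h \<le> H" for h
  proof -
    have "2 ^ b dvd poly (\<gamma> h) (int v) - poly (\<gamma> h) (int v1)"
      using cong[of h] by (rule dvd_trans[rotated]) simp
    moreover have "2 ^ b dvd poly (\<gamma> h) (int v1)" using b(1) that by (auto simp: P_def)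
    ultimately show ?thesis by (metis diff_add_cancel dvd_add)
  qed
  have ev: "even (d (v - h))" if "h \<le> H" "h \<noteq> h0" for h
  proof (rule ccontr)
    assume "\<not> even (d (v - h))"
    then obtain k where k: "v - h + 3 = tri k" using parity by blast
    have vh: "int (v - h) = int v - int h" using that v by simp
    have "int (tri k) = int (tri j) + int h0 - int h" using k vh v(4) by linarith
    then have "tri k = tri j + (h0 - h) \<and> h \<le> h0 \<or> tri j = tri k + (h - h0) \<and> h0 \<le> h" by linarith
    moreover have "h0 - h < j" "h - h0 < j" using that j(1) h0(1) by auto
    ultimately have "k = j" using tri_near by blast
    then show False using \<open>int (tri k) = _\<close> that by simp
  qed
  \<comment> \<open>Each remaining term is a multiple of \<open>2 ^ b\<close> times an even number,
    so the term of \<open>h0\<close> alone would have to be divisible by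
    \<open>2 ^ Suc b\<close>.\<close>
  have rest: "2 ^ Suc b dvd (\<Sum>h\<in>{..H} - {h0}. poly (\<gamma> h) (int v) * d (v - h))"
  proof (rule dvd_sum)
    fix h assume "h \<in> {..H} - {h0}"
    then have "2 ^ b dvd poly (\<gamma> h) (int v)" "2 dvd d (v - h)" using congb ev by auto
    then have "2 ^ b * 2 dvd poly (\<gamma> h) (int v) * d (v - h)" by (rule mult_dvd_mono)
    then show "2 ^ Suc b dvd poly (\<gamma> h) (int v) * d (v - h)" by (simp add: mult.commute)
  qed
  have "(\<Sum>h\<le>H. poly (\<gamma> h) (int v) * d (v - h))
      = poly (\<gamma> h0) (int v) * d (v - h0) + (\<Sum>h\<in>{..H} - {h0}. poly (\<gamma> h) (int v) * d (v - h))"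
    using h0(1) by (simp add: sum.remove)
  also have "(\<Sum>h\<le>H. poly (\<gamma> h) (int v) * d (v - h)) = 0" using rec v(1) by blast
  finally have "2 ^ Suc b dvd poly (\<gamma> h0) (int v) * d (v - h0)"
    using rest by (metis add_eq_0_iff dvd_minus_iff)
  moreover have "odd (d (v - h0))" using v(3) j(1) parity[of "v - h0"] by (auto intro!: exI[of _ j])
  ultimately have "2 ^ Suc b dvd poly (\<gamma> h0) (int v)"
    by (metis coprime_dvd_mult_left_iff coprime_power_left_iff coprime_left_2_iff_odd)
  then have "2 ^ Suc b dvd poly (\<gamma> h0) (int v1)"
    using cong[of h0] by (metis add_diff_cancel_left' diff_add_cancel dvd_diff)
  then show False using h0(2) by blast
qed

lemma not_both_P_recursive:
  fixes a b :: "nat \<Rightarrow> int"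
  assumes "0 < c"
    and "\<And>v. odd (a (c * v) - b (c * v)) \<longleftrightarrow> (\<exists>k\<ge>3. v + 3 = tri k)"
  shows "\<not> P_recursive a \<or> \<not> P_recursive b"
  using P_recursive_diff_subsequence[of a b c] assms
    no_recurrence_sparse_parity[of "\<lambda>v. a (c * v) - b (c * v)"]
  by blast

section \<open>Occurrences of patterns\<close>

text \<open>The increasing enumeration of the natural numbers other than \<open>z\<close>; it makes
  room for an empty line at position \<open>z\<close>.\<close>

definition skip :: "nat \<Rightarrow> nat \<Rightarrow> nat" where
  "skip z i = (if i < z then i else Suc i)"

definition plain_pattern :: "nat \<Rightarrow> (nat \<Rightarrow> nat) \<Rightarrow> pattern" where
  "plain_pattern m f = (m, m, {(i, f i) | i. i < m})"

definition zero_row_pattern :: "nat \<Rightarrow> (nat \<Rightarrow> nat) \<Rightarrow> nat \<Rightarrow> pattern" where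
  "zero_row_pattern m f z = (Suc m, m, {(skip z i, f i) | i. i < m})"

definition zero_col_pattern :: "nat \<Rightarrow> (nat \<Rightarrow> nat) \<Rightarrow> nat \<Rightarrow> pattern" where
  "zero_col_pattern m f z = (m, Suc m, {(i, skip z (f i)) | i. i < m})"

text \<open>Occurrences in one-line notation: only the rows are chosen, and the columns are the
  values of \<open>\<sigma>\<close> at these rows.\<close>

definition occ :: "nat \<Rightarrow> (nat \<Rightarrow> nat) \<Rightarrow> nat \<Rightarrow> (nat \<Rightarrow> nat) \<Rightarrow> (nat \<Rightarrow> nat) \<Rightarrow> bool" where
  "occ n \<sigma> m f r \<longleftrightarrow> strict_mono_on {..<m} r \<and> (\<forall>i<m. r i < n) \<and>
     (\<forall>i<m. \<forall>j<m. f i < f j \<longrightarrow> \<sigma> (r i) < \<sigma> (r j))"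

lemma skip_strict: "skip z i < skip z j \<longleftrightarrow> i < j"
  by (auto simp: skip_def)

lemma skip_eq [simp]: "skip z i = skip z j \<longleftrightarrow> i = j"
  by (auto simp: skip_def)

lemma skip_neq [simp]: "skip z i \<noteq> z" "z \<noteq> skip z i"
  by (auto simp: skip_def)

lemma skip_less: "i < m \<Longrightarrow> skip z i < Suc m"
  by (auto simp: skip_def)

lemma skip_cases:
  assumes "k < Suc m" "z \<le> m" "k \<noteq> z"
  obtains i where "i < m" "k = skip z i"
proof (cases "k < z")
  case True
  then show ?thesis using assms by (intro that[of k]) (auto simp: skip_def)
next
  case False
  then show ?thesis using assms by (intro that[of "k - 1"]) (auto simp: skip_def)
qed

lemma pattern_sizes:
  "prows (plain_pattern m f) = m" "pcols (plain_pattern m f) = m"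
  "prows (zero_row_pattern m f z) = Suc m" "pcols (zero_row_pattern m f z) = m"
  "prows (zero_col_pattern m f z) = m" "pcols (zero_col_pattern m f z) = Suc m"
  by (simp_all add: plain_pattern_def zero_row_pattern_def zero_col_pattern_def prows_def pcols_def)

lemma pattern_ones:
  "pones (plain_pattern m f) = {(i, f i) | i. i < m}"
  "pones (zero_row_pattern m f z) = {(skip z i, f i) | i. i < m}"
  "pones (zero_col_pattern m f z) = {(i, skip z (f i)) | i. i < m}"
  by (simp_all add: plain_pattern_def zero_row_pattern_def zero_col_pattern_def pones_def)

lemma partial_patterns:
  assumes f: "bij_betw f {..<m} {..<m}"
  shows "partial_pattern (plain_pattern m f)" "partial_pattern (zero_row_pattern m f z)"
    "partial_pattern (zero_col_pattern m f z)"
proof -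
  have r: "f i < m" if "i < m" for i using f that by (auto simp: bij_betw_def)
  have inj: "i = j" if "f i = f j" "i < m" "j < m" for i j
    using f that by (auto simp: bij_betw_def dest: inj_onD)
  show "partial_pattern (plain_pattern m f)"
    unfolding partial_pattern_def pattern_sizes pattern_ones using r inj by auto
  show "partial_pattern (zero_row_pattern m f z)"
    unfolding partial_pattern_def pattern_sizes pattern_ones
    using r inj skip_less[of _ m z] by (auto simp: subset_iff)
  show "partial_pattern (zero_col_pattern m f z)"
    unfolding partial_pattern_def pattern_sizes pattern_ones
    using r inj skip_less[of _ m z] by (auto simp: subset_iff)
qed

lemma strict_mono_on_insert:
  assumes r: "strict_mono_on {..<m} r" and z: "z \<le> m"
    and below: "\<And>i. i < m \<Longrightarrow> i < z \<Longrightarrow> r i < x" and above: "\<And>i. i < m \<Longrightarrow> z \<le> i \<Longrightarrow> x < r i"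
    and r': "\<And>i. i < m \<Longrightarrow> r' (skip z i) = r i" "r' z = x"
  shows "strict_mono_on {..<Suc m} r'"
proof (rule strict_mono_onI)
  fix a b assume "a \<in> {..<Suc m}" "b \<in> {..<Suc m}" and ab: "a < b"
  then have a: "a < Suc m" and b: "b < Suc m" by auto
  show "r' a < r' b"
  proof (cases "a = z")
    case True
    with ab obtain i where i: "i < m" "b = skip z i" using skip_cases[OF b z] by blast
    with True ab have "z \<le> i" by (auto simp: skip_def split: if_splits)
    then show ?thesis using True i r' above by simp
  next
    case False
    then obtain i where i: "i < m" "a = skip z i" using skip_cases[OF a z] by blast
    show ?thesis
    proof (cases "b = z")
      case True
      with i ab have "i < z" by (auto simp: skip_def split: if_splits)
      then show ?thesis using True i r' below by simp
    next
      case False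
      then obtain j where j: "j < m" "b = skip z j" using skip_cases[OF b z] by blast
      with i ab have "i < j" by (simp add: skip_strict)
      then show ?thesis using i j r' r by (auto simp: strict_mono_on_def)
    qed
  qed
qed

section \<open>Submatrices and order-isomorphic occurrences\<close>

lemma containsI:
  assumes "strict_mono_on {..<prows L} r" "\<And>i. i < prows L \<Longrightarrow> r i < n"
    "strict_mono_on {..<pcols L} c" "\<And>j. j < pcols L \<Longrightarrow> c j < n"
    "\<And>i j. i < prows L \<Longrightarrow> j < pcols L \<Longrightarrow> \<sigma> (r i) = c j \<longleftrightarrow> (i, j) \<in> pones L"
  shows "contains n \<sigma> L"
  unfolding contains_def image_subset_iff
  by (intro exI[of _ r] exI[of _ c] conjI ballI allI impI) (use assms in \<open>simp_all only: lessThan_iff\<close>)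

definition embeds :: "nat \<Rightarrow> (nat \<Rightarrow> nat) \<Rightarrow> pattern \<Rightarrow> (nat \<Rightarrow> nat) \<Rightarrow> (nat \<Rightarrow> nat) \<Rightarrow> bool" where
  "embeds n \<sigma> L r c \<longleftrightarrow> (\<forall>i j. i < j \<longrightarrow> j < prows L \<longrightarrow> r i < r j) \<and> (\<forall>i<prows L. r i < n) \<and>
     (\<forall>i j. i < j \<longrightarrow> j < pcols L \<longrightarrow> c i < c j) \<and> (\<forall>j<pcols L. c j < n) \<and>
     (\<forall>i j. i < prows L \<longrightarrow> j < pcols L \<longrightarrow> (i, j) \<in> pones L \<longrightarrow> \<sigma> (r i) = c j)"

lemma containsD:
  assumes "contains n \<sigma> L"
  shows "\<exists>r c. embeds n \<sigma> L r c"
proof -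
  obtain r c where rc: "strict_mono_on {..<prows L} r" "r ` {..<prows L} \<subseteq> {..<n}"
    "strict_mono_on {..<pcols L} c" "c ` {..<pcols L} \<subseteq> {..<n}"
    "\<forall>i<prows L. \<forall>j<pcols L. (\<sigma> (r i) = c j) \<longleftrightarrow> (i, j) \<in> pones L"
    using assms unfolding contains_def by (elim exE conjE) (rule that)
  have "r i < r j" if "i < j" "j < prows L" for i j
    using strict_mono_onD[OF rc(1), of i j] that by simp
  moreover have "r i < n" if "i < prows L" for i using rc(2) that by blast
  moreover have "c i < c j" if "i < j" "j < pcols L" for i j
    using strict_mono_onD[OF rc(3), of i j] that by simp
  moreover have "c i < n" if "i < pcols L" for i using rc(4) that by blast
  moreover have "\<sigma> (r i) = c j" if "i < prows L" "j < pcols L" "(i, j) \<in> pones L" for i j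
    using rc(5) that by simp
  ultimately show ?thesis
    unfolding embeds_def by (intro exI[of _ r] exI[of _ c] conjI allI impI)
qed

lemma occI:
  assumes "\<And>i j. i < j \<Longrightarrow> j < m \<Longrightarrow> r i < r j" "\<And>i. i < m \<Longrightarrow> r i < n"
    "\<And>i j. i < m \<Longrightarrow> j < m \<Longrightarrow> f i < f j \<Longrightarrow> \<sigma> (r i) < \<sigma> (r j)"
  shows "occ n \<sigma> m f r"
  unfolding occ_def strict_mono_on_def using assms by blast

lemma occ_mono: "occ n \<sigma> m f r \<Longrightarrow> i < j \<Longrightarrow> j < m \<Longrightarrow> r i < r j"
  unfolding occ_def strict_mono_on_def by (meson lessThan_iff less_trans)

lemma occ_less: "occ n \<sigma> m f r \<Longrightarrow> i < m \<Longrightarrow> r i < n"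
  unfolding occ_def by blast

lemma occ_value: "occ n \<sigma> m f r \<Longrightarrow> i < m \<Longrightarrow> j < m \<Longrightarrow> f i < f j \<Longrightarrow> \<sigma> (r i) < \<sigma> (r j)"
  unfolding occ_def by blast

lemma occ_inj: "occ n \<sigma> m f r \<Longrightarrow> i < m \<Longrightarrow> j < m \<Longrightarrow> r i = r j \<longleftrightarrow> i = j"
  using occ_mono[of n \<sigma> m f r i j] occ_mono[of n \<sigma> m f r j i] by (cases i j rule: linorder_cases) auto

lemma permutes_lessThan_iff: "\<sigma> permutes {..<n} \<Longrightarrow> \<sigma> i < n \<longleftrightarrow> i < (n::nat)"
  using permutes_in_image[of \<sigma> "{..<n}" i] by simp

lemma permutes_eq_iff: "\<sigma> permutes S \<Longrightarrow> \<sigma> i = \<sigma> j \<longleftrightarrow> i = j"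
  using permutes_inj[of \<sigma> S] by (simp add: inj_eq)

lemma bij_entry_less: "bij_betw f {..<m} {..<m} \<Longrightarrow> i < m \<Longrightarrow> f i < (m::nat)"
  by (auto simp: bij_betw_def)

lemma bij_inverse:
  assumes f: "bij_betw f {..<m} {..<m::nat}"
  shows "\<exists>g. \<forall>j<m. g j < m \<and> f (g j) = j \<and> g (f j) = j"
proof (intro exI allI impI)
  fix j assume j: "j < m"
  show "inv_into {..<m} f j < m \<and> f (inv_into {..<m} f j) = j \<and> inv_into {..<m} f (f j) = j"
    using bij_betw_inv_into[OF f] bij_betw_inv_into_right[OF f, of j] bij_betw_inv_into_left[OF f, of j] j
    by (auto simp: bij_betw_def)
qed

context
  fixes n m :: nat and \<sigma> f :: "nat \<Rightarrow> nat"
  assumes \<sigma>: "\<sigma> permutes {..<n}" and f: "bij_betw f {..<m} {..<m}"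
begin

lemma contains_plain: "contains n \<sigma> (plain_pattern m f) \<longleftrightarrow> (\<exists>r. occ n \<sigma> m f r)"
proof
  assume "contains n \<sigma> (plain_pattern m f)"
  then obtain r c where "embeds n \<sigma> (plain_pattern m f) r c"
    using containsD by blast
  note rc0 = this[unfolded embeds_def pattern_sizes pattern_ones]
  have rc: "\<And>i j. i < j \<Longrightarrow> j < m \<Longrightarrow> r i < r j" "\<And>i. i < m \<Longrightarrow> r i < n"
    "\<And>i j. i < j \<Longrightarrow> j < m \<Longrightarrow> c i < c j" "\<And>j. j < m \<Longrightarrow> c j < n"
    "\<And>i j. i < m \<Longrightarrow> j < m \<Longrightarrow> (i, j) \<in> {(i, f i) | i. i < m} \<Longrightarrow> \<sigma> (r i) = c j"
    using rc0 by blast+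
  have v: "\<sigma> (r i) = c (f i)" if "i < m" for i
    by (rule rc(5)) (use that bij_entry_less[OF f] in auto)
  have "occ n \<sigma> m f r"
  proof (rule occI)
    show "\<sigma> (r i) < \<sigma> (r j)" if "i < m" "j < m" "f i < f j" for i j
      unfolding v[OF that(1)] v[OF that(2)] by (rule rc(3)[OF that(3) bij_entry_less[OF f that(2)]])
  qed (fact rc)+
  then show "\<exists>r. occ n \<sigma> m f r" by blast
next
  assume "\<exists>r. occ n \<sigma> m f r"
  then obtain r where r: "occ n \<sigma> m f r" by blast
  obtain g where "\<forall>j<m. g j < m \<and> f (g j) = j \<and> g (f j) = j"
    using bij_inverse[OF f] by blast
  then have g: "g j < m" "f (g j) = j" "g (f j) = j" if "j < m" for j
    using that by auto
  define c where "c j = \<sigma> (r (g j))" for j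
  have "strict_mono_on {..<m} r"
    by (rule strict_mono_onI) (use occ_mono[OF r] in auto)
  moreover have "strict_mono_on {..<m} c"
    by (rule strict_mono_onI) (use occ_value[OF r] g in \<open>auto simp: c_def\<close>)
  moreover have "(\<sigma> (r i) = c j) \<longleftrightarrow> (i, j) \<in> {(i, f i) | i. i < m}" if "i < m" "j < m" for i j
    using that g occ_inj[OF r] by (auto simp: c_def permutes_eq_iff[OF \<sigma>])
  moreover have "r i < n" if "i < m" for i using occ_less[OF r that] .
  moreover have "c j < n" if "j < m" for j
    using occ_less[OF r g(1)[OF that]] by (simp add: c_def permutes_lessThan_iff[OF \<sigma>])
  ultimately show "contains n \<sigma> (plain_pattern m f)"
    by (intro containsI[of _ "r" _ "c"]; unfold pattern_sizes pattern_ones)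
qed

text \<open>The empty row may be any further row \<open>x\<close> in the prescribed gap: as
  \<open>x\<close> differs from all \<open>r i\<close>, its 1 lies in none of the chosen
  columns.\<close>

lemma contains_zero_row:
  assumes z: "z \<le> m"
  shows "contains n \<sigma> (zero_row_pattern m f z) \<longleftrightarrow>
    (\<exists>r x. occ n \<sigma> m f r \<and> x < n \<and> (\<forall>i<m. if i < z then r i < x else x < r i))"
proof
  assume "contains n \<sigma> (zero_row_pattern m f z)"
  then obtain r c where "embeds n \<sigma> (zero_row_pattern m f z) r c"
    using containsD by blast
  note rc0 = this[unfolded embeds_def pattern_sizes pattern_ones]
  have rc: "\<And>i j. i < j \<Longrightarrow> j < Suc m \<Longrightarrow> r i < r j" "\<And>i. i < Suc m \<Longrightarrow> r i < n"
    "\<And>i j. i < j \<Longrightarrow> j < m \<Longrightarrow> c i < c j" "\<And>j. j < m \<Longrightarrow> c j < n"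
    "\<And>i j. i < Suc m \<Longrightarrow> j < m \<Longrightarrow> (i, j) \<in> {(skip z i, f i) | i. i < m} \<Longrightarrow> \<sigma> (r i) = c j"
    using rc0 by blast+
  define r' where "r' i = r (skip z i)" for i
  have v: "\<sigma> (r' i) = c (f i)" if "i < m" for i
    unfolding r'_def by (rule rc(5)) (use that bij_entry_less[OF f] skip_less[OF that] in auto)
  have "occ n \<sigma> m f r'"
  proof (rule occI)
    show "r' i < r' j" if "i < j" "j < m" for i j
      unfolding r'_def by (rule rc(1)) (use that skip_less skip_strict in auto)
    show "r' i < n" if "i < m" for i unfolding r'_def by (rule rc(2)[OF skip_less[OF that]])
    show "\<sigma> (r' i) < \<sigma> (r' j)" if "i < m" "j < m" "f i < f j" for i j
      unfolding v[OF that(1)] v[OF that(2)] by (rule rc(3)[OF that(3) bij_entry_less[OF f that(2)]])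
  qed
  moreover have "if i < z then r' i < r z else r z < r' i" if "i < m" for i
    using that z by (auto simp: r'_def skip_def intro: rc(1))
  moreover have "r z < n" using rc(2) z by simp
  ultimately show "\<exists>r x. occ n \<sigma> m f r \<and> x < n \<and> (\<forall>i<m. if i < z then r i < x else x < r i)"
    by blast
next
  assume "\<exists>r x. occ n \<sigma> m f r \<and> x < n \<and> (\<forall>i<m. if i < z then r i < x else x < r i)"
  then obtain r x where r: "occ n \<sigma> m f r" and x: "x < n" "\<And>i. i < m \<Longrightarrow> if i < z then r i < x else x < r i"
    by blast
  obtain g where "\<forall>j<m. g j < m \<and> f (g j) = j \<and> g (f j) = j"
    using bij_inverse[OF f] by blast
  then have g: "g j < m" "f (g j) = j" "g (f j) = j" if "j < m" for j
    using that by auto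
  define c where "c j = \<sigma> (r (g j))" for j
  define r' where "r' i = (if i = z then x else r (if i < z then i else i - 1))" for i
  have r': "r' (skip z i) = r i" "r' z = x" for i
    by (auto simp: r'_def skip_def)
  have xr: "x \<noteq> r i" if "i < m" for i using x(2)[OF that] by (auto split: if_splits)
  have "strict_mono_on {..<m} r"
    by (rule strict_mono_onI) (use occ_mono[OF r] in auto)
  then have "strict_mono_on {..<Suc m} r'"
    by (rule strict_mono_on_insert[of m r z x r'])
      (use z r' x(2) in \<open>simp_all add: not_less split: if_splits\<close>)
  moreover have "strict_mono_on {..<m} c"
    by (rule strict_mono_onI) (use occ_value[OF r] g in \<open>auto simp: c_def\<close>)
  moreover have "r' k < n" if k: "k < Suc m" for k
  proof (cases "k = z")
    case False
    then obtain i where "i < m" "k = skip z i" using skip_cases[OF k z] by blast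
    then show ?thesis using occ_less[OF r] r' by simp
  qed (use x r' in simp)
  moreover have "c j < n" if "j < m" for j
    using occ_less[OF r g(1)[OF that]] by (simp add: c_def permutes_lessThan_iff[OF \<sigma>])
  moreover have "(\<sigma> (r' k) = c j) \<longleftrightarrow> (k, j) \<in> {(skip z i, f i) | i. i < m}" if k: "k < Suc m" and j: "j < m" for k j
  proof (cases "k = z")
    case True
    then show ?thesis using xr[OF g(1)[OF j]] by (auto simp: r' c_def permutes_eq_iff[OF \<sigma>])
  next
    case False
    then obtain i where "i < m" "k = skip z i" using skip_cases[OF k z] by blast
    then show ?thesis using j g occ_inj[OF r] by (auto simp: c_def permutes_eq_iff[OF \<sigma>] r')
  qed
  ultimately show "contains n \<sigma> (zero_row_pattern m f z)"
    by (intro containsI[of _ "r'" _ "c"]; unfold pattern_sizes pattern_ones)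
qed

lemma contains_zero_col:
  assumes z: "z \<le> m"
  shows "contains n \<sigma> (zero_col_pattern m f z) \<longleftrightarrow>
    (\<exists>r y. occ n \<sigma> m f r \<and> y < n \<and> (\<forall>i<m. if f i < z then \<sigma> (r i) < y else y < \<sigma> (r i)))"
proof
  assume "contains n \<sigma> (zero_col_pattern m f z)"
  then obtain r c where "embeds n \<sigma> (zero_col_pattern m f z) r c"
    using containsD by blast
  note rc0 = this[unfolded embeds_def pattern_sizes pattern_ones]
  have rc: "\<And>i j. i < j \<Longrightarrow> j < m \<Longrightarrow> r i < r j" "\<And>i. i < m \<Longrightarrow> r i < n"
    "\<And>i j. i < j \<Longrightarrow> j < Suc m \<Longrightarrow> c i < c j" "\<And>j. j < Suc m \<Longrightarrow> c j < n"
    "\<And>i j. i < m \<Longrightarrow> j < Suc m \<Longrightarrow> (i, j) \<in> {(i, skip z (f i)) | i. i < m} \<Longrightarrow> \<sigma> (r i) = c j"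
    using rc0 by blast+
  have v: "\<sigma> (r i) = c (skip z (f i))" if "i < m" for i
    by (rule rc(5)) (use that skip_less[OF bij_entry_less[OF f that]] in auto)
  have "occ n \<sigma> m f r"
  proof (rule occI)
    show "\<sigma> (r i) < \<sigma> (r j)" if "i < m" "j < m" "f i < f j" for i j
      unfolding v[OF that(1)] v[OF that(2)]
      by (rule rc(3)) (use that skip_strict skip_less[OF bij_entry_less[OF f]] in auto)
  qed (fact rc)+
  moreover have "if f i < z then \<sigma> (r i) < c z else c z < \<sigma> (r i)" if "i < m" for i
    using bij_entry_less[OF f that] z by (auto simp: v[OF that] skip_def intro: rc(3))
  moreover have "c z < n" using rc(4) z by simp
  ultimately show "\<exists>r y. occ n \<sigma> m f r \<and> y < n \<and> (\<forall>i<m. if f i < z then \<sigma> (r i) < y else y < \<sigma> (r i))"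
    by blast
next
  assume "\<exists>r y. occ n \<sigma> m f r \<and> y < n \<and> (\<forall>i<m. if f i < z then \<sigma> (r i) < y else y < \<sigma> (r i))"
  then obtain r y where r: "occ n \<sigma> m f r"
    and y: "y < n" "\<And>i. i < m \<Longrightarrow> if f i < z then \<sigma> (r i) < y else y < \<sigma> (r i)"
    by blast
  obtain g where "\<forall>j<m. g j < m \<and> f (g j) = j \<and> g (f j) = j"
    using bij_inverse[OF f] by blast
  then have g: "g j < m" "f (g j) = j" "g (f j) = j" if "j < m" for j
    using that by auto
  define c where "c j = \<sigma> (r (g j))" for j
  define c' where "c' i = (if i = z then y else c (if i < z then i else i - 1))" for i
  have c': "c' (skip z i) = c i" "c' z = y" for i
    by (auto simp: c'_def skip_def)
  have cy: "if j < z then c j < y else y < c j" if "j < m" for j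
    using y(2)[OF g(1)[OF that]] g(2)[OF that] by (simp add: c_def)
  have yr: "\<sigma> (r i) \<noteq> y" if "i < m" for i using y(2)[OF that] by (auto split: if_splits)
  have "strict_mono_on {..<m} c"
    by (rule strict_mono_onI) (use occ_value[OF r] g in \<open>auto simp: c_def\<close>)
  then have "strict_mono_on {..<Suc m} c'"
    by (rule strict_mono_on_insert[of m c z y c'])
      (use z c' cy in \<open>simp_all add: not_less split: if_splits\<close>)
  moreover have "strict_mono_on {..<m} r"
    by (rule strict_mono_onI) (use occ_mono[OF r] in auto)
  moreover have "r i < n" if "i < m" for i using occ_less[OF r that] .
  moreover have "c' k < n" if k: "k < Suc m" for k
  proof (cases "k = z")
    case False
    then obtain i where "i < m" "k = skip z i" using skip_cases[OF k z] by blast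
    then show ?thesis using occ_less[OF r] g(1) c' by (simp add: c_def permutes_lessThan_iff[OF \<sigma>])
  qed (use y c' in simp)
  moreover have "(\<sigma> (r i) = c' j) \<longleftrightarrow> (i, j) \<in> {(i, skip z (f i)) | i. i < m}" if i: "i < m" and j: "j < Suc m" for i j
  proof (cases "j = z")
    case True
    then show ?thesis using yr[OF i] by (auto simp: c')
  next
    case False
    then obtain k where "k < m" "j = skip z k" using skip_cases[OF j z] by blast
    then show ?thesis using i g occ_inj[OF r] by (auto simp: c_def permutes_eq_iff[OF \<sigma>] c')
  qed
  ultimately show "contains n \<sigma> (zero_col_pattern m f z)"
    by (intro containsI[of _ "r" _ "c'"]; unfold pattern_sizes pattern_ones)
qed

end

section \<open>Letters and blocks\<close>

text \<open>Simple permutations, each containing the pattern 4321. Their roles are: 0 the first letter of the queue,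
  1 a plain letter, 2 a marker, 3 a separator, 4 and 5 the two variants of a pointer, 6 the end of the run.\<close>

definition letter :: "nat \<Rightarrow> nat \<Rightarrow> nat" where
  "letter \<tau> i = [[1,3,6,4,2,0,5], [1,5,3,6,2,0,4], [1,6,2,5,3,0,4], [1,6,3,5,0,4,2],
     [1,6,3,5,2,0,4], [1,6,4,0,3,5,2], [1,6,4,2,0,3,5]] ! \<tau> ! i"

text \<open>The finite computations behind the choice of the letters. Simplicity (no proper interval
  of at least two positions carries an interval of values) controls overlaps of occurrences with
  blocks; a descent of length 4 cannot be spread over three increasing chains of blocks;
  distinctness lets the type be read off a block.\<close>

lemma letter_checks:
  "list_all (\<lambda>\<tau>. list_all (\<lambda>i. letter \<tau> i < 7) [0..<7] \<and> distinct (map (letter \<tau>) [0..<7])) [0..<7]"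
  "list_all (\<lambda>\<tau>. list_all (\<lambda>a. list_all (\<lambda>b. a < b \<longrightarrow> \<not> (a = 0 \<and> b = 6) \<longrightarrow>
      list_ex (\<lambda>i. (i < a \<or> b < i) \<and> list_ex (\<lambda>j. a \<le> j \<and> j \<le> b \<and> letter \<tau> j < letter \<tau> i) [0..<7]
        \<and> list_ex (\<lambda>j. a \<le> j \<and> j \<le> b \<and> letter \<tau> i < letter \<tau> j) [0..<7]) [0..<7]) [0..<7]) [0..<7]) [0..<7]"
  "list_all (\<lambda>\<tau>. list_ex (\<lambda>i. list_ex (\<lambda>j. list_ex (\<lambda>k. list_ex (\<lambda>l. i < j \<and> j < k \<and> k < l \<and>
      letter \<tau> l < letter \<tau> k \<and> letter \<tau> k < letter \<tau> j \<and> letter \<tau> j < letter \<tau> i) [0..<7]) [0..<7]) [0..<7]) [0..<7]) [0..<7]"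
  "distinct (map (\<lambda>\<tau>. map (letter \<tau>) [0..<7]) [0..<7])"
  by code_simp+

lemma letter_less: "\<tau> < 7 \<Longrightarrow> i < 7 \<Longrightarrow> letter \<tau> i < 7"
  using letter_checks(1) by (auto simp: list_all_iff)

lemma letter_bij: "\<tau> < 7 \<Longrightarrow> bij_betw (letter \<tau>) {..<7} {..<7}"
proof -
  assume "\<tau> < 7"
  then have "inj_on (letter \<tau>) {..<7}" "letter \<tau> ` {..<7} \<subseteq> {..<7}"
    using letter_checks(1) by (auto simp: list_all_iff distinct_map atLeast0LessThan)
  then show ?thesis
    by (simp add: bij_betw_def endo_inj_surj)
qed

lemma letter_inj: "\<tau> < 7 \<Longrightarrow> i < 7 \<Longrightarrow> j < 7 \<Longrightarrow> letter \<tau> i = letter \<tau> j \<longleftrightarrow> i = j"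
  using letter_bij[of \<tau>] by (auto simp: bij_betw_def dest: inj_onD)

lemma letter_surj: "\<tau> < 7 \<Longrightarrow> v < 7 \<Longrightarrow> \<exists>i<7. letter \<tau> i = v"
proof -
  assume "\<tau> < 7" "v < 7"
  then have "v \<in> letter \<tau> ` {..<7}" using letter_bij[of \<tau>] by (simp add: bij_betw_def)
  then show ?thesis by auto
qed

lemma letter_simple:
  assumes "\<tau> < 7" "a < b" "b < 7"
    and range: "\<And>i. i < 7 \<Longrightarrow> (a \<le> i \<and> i \<le> b) \<longleftrightarrow> (lo \<le> letter \<tau> i \<and> letter \<tau> i \<le> hi)"
  shows "a = 0 \<and> b = 6"
proof (rule ccontr)
  assume "\<not> (a = 0 \<and> b = 6)"
  have "\<exists>i\<in>set [0..<7]. (i < a \<or> b < i) \<and> (\<exists>j\<in>set [0..<7]. a \<le> j \<and> j \<le> b \<and> letter \<tau> j < letter \<tau> i)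
      \<and> (\<exists>j\<in>set [0..<7]. a \<le> j \<and> j \<le> b \<and> letter \<tau> i < letter \<tau> j)"
    by (rule letter_checks(2)[unfolded list_all_iff list_ex_iff, rule_format])
      (use assms(1-3) \<open>\<not> (a = 0 \<and> b = 6)\<close> in auto)
  then obtain i j k where i: "i \<in> set [0..<7]" "i < a \<or> b < i"
    and jk: "j \<in> set [0..<7]" "a \<le> j \<and> j \<le> b" "letter \<tau> j < letter \<tau> i"
      "k \<in> set [0..<7]" "a \<le> k \<and> k \<le> b" "letter \<tau> i < letter \<tau> k"
    by blast
  then have less: "i < 7" "j < 7" "k < 7" by simp_all
  have "lo \<le> letter \<tau> j" "letter \<tau> k \<le> hi" using range[OF less(2)] range[OF less(3)] jk by auto
  then have "lo \<le> letter \<tau> i \<and> letter \<tau> i \<le> hi" using jk by linarith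
  then show False using range[OF less(1)] i(2) by auto
qed

lemma letter_decreasing:
  assumes "\<tau> < 7"
  shows "\<exists>i j k l. i < j \<and> j < k \<and> k < l \<and> l < 7 \<and>
      letter \<tau> l < letter \<tau> k \<and> letter \<tau> k < letter \<tau> j \<and> letter \<tau> j < letter \<tau> i"
  using letter_checks(3) assms unfolding list_all_iff list_ex_iff by (metis atLeastLessThan_iff le0 set_upt)

lemma letter_eqD:
  assumes "\<tau> < 7" "\<tau>' < 7" "\<And>i. i < 7 \<Longrightarrow> letter \<tau> i = letter \<tau>' i"
  shows "\<tau> = \<tau>'"
proof -
  have "map (letter \<tau>) [0..<7] = map (letter \<tau>') [0..<7]" using assms(3) by (intro map_cong) auto
  moreover have "inj_on (\<lambda>\<tau>. map (letter \<tau>) [0..<7]) {0..<7}"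
    using letter_checks(4) unfolding distinct_map by simp
  ultimately show ?thesis using assms(1,2) by (auto dest: inj_onD)
qed

text \<open>A contiguous copy of the letter \<open>\<tau>\<close> with upper left corner
  \<open>(r, c)\<close>.\<close>

definition blk :: "nat \<Rightarrow> (nat \<Rightarrow> nat) \<Rightarrow> nat \<Rightarrow> nat \<Rightarrow> nat \<Rightarrow> bool" where
  "blk n \<sigma> \<tau> r c \<longleftrightarrow> \<tau> < 7 \<and> r + 7 \<le> n \<and> (\<forall>i<7. \<sigma> (r + i) = c + letter \<tau> i)"

definition tight :: "nat \<Rightarrow> (nat \<Rightarrow> nat) \<Rightarrow> bool" where
  "tight n \<sigma> \<longleftrightarrow> (\<forall>\<tau><7. \<forall>s. occ n \<sigma> 7 (letter \<tau>) s \<longrightarrow>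
     (\<forall>i<7. s i = s 0 + i) \<and> (\<exists>c. blk n \<sigma> \<tau> (s 0) c))"

lemma blkD: "blk n \<sigma> \<tau> r c \<Longrightarrow> i < 7 \<Longrightarrow> \<sigma> (r + i) = c + letter \<tau> i"
  by (simp add: blk_def)

lemma blk_letter: "blk n \<sigma> \<tau> r c \<Longrightarrow> \<tau> < 7"
  by (simp add: blk_def)

lemma blk_row: "blk n \<sigma> \<tau> r c \<Longrightarrow> r + 7 \<le> n"
  by (simp add: blk_def)

lemma blk_unique:
  assumes "blk n \<sigma> \<tau> r c" "blk n \<sigma> \<tau>' r c'"
  shows "\<tau> = \<tau>' \<and> c = c'"
proof -
  have \<tau>: "\<tau> < 7" "\<tau>' < 7" using assms by (auto simp: blk_def)
  have eq: "c + letter \<tau> i = c' + letter \<tau>' i" if "i < 7" for i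
    using blkD[OF assms(1) that] blkD[OF assms(2) that] by simp
  obtain i where "i < 7" "letter \<tau> i = 0" using letter_surj[of \<tau> 0] \<tau> by auto
  moreover obtain j where "j < 7" "letter \<tau>' j = 0" using letter_surj[of \<tau>' 0] \<tau> by auto
  ultimately have "c = c'" using eq[of i] eq[of j] by linarith
  then show ?thesis using letter_eqD[of \<tau> \<tau>'] \<tau> eq by auto
qed

lemma occ_block:
  assumes "blk n \<sigma> \<tau> r c"
  shows "occ n \<sigma> 7 (letter \<tau>) (\<lambda>i. r + i)"
  by (rule occI) (use assms in \<open>auto simp: blk_def\<close>)

section \<open>Overlaps of blocks\<close>

context
  fixes n :: nat and \<sigma> :: "nat \<Rightarrow> nat"
  assumes \<sigma>: "\<sigma> permutes {..<n}"
begin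

lemma blk_mem:
  assumes "blk n \<sigma> \<tau> r c"
  shows "(r \<le> x \<and> x < r + 7) \<longleftrightarrow> (c \<le> \<sigma> x \<and> \<sigma> x < c + 7)"
proof
  assume "r \<le> x \<and> x < r + 7"
  then have "\<sigma> (r + (x - r)) = c + letter \<tau> (x - r)" "x - r < 7"
    using blkD[OF assms, of "x - r"] by auto
  then show "c \<le> \<sigma> x \<and> \<sigma> x < c + 7"
    using \<open>r \<le> x \<and> _\<close> letter_less[OF blk_letter[OF assms], of "x - r"] by simp
next
  assume x: "c \<le> \<sigma> x \<and> \<sigma> x < c + 7"
  then have "\<sigma> x - c < 7" by linarith
  then obtain i where i: "i < 7" "letter \<tau> i = \<sigma> x - c"
    using letter_surj[OF blk_letter[OF assms], of "\<sigma> x - c"] by blast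
  then have "\<sigma> (r + i) = \<sigma> x" using blkD[OF assms, of i] x by simp
  then have "r + i = x" using permutes_eq_iff[OF \<sigma>] by simp
  then show "r \<le> x \<and> x < r + 7" using i by auto
qed

lemma blk_cols: "blk n \<sigma> \<tau> r c \<Longrightarrow> c + 7 \<le> n"
proof -
  assume b: "blk n \<sigma> \<tau> r c"
  obtain i where i: "i < 7" "letter \<tau> i = 6" using letter_surj[OF blk_letter[OF b], of 6] by auto
  have "\<sigma> (r + i) < n"
    using permutes_lessThan_iff[OF \<sigma>] blk_row[OF b] i by simp
  then show ?thesis using blkD[OF b i(1)] i by simp
qed

text \<open>By simplicity an occurrence of a letter meets a block in at most one point, or is contained in it.\<close>

lemma occ_meets_block:
  assumes o: "occ n \<sigma> 7 (letter \<tau>) s" "\<tau> < 7" and b: "blk n \<sigma> \<tau>0 r c"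
    and ij: "i < j" "j < 7" "r \<le> s i" "s i < r + 7" "r \<le> s j" "s j < r + 7"
  shows "k < 7 \<Longrightarrow> s k = r + k"
proof -
  \<comment> \<open>\<open>A\<close> collects the positions whose point lies in the block. The block
    is an interval both in rows and in columns, so \<open>A\<close> is an interval of positions that
    carries an interval of values. With two elements it must be everything, and seven increasing
    rows within seven rows leave no freedom.\<close>
  define A where "A = {k. k < 7 \<and> r \<le> s k \<and> s k < r + 7}"
  have A: "finite A" "A \<noteq> {}" "i \<in> A" "j \<in> A" using ij by (auto simp: A_def)
  define lo where "lo = Min (letter \<tau> ` A)"
  define hi where "hi = Max (letter \<tau> ` A)"
  have mono: "s x \<le> s y" if "x \<le> y" "y < 7" for x y
    using occ_mono[OF o(1), of x y] that by (cases "x = y") auto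
  have val: "\<sigma> (s x) \<le> \<sigma> (s y)" if "letter \<tau> x \<le> letter \<tau> y" "x < 7" "y < 7" for x y
    using occ_value[OF o(1), of x y] letter_inj[OF o(2), of x y] that
    by (cases "letter \<tau> x = letter \<tau> y") auto
  have range: "(Min A \<le> k \<and> k \<le> Max A) \<longleftrightarrow> (lo \<le> letter \<tau> k \<and> letter \<tau> k \<le> hi)" if k: "k < 7" for k
  proof
    assume h: "Min A \<le> k \<and> k \<le> Max A"
    have "Min A \<in> A" "Max A \<in> A" using A by auto
    then have "k \<in> A" using mono[of "Min A" k] mono[of k "Max A"] h k by (auto simp: A_def)
    then show "lo \<le> letter \<tau> k \<and> letter \<tau> k \<le> hi" using A by (auto simp: lo_def hi_def)
  next
    assume h: "lo \<le> letter \<tau> k \<and> letter \<tau> k \<le> hi"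
    have "lo \<in> letter \<tau> ` A" "hi \<in> letter \<tau> ` A" using A by (auto simp: lo_def hi_def)
    then obtain x y where xy: "x \<in> A" "lo = letter \<tau> x" "y \<in> A" "hi = letter \<tau> y" by auto
    have "\<sigma> (s x) \<le> \<sigma> (s k)" "\<sigma> (s k) \<le> \<sigma> (s y)"
      using val[of x k] val[of k y] xy h k by (auto simp: A_def)
    moreover have "c \<le> \<sigma> (s x)" "\<sigma> (s y) < c + 7"
      using blk_mem[OF b, of "s x"] blk_mem[OF b, of "s y"] xy by (auto simp: A_def)
    ultimately have "k \<in> A" using blk_mem[OF b, of "s k"] k by (auto simp: A_def)
    then show "Min A \<le> k \<and> k \<le> Max A" using A by auto
  qed
  have "Min A \<le> i" "j \<le> Max A" using A by auto
  then have "Min A < Max A" using ij by linarith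
  moreover have "Max A < 7" using Max_in[OF A(1,2)] by (simp add: A_def)
  ultimately have "Min A = 0 \<and> Max A = 6" by (rule letter_simple[OF o(2) _ _ range])
  then have "0 \<in> A" "6 \<in> A" using Min_in[OF A(1,2)] Max_in[OF A(1,2)] by auto
  then have ends: "r \<le> s 0" "s 6 < r + 7" by (auto simp: A_def)
  have up: "s 0 + k \<le> s k" if "k < 7" for k
    using that
  proof (induction k)
    case (Suc k)
    then show ?case using occ_mono[OF o(1), of k "Suc k"] by simp
  qed simp
  have down: "s k + (6 - k) \<le> s 6" if "k < 7" for k
    using that
  proof (induction "6 - k" arbitrary: k)
    case (Suc d)
    then have k: "k < 6" by simp
    have "s (Suc k) + (6 - Suc k) \<le> s 6" by (rule Suc(1)) (use Suc(2) k in auto)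
    moreover have "s k < s (Suc k)" using occ_mono[OF o(1), of k "Suc k"] k by simp
    ultimately show ?case using k by linarith
  qed (auto dest: le_antisym)
  show "s k = r + k" if "k < 7" using up[OF that] down[OF that] ends that by simp
qed

text \<open>An overlap in at least two rows would make the blocks equal by
  \<open>occ_meets_block\<close>. In an overlap of one row, the two column intervals share a single
  column, which is extreme in the second block; removing that point leaves six positions with six
  consecutive values, against simplicity.\<close>

lemma blk_disjoint_rows:
  assumes b: "blk n \<sigma> \<tau> r c" and b': "blk n \<sigma> \<tau>' r' c'" and "r < r'"
  shows "r + 7 \<le> r'"
proof (rule ccontr)
  assume "\<not> r + 7 \<le> r'"
  then have ov: "r' < r + 7" by simp
  show False
  proof (cases "r' + 1 < r + 7")
    case True
    have "r' + k = r + k" if "k < 7" for k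
      using occ_meets_block[OF occ_block[OF b'] blk_letter[OF b'] b, of 0 1] True \<open>r < r'\<close> that by simp
    from this[of 0] show False using \<open>r < r'\<close> by simp
  next
    case False
    then have r': "r' = r + 6" using ov by simp
    have mem: "(c \<le> c' + letter \<tau>' i \<and> c' + letter \<tau>' i < c + 7) \<longleftrightarrow> i = 0" if "i < 7" for i
      using blk_mem[OF b, of "r' + i"] blkD[OF b' that] r' that by auto
    define v where "v = letter \<tau>' 0"
    have v7: "v < 7" using letter_less[OF blk_letter[OF b']] by (simp add: v_def)
    have only: "\<not> (c \<le> c' + w \<and> c' + w < c + 7)" if w: "w < 7" "w \<noteq> v" for w
    proof -
      obtain i where i: "i < 7" "letter \<tau>' i = w" using letter_surj[OF blk_letter[OF b'] w(1)] by auto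
      have "i \<noteq> 0" using i(2) w(2) unfolding v_def by metis
      then show ?thesis using mem[OF i(1)] i by simp
    qed
    have cv: "c \<le> c' + v" "c' + v < c + 7" using mem[of 0] by (auto simp: v_def)
    have "v = 0 \<or> v = 6"
    proof (rule ccontr)
      assume v: "\<not> (v = 0 \<or> v = 6)"
      then have w: "v - 1 < 7" "v - 1 \<noteq> v" "v + 1 < 7" "v + 1 \<noteq> v" using v7 by auto
      show False using only[OF w(1,2)] only[OF w(3,4)] cv v by linarith
    qed
    then have "(1 \<le> i \<and> i \<le> 6) \<longleftrightarrow> ((if v = 0 then 1 else 0) \<le> letter \<tau>' i \<and> letter \<tau>' i \<le> (if v = 0 then 6 else 5))"
      if "i < 7" for i
      using letter_less[OF blk_letter[OF b'] that] letter_inj[OF blk_letter[OF b'], of i 0] that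
      by (auto simp: v_def)
    from letter_simple[OF blk_letter[OF b'] _ _ this] show False by auto
  qed
qed

lemma blk_disjoint_cols:
  assumes b: "blk n \<sigma> \<tau> r c" and b': "blk n \<sigma> \<tau>' r' c'" and "c < c'"
  shows "c + 7 \<le> c'"
proof (rule ccontr)
  assume "\<not> c + 7 \<le> c'"
  have "r \<noteq> r'" using blk_unique[OF b, of \<tau>' c'] b' \<open>c < c'\<close> by auto
  obtain i where i: "i < 7" "letter \<tau>' i = 0" using letter_surj[OF blk_letter[OF b'], of 0] by auto
  then have "c \<le> \<sigma> (r' + i) \<and> \<sigma> (r' + i) < c + 7"
    using blkD[OF b' i(1)] \<open>c < c'\<close> \<open>\<not> c + 7 \<le> c'\<close> by simp
  then have "r \<le> r' + i \<and> r' + i < r + 7" using blk_mem[OF b] by blast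
  then show False
    using blk_disjoint_rows[OF b b'] blk_disjoint_rows[OF b' b] \<open>r \<noteq> r'\<close> i by linarith
qed

lemma blk_neq_cols:
  assumes b: "blk n \<sigma> \<tau> r c" and b': "blk n \<sigma> \<tau>' r' c'" and "r \<noteq> r'"
  shows "c \<noteq> c'"
proof
  assume "c = c'"
  obtain i where i: "i < 7" "letter \<tau>' i = 0" using letter_surj[OF blk_letter[OF b'], of 0] by auto
  then have "c \<le> \<sigma> (r' + i) \<and> \<sigma> (r' + i) < c + 7"
    using blkD[OF b' i(1)] \<open>c = c'\<close> by simp
  then have "r \<le> r' + i \<and> r' + i < r + 7" using blk_mem[OF b] by blast
  then show False
    using blk_disjoint_rows[OF b b'] blk_disjoint_rows[OF b' b] \<open>r \<noteq> r'\<close> i by linarith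
qed

text \<open>A row can be inserted between consecutive rows of an occurrence exactly if these are not
  adjacent, and likewise for columns. Empty lines are forbidden only in the inner gaps, so the
  surroundings of a block remain free.\<close>

lemma tight_iff:
  "tight n \<sigma> \<longleftrightarrow> (\<forall>\<tau><7. \<forall>z. 0 < z \<longrightarrow> z < 7 \<longrightarrow>
     \<not> contains n \<sigma> (zero_row_pattern 7 (letter \<tau>) z) \<and> \<not> contains n \<sigma> (zero_col_pattern 7 (letter \<tau>) z))"
proof
  assume t: "tight n \<sigma>"
  show "\<forall>\<tau><7. \<forall>z. 0 < z \<longrightarrow> z < 7 \<longrightarrow>
     \<not> contains n \<sigma> (zero_row_pattern 7 (letter \<tau>) z) \<and> \<not> contains n \<sigma> (zero_col_pattern 7 (letter \<tau>) z)"
  proof (intro allI impI conjI notI)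
    fix \<tau> z :: nat assume \<tau>: "\<tau> < 7" and z: "0 < z" "z < 7"
    assume "contains n \<sigma> (zero_row_pattern 7 (letter \<tau>) z)"
    then obtain r x where r: "occ n \<sigma> 7 (letter \<tau>) r" "\<forall>i<7. if i < z then r i < x else x < r i"
      using contains_zero_row[OF \<sigma> letter_bij[OF \<tau>], of z] z by auto
    have "r z = r 0 + z" "r (z - 1) = r 0 + (z - 1)"
      using t r(1) \<tau> z unfolding tight_def by (metis, metis less_imp_diff_less)
    moreover have "z - 1 < 7" "z - 1 < z" using z by auto
    ultimately show False using r(2)[rule_format, of z] r(2)[rule_format, of "z - 1"] z by simp
  next
    fix \<tau> z :: nat assume \<tau>: "\<tau> < 7" and z: "0 < z" "z < 7"
    assume "contains n \<sigma> (zero_col_pattern 7 (letter \<tau>) z)"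
    then obtain r y where r: "occ n \<sigma> 7 (letter \<tau>) r" "\<forall>i<7. if letter \<tau> i < z then \<sigma> (r i) < y else y < \<sigma> (r i)"
      using contains_zero_col[OF \<sigma> letter_bij[OF \<tau>], of z] z by auto
    obtain c where c: "blk n \<sigma> \<tau> (r 0) c" and ri: "\<And>i. i < 7 \<Longrightarrow> r i = r 0 + i"
      using t r(1) \<tau> unfolding tight_def by blast
    have "z - 1 < 7" using z by simp
    then obtain i j where "i < 7" "letter \<tau> i = z" "j < 7" "letter \<tau> j = z - 1"
      using letter_surj[OF \<tau> z(2)] letter_surj[OF \<tau>, of "z - 1"] by blast
    then show False
      using r(2)[rule_format, of i] r(2)[rule_format, of j] ri[of i] ri[of j] blkD[OF c, of i] blkD[OF c, of j] z
      by simp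
  qed
next
  assume av: "\<forall>\<tau><7. \<forall>z. 0 < z \<longrightarrow> z < 7 \<longrightarrow>
     \<not> contains n \<sigma> (zero_row_pattern 7 (letter \<tau>) z) \<and> \<not> contains n \<sigma> (zero_col_pattern 7 (letter \<tau>) z)"
  show "tight n \<sigma>"
    unfolding tight_def
  proof (intro allI impI)
    fix \<tau> s assume \<tau>: "\<tau> < 7" and s: "occ n \<sigma> 7 (letter \<tau>) s"
    have step: "s (Suc i) = Suc (s i)" if i: "Suc i < 7" for i
    proof (rule ccontr)
      assume "s (Suc i) \<noteq> Suc (s i)"
      then have gap: "Suc (s i) < s (Suc i)" using occ_mono[OF s, of i "Suc i"] i by simp
      have "if k < Suc i then s k < Suc (s i) else Suc (s i) < s k" if "k < 7" for k
      proof (cases "k < Suc i")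
        case True
        then show ?thesis using occ_mono[OF s, of k i] i by (cases "k = i") auto
      next
        case False
        then show ?thesis using occ_mono[OF s, of "Suc i" k] that gap by (cases "k = Suc i") auto
      qed
      moreover have "Suc (s i) < n" using gap occ_less[OF s i] by simp
      ultimately have "contains n \<sigma> (zero_row_pattern 7 (letter \<tau>) (Suc i))"
        unfolding contains_zero_row[OF \<sigma> letter_bij[OF \<tau>] less_imp_le[OF i]] using s by blast
      then show False using av \<tau> i by blast
    qed
    have rows: "s i = s 0 + i" if "i < 7" for i
      using that by (induction i) (auto simp: step)
    obtain g where "\<forall>j<7. g j < 7 \<and> letter \<tau> (g j) = j \<and> g (letter \<tau> j) = j"
      using bij_inverse[OF letter_bij[OF \<tau>]] by blast
    then have g: "g j < 7" "letter \<tau> (g j) = j" "g (letter \<tau> j) = j" if "j < 7" for j using that by auto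
    have cstep: "\<sigma> (s (g (Suc j))) = Suc (\<sigma> (s (g j)))" if j: "Suc j < 7" for j
    proof (rule ccontr)
      let ?y = "Suc (\<sigma> (s (g j)))"
      assume "\<sigma> (s (g (Suc j))) \<noteq> ?y"
      then have gap: "?y < \<sigma> (s (g (Suc j)))"
        using occ_value[OF s, of "g j" "g (Suc j)"] g[of j] g[OF j] j by simp
      have "if letter \<tau> k < Suc j then \<sigma> (s k) < ?y else ?y < \<sigma> (s k)" if k: "k < 7" for k
      proof (cases "letter \<tau> k < Suc j")
        case True
        then show ?thesis using occ_value[OF s, of k "g j"] g[of j] g(3)[OF k] j k
          by (cases "letter \<tau> k = j") auto
      next
        case False
        then show ?thesis using occ_value[OF s, of "g (Suc j)" k] g[OF j] g(3)[OF k] gap k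
          by (cases "letter \<tau> k = Suc j") auto
      qed
      moreover have "?y < n"
        using gap occ_less[OF s g(1)[OF j]] permutes_lessThan_iff[OF \<sigma>, of "s (g (Suc j))"] by simp
      ultimately have "contains n \<sigma> (zero_col_pattern 7 (letter \<tau>) (Suc j))"
        unfolding contains_zero_col[OF \<sigma> letter_bij[OF \<tau>] less_imp_le[OF j]] using s by blast
      then show False using av \<tau> j by blast
    qed
    have cols: "\<sigma> (s (g j)) = \<sigma> (s (g 0)) + j" if "j < 7" for j
      using that by (induction j) (auto simp: cstep)
    have "\<sigma> (s 0 + i) = \<sigma> (s (g 0)) + letter \<tau> i" if i: "i < 7" for i
      using cols[OF letter_less[OF \<tau> i]] g(3)[OF i] rows[OF i] by simp
    moreover have "s 0 + 7 \<le> n" using rows[of 6] occ_less[OF s, of 6] by simp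
    ultimately have "blk n \<sigma> \<tau> (s 0) (\<sigma> (s (g 0)))" using \<tau> by (simp add: blk_def)
    then show "(\<forall>i<7. s i = s 0 + i) \<and> (\<exists>c. blk n \<sigma> \<tau> (s 0) c)" using rows by blast
  qed
qed

end

section \<open>Configurations of blocks\<close>

text \<open>The inverse of the list \<open>co\<close>: the rank by column of block
  \<open>j\<close>.\<close>

definition rk :: "nat list \<Rightarrow> nat \<Rightarrow> nat" where
  "rk co j = (LEAST h. co ! h = j)"

text \<open>The inflation of the arrangement \<open>co\<close> in which point \<open>j\<close> is
  replaced by the letter \<open>ts ! j\<close>.\<close>

definition word :: "nat list \<Rightarrow> nat list \<Rightarrow> nat \<Rightarrow> nat" where
  "word ts co x = 7 * rk co (x div 7) + letter (ts ! (x div 7)) (x mod 7)"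

text \<open>A configuration consists of the admissible block types \<open>cls\<close> in row order and of the order \<open>co\<close> of the block
  indices by column; \<open>R j\<close> and \<open>K j\<close> are the first row and the first column of block \<open>j\<close>.\<close>

definition confocc ::
  "nat \<Rightarrow> (nat \<Rightarrow> nat) \<Rightarrow> nat list list \<Rightarrow> nat list \<Rightarrow> (nat \<Rightarrow> nat) \<Rightarrow> (nat \<Rightarrow> nat) \<Rightarrow> bool" where
  "confocc n \<sigma> cls co R K \<longleftrightarrow>
     (\<forall>j<length cls. \<exists>\<tau>\<in>set (cls ! j). blk n \<sigma> \<tau> (R j) (K j)) \<and>
     (\<forall>j. Suc j < length cls \<longrightarrow> R j < R (Suc j)) \<and>
     (\<forall>h. Suc h < length cls \<longrightarrow> K (co ! h) < K (co ! Suc h))"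

text \<open>For rows the outer gaps \<open>0\<close> and \<open>k\<close> are included as well: they
  pin the first letter to the top row and the end block to the bottom row.\<close>

definition row_gap :: "nat \<Rightarrow> nat \<Rightarrow> (nat \<Rightarrow> nat) \<Rightarrow> nat \<Rightarrow> bool" where
  "row_gap n k R g \<longleftrightarrow> (if g = 0 then 0 < R 0 else if g = k then R (k - 1) + 7 < n else R (g - 1) + 7 < R g)"

definition col_gap :: "nat list \<Rightarrow> (nat \<Rightarrow> nat) \<Rightarrow> nat \<Rightarrow> bool" where
  "col_gap co K g \<longleftrightarrow> K (co ! (g - 1)) + 7 < K (co ! g)"

lemma rk_nth:
  assumes "distinct co" "h < length co"
  shows "rk co (co ! h) = h"
  unfolding rk_def
proof (rule Least_equality)
  fix y assume y: "co ! y = co ! h"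
  show "h \<le> y"
  proof (rule ccontr)
    assume "\<not> h \<le> y"
    then show False using nth_eq_iff_index_eq[OF assms(1), of y h] assms(2) y by simp
  qed
qed simp

section \<open>Occurrences of inflated arrangements\<close>

context
  fixes co :: "nat list" and k :: nat
  assumes co: "distinct co" "set co = {..<k}"
begin

lemma length_order: "length co = k"
  using co distinct_card[of co] by simp

lemma order_rk: "j < k \<Longrightarrow> rk co j < k \<and> co ! rk co j = j"
proof -
  assume "j < k"
  then obtain h where "h < length co" "co ! h = j" using co(2) by (auto simp: in_set_conv_nth set_eq_iff)
  then show ?thesis using rk_nth[OF co(1), of h] length_order by auto
qed

lemma rk_order: "h < k \<Longrightarrow> rk co (co ! h) = h \<and> co ! h < k"
  using rk_nth[OF co(1), of h] length_order nth_mem[of h co] co(2) by auto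

lemma word_block: "i < 7 \<Longrightarrow> word ts co (7 * j + i) = 7 * rk co j + letter (ts ! j) i"
  by (simp add: word_def)

lemma word_bij:
  assumes "length ts = k" "\<forall>\<tau>\<in>set ts. \<tau> < 7"
  shows "bij_betw (word ts co) {..<7 * k} {..<7 * k}"
proof -
  have ts: "ts ! j < 7" if "j < k" for j using assms that by simp
  have dm: "x div 7 < k" "x mod 7 < 7" if "x < 7 * k" for x :: nat using that by auto
  have wd: "word ts co x div 7 = rk co (x div 7)" "word ts co x mod 7 = letter (ts ! (x div 7)) (x mod 7)"
    if "x < 7 * k" for x
  proof -
    have dm7: "(7 * a + b) div 7 = a" "(7 * a + b) mod 7 = b" if "b < 7" for a b :: nat using that by simp_all
    show "word ts co x div 7 = rk co (x div 7)" "word ts co x mod 7 = letter (ts ! (x div 7)) (x mod 7)"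
      unfolding word_def by (rule dm7, rule letter_less[OF ts[OF dm(1)[OF that]] dm(2)[OF that]])+
  qed
  have "inj_on (word ts co) {..<7 * k}"
  proof (rule inj_onI)
    fix x y assume xy: "x \<in> {..<7 * k}" "y \<in> {..<7 * k}" "word ts co x = word ts co y"
    then have x: "x < 7 * k" and y: "y < 7 * k" by simp_all
    have r: "rk co (x div 7) = rk co (y div 7)"
      and l: "letter (ts ! (x div 7)) (x mod 7) = letter (ts ! (y div 7)) (y mod 7)"
      using wd[OF x] wd[OF y] xy(3) by simp_all
    have "co ! rk co (x div 7) = x div 7" "co ! rk co (y div 7) = y div 7"
      using order_rk dm(1) x y by blast+
    then have q: "x div 7 = y div 7" using r by metis
    have "x mod 7 = y mod 7"
      using l letter_inj[OF ts[OF dm(1)[OF y]] dm(2)[OF x] dm(2)[OF y]] unfolding q by blast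
    with q show "x = y" by (metis div_mult_mod_eq)
  qed
  moreover have "word ts co ` {..<7 * k} \<subseteq> {..<7 * k}"
  proof
    fix v assume "v \<in> word ts co ` {..<7 * k}"
    then obtain x where x: "x < 7 * k" "v = word ts co x" by blast
    have "v div 7 < k" using wd(1)[OF x(1)] order_rk[OF dm(1)[OF x(1)]] x(2) by simp
    then show "v \<in> {..<7 * k}" by (simp add: div_less_iff_less_mult mult.commute)
  qed
  ultimately show ?thesis by (simp add: bij_betw_def endo_inj_surj)
qed

context
  fixes n :: nat and \<sigma> :: "nat \<Rightarrow> nat"
  assumes \<sigma>: "\<sigma> permutes {..<n}"
begin

text \<open>Each segment of seven rows of the occurrence is an occurrence of one letter, which
  tightness makes contiguous. The first column is recovered from the entry in the first row.\<close>

lemma blocks_of_occ: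
  assumes t: "tight n \<sigma>" and ts: "length ts = k" "\<forall>\<tau>\<in>set ts. \<tau> < 7"
    and o: "occ n \<sigma> (7 * k) (word ts co) r" and j: "j < k"
  shows "(\<forall>i<7. r (7 * j + i) = r (7 * j) + i) \<and> blk n \<sigma> (ts ! j) (r (7 * j)) (\<sigma> (r (7 * j)) - letter (ts ! j) 0)"
proof -
  have \<tau>: "ts ! j < 7" using ts j by simp
  have less: "7 * j + i < 7 * k" if "i < 7" for i using that j by linarith
  have "occ n \<sigma> 7 (letter (ts ! j)) (\<lambda>i. r (7 * j + i))"
    by (rule occI) (use occ_mono[OF o] occ_less[OF o] occ_value[OF o] less in \<open>simp_all add: word_block\<close>)
  then have "\<forall>i<7. r (7 * j + i) = r (7 * j + 0) + i" "\<exists>c. blk n \<sigma> (ts ! j) (r (7 * j + 0)) c"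
    using t \<tau> unfolding tight_def by blast+
  then show ?thesis using blkD[of n \<sigma> "ts ! j" "r (7 * j)" _ 0] by fastforce
qed

lemma rows_chain:
  assumes "\<forall>j<k. \<exists>\<tau>. blk n \<sigma> \<tau> (R j) (K j)" "\<forall>j. Suc j < k \<longrightarrow> R j < R (Suc j)"
    and "a < b" "b < k"
  shows "R a + 7 \<le> R b"
  using assms(3,4)
proof (induction b)
  case (Suc b)
  obtain \<tau> \<tau>' where bl: "blk n \<sigma> \<tau> (R b) (K b)" "blk n \<sigma> \<tau>' (R (Suc b)) (K (Suc b))"
    using assms(1) Suc.prems by (meson Suc_lessD)
  have "R b + 7 \<le> R (Suc b)" using blk_disjoint_rows[OF \<sigma> bl] assms(2) Suc.prems by simp
  then show ?case using Suc by (cases "a = b") auto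
qed simp

lemma cols_chain:
  assumes "\<forall>j<k. \<exists>\<tau>. blk n \<sigma> \<tau> (R j) (K j)" "\<forall>h. Suc h < k \<longrightarrow> K (co ! h) < K (co ! Suc h)"
    and "a < b" "b < k"
  shows "K (co ! a) + 7 \<le> K (co ! b)"
  using assms(3,4)
proof (induction b)
  case (Suc b)
  have "co ! b < k" "co ! Suc b < k" using rk_order[of b] rk_order[of "Suc b"] Suc.prems by auto
  then obtain \<tau> \<tau>' where bl: "blk n \<sigma> \<tau> (R (co ! b)) (K (co ! b))" "blk n \<sigma> \<tau>' (R (co ! Suc b)) (K (co ! Suc b))"
    using assms(1) by blast
  have "K (co ! b) + 7 \<le> K (co ! Suc b)" using blk_disjoint_cols[OF \<sigma> bl] assms(2) Suc.prems by simp
  then show ?case using Suc by (cases "a = b") auto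
qed simp

lemma occ_of_blocks:
  assumes ts: "length ts = k" and bl: "\<forall>j<k. blk n \<sigma> (ts ! j) (R j) (K j)"
    and rows: "\<forall>j. Suc j < k \<longrightarrow> R j < R (Suc j)"
    and cols: "\<forall>h. Suc h < k \<longrightarrow> K (co ! h) < K (co ! Suc h)"
  shows "occ n \<sigma> (7 * k) (word ts co) (\<lambda>x. R (x div 7) + x mod 7)"
proof -
  have ex: "\<forall>j<k. \<exists>\<tau>. blk n \<sigma> \<tau> (R j) (K j)" using bl by blast
  note rc = rows_chain[OF ex rows] and cc = cols_chain[OF ex cols]
  have dm: "x div 7 < k" "x mod 7 < 7" if "x < 7 * k" for x :: nat using that by auto
  have val: "\<sigma> (R (x div 7) + x mod 7) = K (x div 7) + letter (ts ! (x div 7)) (x mod 7)" if "x < 7 * k" for x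
    using blkD bl dm[OF that] by blast
  show ?thesis
  proof (rule occI)
    fix x y :: nat assume xy: "x < y" "y < 7 * k"
    then have x: "x < 7 * k" by simp
    show "R (x div 7) + x mod 7 < R (y div 7) + y mod 7"
    proof (cases "x div 7 = y div 7")
      case True
      then have "x mod 7 < y mod 7" using xy(1) by (metis div_mult_mod_eq nat_add_left_cancel_less)
      then show ?thesis using True by simp
    next
      case False
      then have "x div 7 < y div 7" using xy(1) by (meson div_le_mono le_neq_implies_less less_imp_le)
      then show ?thesis using rc[of "x div 7" "y div 7"] dm(1)[OF xy(2)] dm(2)[OF x] by linarith
    qed
  next
    fix x assume x: "x < 7 * k"
    have "R (x div 7) + 7 \<le> n" using bl dm[OF x] blk_row by blast
    then show "R (x div 7) + x mod 7 < n" using dm(2)[OF x] by linarith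
  next
    fix x y assume x: "x < 7 * k" and y: "y < 7 * k" and w: "word ts co x < word ts co y"
    have lt: "letter (ts ! (x div 7)) (x mod 7) < 7" "letter (ts ! (y div 7)) (y mod 7) < 7"
      using letter_less blk_letter bl dm[OF x] dm[OF y] by blast+
    have rx: "rk co (x div 7) < k" "co ! rk co (x div 7) = x div 7"
      and ry: "rk co (y div 7) < k" "co ! rk co (y div 7) = y div 7"
      using order_rk dm(1)[OF x] dm(1)[OF y] by blast+
    show "\<sigma> (R (x div 7) + x mod 7) < \<sigma> (R (y div 7) + y mod 7)"
    proof (cases "rk co (x div 7) = rk co (y div 7)")
      case True
      then have "x div 7 = y div 7" using rx ry by metis
      then show ?thesis unfolding val[OF x] val[OF y] using w by (simp add: word_def)
    next
      case False
      then have "rk co (x div 7) < rk co (y div 7)" using w lt by (simp add: word_def)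
      then have "K (x div 7) + 7 \<le> K (y div 7)" using cc[of "rk co (x div 7)" "rk co (y div 7)"] rx ry by simp
      then show ?thesis unfolding val[OF x] val[OF y] using lt by linarith
    qed
  qed
qed

section \<open>Configurations as families of patterns\<close>

context
  fixes cls :: "nat list list"
  assumes t: "tight n \<sigma>" and cls: "length cls = k" "0 < k" "\<forall>l\<in>set cls. \<forall>\<tau>\<in>set l. \<tau> < 7"
begin

lemma product_letters:
  assumes "ts \<in> set (product_lists cls)"
  shows "length ts = k" "\<forall>\<tau>\<in>set ts. \<tau> < 7" "\<And>j. j < k \<Longrightarrow> ts ! j \<in> set (cls ! j)"
proof -
  have "list_all2 (\<lambda>x ys. x \<in> set ys) ts cls" using assms by (simp add: product_lists_set)
  then show *: "length ts = k" "\<And>j. j < k \<Longrightarrow> ts ! j \<in> set (cls ! j)"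
    using cls(1) by (auto simp: list_all2_conv_all_nth)
  show "\<forall>\<tau>\<in>set ts. \<tau> < 7"
  proof
    fix \<tau> assume "\<tau> \<in> set ts"
    then obtain j where "j < k" "ts ! j = \<tau>" using * by (auto simp: in_set_conv_nth)
    moreover from this have "cls ! j \<in> set cls" using cls(1) by simp
    ultimately show "\<tau> < 7" using cls(3) *(2) by blast
  qed
qed

lemma confocc_of_occ:
  assumes ts: "ts \<in> set (product_lists cls)" and o: "occ n \<sigma> (7 * k) (word ts co) r"
  shows "confocc n \<sigma> cls co (\<lambda>j. r (7 * j)) (\<lambda>j. \<sigma> (r (7 * j)) - letter (ts ! j) 0)"
proof -
  note p = product_letters[OF ts] and b = blocks_of_occ[OF t product_letters(1,2)[OF ts] o]
  have "\<sigma> (r (7 * (co ! h))) - letter (ts ! (co ! h)) 0 < \<sigma> (r (7 * (co ! Suc h))) - letter (ts ! (co ! Suc h)) 0"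
    if h: "Suc h < k" for h
  proof -
    let ?a = "co ! h" and ?b = "co ! Suc h"
    have ab: "?a < k" "?b < k" "rk co ?a = h" "rk co ?b = Suc h" using rk_order[of h] rk_order[of "Suc h"] h by auto
    have \<tau>: "ts ! ?a < 7" "ts ! ?b < 7" using p ab by simp_all
    \<comment> \<open>The smallest entry of block \<open>?b\<close> equals its first column; being
      larger than an entry of block \<open>?a\<close>, it exceeds the first column of
      \<open>?a\<close>.\<close>
    obtain i where i: "i < 7" "letter (ts ! ?b) i = 0" using letter_surj[OF \<tau>(2), of 0] by auto
    have lt: "letter (ts ! ?a) 0 < 7" using letter_less[OF \<tau>(1)] by simp
    have idx: "7 * ?a < 7 * k" "7 * ?b + i < 7 * k" using ab i by linarith+
    have "word ts co (7 * ?a) < word ts co (7 * ?b + i)"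
      using ab i lt word_block[of 0 ts ?a] word_block[of i ts ?b] by simp
    then have "\<sigma> (r (7 * ?a)) < \<sigma> (r (7 * ?b + i))" using occ_value[OF o idx] by simp
    moreover have "\<sigma> (r (7 * ?b + i)) = \<sigma> (r (7 * ?b)) - letter (ts ! ?b) 0"
      using b[OF ab(2)] blkD[of n \<sigma> "ts ! ?b" "r (7 * ?b)" _ i] i by auto
    ultimately show ?thesis by linarith
  qed
  moreover have "r (7 * j) < r (7 * Suc j)" if "Suc j < k" for j
    by (rule occ_mono[OF o]) (use that in auto)
  ultimately show ?thesis
    unfolding confocc_def cls(1) using p(3) b by (intro conjI allI impI bexI) blast+
qed

lemma occ_of_confocc:
  assumes "confocc n \<sigma> cls co R K"
  obtains ts where "ts \<in> set (product_lists cls)" "\<forall>j<k. blk n \<sigma> (ts ! j) (R j) (K j)"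
    "occ n \<sigma> (7 * k) (word ts co) (\<lambda>x. R (x div 7) + x mod 7)"
proof -
  have c: "\<forall>j<k. \<exists>\<tau>\<in>set (cls ! j). blk n \<sigma> \<tau> (R j) (K j)" "\<forall>j. Suc j < k \<longrightarrow> R j < R (Suc j)"
    "\<forall>h. Suc h < k \<longrightarrow> K (co ! h) < K (co ! Suc h)"
    using assms cls(1) unfolding confocc_def by auto
  obtain f where f: "\<forall>j<k. f j \<in> set (cls ! j) \<and> blk n \<sigma> (f j) (R j) (K j)"
    using c(1) by metis
  define ts where "ts = map f [0..<k]"
  have len: "length ts = k" and nth: "\<And>j. j < k \<Longrightarrow> ts ! j = f j" by (simp_all add: ts_def)
  have "ts \<in> set (product_lists cls)"
    using f cls(1) by (auto simp: product_lists_set list_all2_conv_all_nth len nth)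
  moreover have b: "\<forall>j<k. blk n \<sigma> (ts ! j) (R j) (K j)" using f nth by simp
  moreover have "occ n \<sigma> (7 * k) (word ts co) (\<lambda>x. R (x div 7) + x mod 7)"
    by (rule occ_of_blocks[OF len b c(2,3)])
  ultimately show ?thesis by (rule that)
qed

text \<open>A configuration stands for all patterns obtained by choosing one letter from each class.
  Classes such as \<open>[4,5]\<close> make it blind to the toggling of pointers.\<close>

lemma confocc_iff_plain:
  "(\<exists>ts\<in>set (product_lists cls). contains n \<sigma> (plain_pattern (7 * k) (word ts co))) \<longleftrightarrow>
   (\<exists>R K. confocc n \<sigma> cls co R K)"
proof
  assume "\<exists>ts\<in>set (product_lists cls). contains n \<sigma> (plain_pattern (7 * k) (word ts co))"
  then obtain ts r where "ts \<in> set (product_lists cls)" "occ n \<sigma> (7 * k) (word ts co) r"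
    using contains_plain[OF \<sigma> word_bij] product_letters(1,2) by blast
  then show "\<exists>R K. confocc n \<sigma> cls co R K" using confocc_of_occ by blast
next
  assume "\<exists>R K. confocc n \<sigma> cls co R K"
  then show "\<exists>ts\<in>set (product_lists cls). contains n \<sigma> (plain_pattern (7 * k) (word ts co))"
    using occ_of_confocc contains_plain[OF \<sigma> word_bij] product_letters(1,2) by metis
qed

lemma confocc_iff_zero_row:
  assumes g: "g \<le> k"
  shows "(\<exists>ts\<in>set (product_lists cls). contains n \<sigma> (zero_row_pattern (7 * k) (word ts co) (7 * g))) \<longleftrightarrow>
   (\<exists>R K. confocc n \<sigma> cls co R K \<and> row_gap n k R g)"
proof
  assume "\<exists>ts\<in>set (product_lists cls). contains n \<sigma> (zero_row_pattern (7 * k) (word ts co) (7 * g))"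
  then obtain ts where ts: "ts \<in> set (product_lists cls)"
    "contains n \<sigma> (zero_row_pattern (7 * k) (word ts co) (7 * g))" by blast
  have "7 * g \<le> 7 * k" using g by simp
  from ts(2)[unfolded contains_zero_row[OF \<sigma> word_bij[OF product_letters(1,2)[OF ts(1)]] this]]
  obtain r x where r: "occ n \<sigma> (7 * k) (word ts co) r" "x < n" "\<forall>i<7*k. if i < 7 * g then r i < x else x < r i"
    by blast
  have b: "r (7 * j + 6) = r (7 * j) + 6" if "j < k" for j
    using blocks_of_occ[OF t product_letters(1,2)[OF ts(1)] r(1) that] by simp
  have "row_gap n k (\<lambda>j. r (7 * j)) g"
  proof (cases "g = 0")
    case True
    then show ?thesis using r(3)[rule_format, of 0] cls(2) by (simp add: row_gap_def)
  next
    case False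
    then have "7 * (g - 1) + 6 < 7 * g" "g - 1 < k" "7 * (g - 1) + 6 < 7 * k" using g by auto
    then have "r (7 * (g - 1)) + 6 < x" using r(3)[rule_format, of "7 * (g - 1) + 6"] b[of "g - 1"] by simp
    moreover have "x < r (7 * g)" if "g < k" using r(3)[rule_format, of "7 * g"] that by simp
    ultimately show ?thesis using False g r(2) by (auto simp: row_gap_def)
  qed
  then show "\<exists>R K. confocc n \<sigma> cls co R K \<and> row_gap n k R g"
    using confocc_of_occ[OF ts(1) r(1)] by blast
next
  assume "\<exists>R K. confocc n \<sigma> cls co R K \<and> row_gap n k R g"
  then obtain R K where c: "confocc n \<sigma> cls co R K" and gap: "row_gap n k R g" by blast
  obtain ts where ts: "ts \<in> set (product_lists cls)" "\<forall>j<k. blk n \<sigma> (ts ! j) (R j) (K j)"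
    "occ n \<sigma> (7 * k) (word ts co) (\<lambda>x. R (x div 7) + x mod 7)" using occ_of_confocc[OF c] by blast
  have rows: "\<forall>j. Suc j < k \<longrightarrow> R j < R (Suc j)" using c cls(1) by (simp add: confocc_def)
  have ex: "\<forall>j<k. \<exists>\<tau>. blk n \<sigma> \<tau> (R j) (K j)" using ts(2) by blast
  have mono: "R a \<le> R b" if "a \<le> b" "b < k" for a b
    using rows_chain[OF ex rows, of a b] that by (cases "a = b") auto
  \<comment> \<open>The line immediately after the block that precedes the gap, or row 0 for the gap
    above the first block.\<close>
  define x where "x = (if g = 0 then 0 else R (g - 1) + 7)"
  have rn: "R j + 7 \<le> n" if "j < k" for j using blk_row ts(2) that by blast
  have "x < n"
  proof (cases "g = 0 \<or> g = k")
    case True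
    then show ?thesis using gap rn[OF cls(2)] cls(2) by (auto simp: row_gap_def x_def)
  next
    case False
    then show ?thesis using gap rn[of g] g by (auto simp: row_gap_def x_def)
  qed
  moreover have "if i < 7 * g then R (i div 7) + i mod 7 < x else x < R (i div 7) + i mod 7" if i: "i < 7 * k" for i
  proof (cases "i < 7 * g")
    case True
    then have "i div 7 \<le> g - 1" "0 < g" by auto
    moreover from this have "R (i div 7) \<le> R (g - 1)" using mono[of "i div 7" "g - 1"] g by simp
    moreover have "i mod 7 < 7" by simp
    ultimately have "R (i div 7) + i mod 7 < x" unfolding x_def by (simp del: mod_less_divisor)
    then show ?thesis using True by simp
  next
    case False
    then have gi: "g \<le> i div 7" "i div 7 < k" using i by auto
    have "x < R g" using gap gi unfolding row_gap_def x_def by (auto split: if_splits)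
    then show ?thesis using False mono[OF gi] by simp
  qed
  moreover have "7 * g \<le> 7 * k" using g by simp
  ultimately have "contains n \<sigma> (zero_row_pattern (7 * k) (word ts co) (7 * g))"
    using contains_zero_row[OF \<sigma> word_bij[OF product_letters(1,2)[OF ts(1)]], of "7 * g"] ts(3) by blast
  then show "\<exists>ts\<in>set (product_lists cls). contains n \<sigma> (zero_row_pattern (7 * k) (word ts co) (7 * g))"
    using ts(1) by blast
qed

lemma confocc_iff_zero_col:
  assumes g: "0 < g" "g < k"
  shows "(\<exists>ts\<in>set (product_lists cls). contains n \<sigma> (zero_col_pattern (7 * k) (word ts co) (7 * g))) \<longleftrightarrow>
   (\<exists>R K. confocc n \<sigma> cls co R K \<and> col_gap co K g)"
proof
  assume "\<exists>ts\<in>set (product_lists cls). contains n \<sigma> (zero_col_pattern (7 * k) (word ts co) (7 * g))"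
  then obtain ts where ts: "ts \<in> set (product_lists cls)"
    "contains n \<sigma> (zero_col_pattern (7 * k) (word ts co) (7 * g))" by blast
  have "7 * g \<le> 7 * k" using g by simp
  from ts(2)[unfolded contains_zero_col[OF \<sigma> word_bij[OF product_letters(1,2)[OF ts(1)]] this]]
  obtain r y where r: "occ n \<sigma> (7 * k) (word ts co) r" "y < n"
    "\<forall>i<7*k. if word ts co i < 7 * g then \<sigma> (r i) < y else y < \<sigma> (r i)"
    by blast
  let ?K = "\<lambda>j. \<sigma> (r (7 * j)) - letter (ts ! j) 0"
  let ?a = "co ! (g - 1)" and ?b = "co ! g"
  have ab: "?a < k" "?b < k" "rk co ?a = g - 1" "rk co ?b = g" using rk_order[of "g - 1"] rk_order[of g] g by auto
  have \<tau>: "ts ! ?a < 7" "ts ! ?b < 7" using product_letters[OF ts(1)] ab by simp_all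
  \<comment> \<open>The largest entry of the block left of the gap and the smallest entry of the
    block right of it enclose \<open>y\<close>, so a whole column is free between the two
    blocks.\<close>
  obtain i where i: "i < 7" "letter (ts ! ?a) i = 6" using letter_surj[OF \<tau>(1), of 6] by auto
  obtain j where j: "j < 7" "letter (ts ! ?b) j = 0" using letter_surj[OF \<tau>(2), of 0] by auto
  have b: "\<sigma> (r (7 * h + l)) = ?K h + letter (ts ! h) l" if "h < k" "l < 7" for h l
    using blocks_of_occ[OF t product_letters(1,2)[OF ts(1)] r(1) that(1)] blkD[OF _ that(2)] that by metis
  have "word ts co (7 * ?a + i) < 7 * g" "7 * ?a + i < 7 * k"
    using word_block[OF i(1)] i ab g by simp_all
  then have "?K ?a + 6 < y" using r(3)[rule_format, of "7 * ?a + i"] b[OF ab(1) i(1)] i by simp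
  moreover have "\<not> word ts co (7 * ?b + j) < 7 * g" "7 * ?b + j < 7 * k"
    using word_block[OF j(1)] j ab g by simp_all
  then have "y < ?K ?b" using r(3)[rule_format, of "7 * ?b + j"] b[OF ab(2) j(1)] j by simp
  ultimately have "col_gap co ?K g" by (simp add: col_gap_def)
  then show "\<exists>R K. confocc n \<sigma> cls co R K \<and> col_gap co K g"
    using confocc_of_occ[OF ts(1) r(1)] by blast
next
  assume "\<exists>R K. confocc n \<sigma> cls co R K \<and> col_gap co K g"
  then obtain R K where c: "confocc n \<sigma> cls co R K" and gap: "col_gap co K g" by blast
  obtain ts where ts: "ts \<in> set (product_lists cls)" "\<forall>j<k. blk n \<sigma> (ts ! j) (R j) (K j)"
    "occ n \<sigma> (7 * k) (word ts co) (\<lambda>x. R (x div 7) + x mod 7)" using occ_of_confocc[OF c] by blast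
  have cols: "\<forall>h. Suc h < k \<longrightarrow> K (co ! h) < K (co ! Suc h)" using c cls(1) by (simp add: confocc_def)
  have ex: "\<forall>j<k. \<exists>\<tau>. blk n \<sigma> \<tau> (R j) (K j)" using ts(2) by blast
  have mono: "K (co ! a) \<le> K (co ! b)" if "a \<le> b" "b < k" for a b
    using cols_chain[OF ex cols, of a b] that by (cases "a = b") auto
  define y where "y = K (co ! (g - 1)) + 7"
  have yg: "y < K (co ! g)" using gap by (simp add: col_gap_def y_def)
  have "co ! g < k" using rk_order[OF g(2)] by simp
  then have "y < n" using yg blk_cols[OF \<sigma>] ts(2) by fastforce
  moreover have "if word ts co i < 7 * g then \<sigma> (R (i div 7) + i mod 7) < y else y < \<sigma> (R (i div 7) + i mod 7)"
    if i: "i < 7 * k" for i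
  proof -
    let ?h = "rk co (i div 7)"
    have dm: "i div 7 < k" "i mod 7 < 7" using i by auto
    have h: "?h < k" "co ! ?h = i div 7" using order_rk[OF dm(1)] by auto
    have v: "\<sigma> (R (i div 7) + i mod 7) = K (co ! ?h) + letter (ts ! (i div 7)) (i mod 7)"
      using blkD[OF ts(2)[rule_format, OF dm(1)] dm(2)] h by simp
    have l: "letter (ts ! (i div 7)) (i mod 7) < 7"
      using letter_less[OF blk_letter[OF ts(2)[rule_format, OF dm(1)]] dm(2)] .
    show ?thesis
    proof (cases "word ts co i < 7 * g")
      case True
      then have "?h \<le> g - 1" by (simp add: word_def)
      then have "K (co ! ?h) \<le> K (co ! (g - 1))" using mono[of ?h "g - 1"] g by simp
      then show ?thesis using True v l by (simp add: y_def)
    next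
      case False
      then have "g \<le> ?h" using l by (simp add: word_def)
      then have "K (co ! g) \<le> K (co ! ?h)" using mono[of g ?h] h by simp
      then show ?thesis using False v yg by simp
    qed
  qed
  moreover have "7 * g \<le> 7 * k" using g by simp
  ultimately have "contains n \<sigma> (zero_col_pattern (7 * k) (word ts co) (7 * g))"
    using contains_zero_col[OF \<sigma> word_bij[OF product_letters(1,2)[OF ts(1)]], of "7 * g"] ts(3) by blast
  then show "\<exists>ts\<in>set (product_lists cls). contains n \<sigma> (zero_col_pattern (7 * k) (word ts co) (7 * g))"
    using ts(1) by blast
qed

end

end

end

section \<open>The forbidden patterns\<close>

type_synonym config = "nat list list \<times> nat list"

text \<open>In \<open>copy_config x\<close> and \<open>end_config\<close> the first three blocks are the letter before the read position, the letter
  read and the separator below the latter. A step of the simulation at letter \<open>t\<close> occupies the blocks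
  letter, pointer, separator of \<open>t\<close> and of \<open>t + 1\<close>; the column of the pointer encodes the read position.\<close>

definition copy_config :: "nat \<Rightarrow> config" where
  "copy_config x = ([[0,1,2], [x], [3], [1], [4,5], [3], [x], [4,5], [3]], [2,0,4,1,7,5,8,3,6])"

text \<open>Nothing is read here: the new letter is plain, and the new pointer stands immediately to
  the right of the old one, which encodes an unchanged read position.\<close>

definition after_marker_config :: config where
  "after_marker_config = ([[2], [4,5], [3], [1], [4,5], [3]], [1,4,2,5,0,3])"

definition end_config :: config where
  "end_config = ([[0,1,2], [2], [3], [1], [4,5], [3], [6]], [2,0,4,1,5,6,3])"

text \<open>The initial queue first, marker, plain, plain. Letters before the last have no pointer;
  the only pointer stands immediately to the right of letter 0, the first read position.\<close>

definition start_config :: config where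
  "start_config = ([[0], [2], [3], [1], [3], [1], [4,5], [3]], [2,0,6,4,1,7,3,5])"

text \<open>Each rule comes with the index of the pointer that it justifies.\<close>

definition rules :: "(config \<times> nat) list" where
  "rules = [(copy_config 1, 4), (copy_config 2, 4), (after_marker_config, 1), (end_config, 4)]"

text \<open>Together with the numbers of the row gaps and column gaps in which no empty row or column is allowed;
  gap \<open>g\<close> precedes the block of rank \<open>g\<close>.\<close>

definition tight_configs :: "(config \<times> nat list \<times> nat list) list" where
  "tight_configs =
     [(copy_config 1, [4,5,6,7,8], [4,7]), (copy_config 2, [4,5,6,7,8], [4,7]),
      (after_marker_config, [1,2,3,4,5], [1,4]), (end_config, [4,5,6], [6]),
      (start_config, [1,2,3,4,5,6,7], [1,2,4,6]), (([[0]], [0]), [0], []), (([[6]], [0]), [1], [])]"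

text \<open>The condition on 4 and 5 makes configurations invariant under toggling, and at most nine
  blocks means at most 63 rows before an empty line is added.\<close>

definition wf_config :: "config \<Rightarrow> bool" where
  "wf_config Q \<longleftrightarrow> distinct (snd Q) \<and> set (snd Q) = {..<length (fst Q)} \<and> fst Q \<noteq> [] \<and> length (fst Q) \<le> 9 \<and>
     (\<forall>l\<in>set (fst Q). \<forall>\<tau>\<in>set l. \<tau> < 7) \<and> (\<forall>l\<in>set (fst Q). 4 \<in> set l \<longleftrightarrow> 5 \<in> set l)"

definition words :: "config \<Rightarrow> (nat \<Rightarrow> nat) list" where
  "words Q = map (\<lambda>ts. word ts (snd Q)) (product_lists (fst Q))"

text \<open>The pointer justified by the rule is fixed to type 5. As this is forbidden, a justified
  pointer has type 4 and loses its partner under toggling.\<close>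

definition special :: "config \<times> nat \<Rightarrow> config" where
  "special Cd = ((fst (fst Cd))[snd Cd := [5]], snd (fst Cd))"

definition size_of :: "config \<Rightarrow> nat" where
  "size_of Q = 7 * length (fst Q)"

definition plain_patterns :: "config \<Rightarrow> pattern list" where
  "plain_patterns Q = map (plain_pattern (size_of Q)) (words Q)"

definition row_patterns :: "config \<Rightarrow> nat \<Rightarrow> pattern list" where
  "row_patterns Q g = map (\<lambda>f. zero_row_pattern (size_of Q) f (7 * g)) (words Q)"

definition col_patterns :: "config \<Rightarrow> nat \<Rightarrow> pattern list" where
  "col_patterns Q g = map (\<lambda>f. zero_col_pattern (size_of Q) f (7 * g)) (words Q)"

definition block_patterns :: "pattern list" where
  "block_patterns = concat (map (\<lambda>\<tau>. concat (map (\<lambda>z.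
     [zero_row_pattern 7 (letter \<tau>) z, zero_col_pattern 7 (letter \<tau>) z]) [1..<7])) [0..<7])"

definition rule_patterns :: "pattern list" where
  "rule_patterns = concat (map (\<lambda>Cd. plain_patterns (special Cd)) rules)"

definition tightness_patterns :: "pattern list" where
  "tightness_patterns = concat (map (\<lambda>(Q, rg, cg). concat (map (row_patterns Q) rg) @ concat (map (col_patterns Q) cg))
     tight_configs)"

definition forbidden :: "pattern set" where
  "forbidden = set (block_patterns @ rule_patterns @ tightness_patterns)"

definition start_patterns :: "pattern set" where
  "start_patterns = set (plain_patterns start_config)"

lemmas config_defs = copy_config_def after_marker_config_def end_config_def start_config_def

lemma wf_tight_configs:
  assumes "(Q, rg, cg) \<in> set tight_configs"
  shows "wf_config Q" "set rg \<subseteq> {..length (fst Q)}" "set cg \<subseteq> {0<..<length (fst Q)}"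
  using assms by (auto simp: tight_configs_def wf_config_def config_defs lessThan_nat_numeral lessThan_Suc)

lemma wf_rules:
  assumes "(Q, d) \<in> set rules"
  shows "wf_config Q" "d < length (fst Q)" "fst Q ! d = [4, 5]"
  using assms by (auto simp: rules_def wf_config_def config_defs lessThan_nat_numeral lessThan_Suc)

lemma wf_start: "wf_config start_config"
  by (simp add: wf_config_def config_defs lessThan_nat_numeral lessThan_Suc) auto

section \<open>Avoidance expressed through configurations\<close>

definition conf :: "nat \<Rightarrow> (nat \<Rightarrow> nat) \<Rightarrow> config \<Rightarrow> (nat \<Rightarrow> nat) \<Rightarrow> (nat \<Rightarrow> nat) \<Rightarrow> bool" where
  "conf n \<sigma> Q R K \<longleftrightarrow> confocc n \<sigma> (fst Q) (snd Q) R K"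

definition gap_free :: "nat \<Rightarrow> (nat \<Rightarrow> nat) \<Rightarrow> config \<times> nat list \<times> nat list \<Rightarrow> bool" where
  "gap_free n \<sigma> T \<longleftrightarrow> (case T of (Q, rg, cg) \<Rightarrow> \<forall>R K. conf n \<sigma> Q R K \<longrightarrow>
     (\<forall>g\<in>set rg. \<not> row_gap n (length (fst Q)) R g) \<and> (\<forall>g\<in>set cg. \<not> col_gap (snd Q) K g))"

definition admissible :: "nat \<Rightarrow> (nat \<Rightarrow> nat) \<Rightarrow> bool" where
  "admissible n \<sigma> \<longleftrightarrow> tight n \<sigma> \<and> (\<forall>T\<in>set tight_configs. gap_free n \<sigma> T) \<and>
     (\<forall>Cd\<in>set rules. \<not> (\<exists>R K. conf n \<sigma> (special Cd) R K))"

definition started :: "nat \<Rightarrow> (nat \<Rightarrow> nat) \<Rightarrow> bool" where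
  "started n \<sigma> \<longleftrightarrow> (\<exists>R K. conf n \<sigma> start_config R K)"

definition good :: "nat \<Rightarrow> (nat \<Rightarrow> nat) \<Rightarrow> nat \<Rightarrow> bool" where
  "good n \<sigma> r \<longleftrightarrow> (\<exists>(Q, d)\<in>set rules. \<exists>R K. conf n \<sigma> Q R K \<and> R d = r)"

lemma conf_iff_patterns:
  assumes "\<sigma> permutes {..<n}" "tight n \<sigma>" "distinct (snd Q)" "set (snd Q) = {..<length (fst Q)}" "fst Q \<noteq> []"
    "\<forall>l\<in>set (fst Q). \<forall>\<tau>\<in>set l. \<tau> < 7"
  shows "(\<exists>L\<in>set (plain_patterns Q). contains n \<sigma> L) \<longleftrightarrow> (\<exists>R K. conf n \<sigma> Q R K)"
    "g \<le> length (fst Q) \<Longrightarrow> (\<exists>L\<in>set (row_patterns Q g). contains n \<sigma> L) \<longleftrightarrow>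
       (\<exists>R K. conf n \<sigma> Q R K \<and> row_gap n (length (fst Q)) R g)"
    "0 < g \<Longrightarrow> g < length (fst Q) \<Longrightarrow> (\<exists>L\<in>set (col_patterns Q g). contains n \<sigma> L) \<longleftrightarrow>
       (\<exists>R K. conf n \<sigma> Q R K \<and> col_gap (snd Q) K g)"
proof -
  have pos: "0 < length (fst Q)" using assms(5) by simp
  show "(\<exists>L\<in>set (plain_patterns Q). contains n \<sigma> L) \<longleftrightarrow> (\<exists>R K. conf n \<sigma> Q R K)"
    using confocc_iff_plain[OF assms(3,4,1,2) refl pos assms(6)]
    by (simp add: plain_patterns_def words_def size_of_def conf_def)
  show "(\<exists>L\<in>set (row_patterns Q g). contains n \<sigma> L) \<longleftrightarrow>
       (\<exists>R K. conf n \<sigma> Q R K \<and> row_gap n (length (fst Q)) R g)" if "g \<le> length (fst Q)"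
    using confocc_iff_zero_row[OF assms(3,4,1,2) refl pos assms(6) that]
    by (simp add: row_patterns_def words_def size_of_def conf_def)
  show "(\<exists>L\<in>set (col_patterns Q g). contains n \<sigma> L) \<longleftrightarrow>
       (\<exists>R K. conf n \<sigma> Q R K \<and> col_gap (snd Q) K g)" if "0 < g" "g < length (fst Q)"
    using confocc_iff_zero_col[OF assms(3,4,1,2) refl pos assms(6) that]
    by (simp add: col_patterns_def words_def size_of_def conf_def)
qed

lemma ball_concat_map: "(\<forall>x\<in>set (concat (map f xs)). P x) \<longleftrightarrow> (\<forall>y\<in>set xs. \<forall>x\<in>set (f y). P x)"
  by auto

lemma avoids_block_patterns:
  assumes "\<sigma> permutes {..<n}"
  shows "(\<forall>L\<in>set block_patterns. \<not> contains n \<sigma> L) \<longleftrightarrow> tight n \<sigma>"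
proof -
  have "(\<forall>L\<in>set block_patterns. \<not> contains n \<sigma> L) \<longleftrightarrow> (\<forall>\<tau>\<in>set [0..<7]. \<forall>z\<in>set [1..<7].
     \<not> contains n \<sigma> (zero_row_pattern 7 (letter \<tau>) z) \<and> \<not> contains n \<sigma> (zero_col_pattern 7 (letter \<tau>) z))"
    unfolding block_patterns_def ball_concat_map by simp
  then show ?thesis unfolding tight_iff[OF assms] by auto
qed

text \<open>Configurations can be read off pattern occurrences only for tight permutations. Without
  tightness a block pattern is contained and both sides are false.\<close>

lemma avoids_forbidden:
  assumes \<sigma>: "\<sigma> permutes {..<n}"
  shows "(\<forall>L\<in>forbidden. \<not> contains n \<sigma> L) \<longleftrightarrow> admissible n \<sigma>"
proof (cases "tight n \<sigma>")
  case False
  then show ?thesis using avoids_block_patterns[OF \<sigma>]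
    unfolding forbidden_def admissible_def set_append ball_Un by blast
next
  case True
  have "(\<forall>L\<in>set rule_patterns. \<not> contains n \<sigma> L) \<longleftrightarrow> (\<forall>Cd\<in>set rules. \<not> (\<exists>R K. conf n \<sigma> (special Cd) R K))"
  proof -
    have "(\<exists>L\<in>set (plain_patterns (special Cd)). contains n \<sigma> L) \<longleftrightarrow> (\<exists>R K. conf n \<sigma> (special Cd) R K)"
      if Cd: "Cd \<in> set rules" for Cd
    proof (rule conf_iff_patterns(1)[OF \<sigma> True])
      obtain Q d where [simp]: "Cd = (Q, d)" by (cases Cd)
      have w: "wf_config Q" using wf_rules Cd by simp
      then show "distinct (snd (special Cd))" "set (snd (special Cd)) = {..<length (fst (special Cd))}"
        "fst (special Cd) \<noteq> []"
        by (auto simp: wf_config_def special_def)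
      show "\<forall>l\<in>set (fst (special Cd)). \<forall>\<tau>\<in>set l. \<tau> < 7"
        using w set_update_subset_insert[of "fst Q" d "[5]"] by (fastforce simp: wf_config_def special_def)
    qed
    then show ?thesis unfolding rule_patterns_def ball_concat_map by blast
  qed
  moreover have "(\<forall>L\<in>set tightness_patterns. \<not> contains n \<sigma> L) \<longleftrightarrow> (\<forall>T\<in>set tight_configs. gap_free n \<sigma> T)"
  proof -
    have "(\<forall>L\<in>set (concat (map (row_patterns Q) rg) @ concat (map (col_patterns Q) cg)). \<not> contains n \<sigma> L)
        \<longleftrightarrow> gap_free n \<sigma> (Q, rg, cg)" if T: "(Q, rg, cg) \<in> set tight_configs" for Q rg cg
    proof -
      have w: "distinct (snd Q)" "set (snd Q) = {..<length (fst Q)}" "fst Q \<noteq> []"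
        "\<forall>l\<in>set (fst Q). \<forall>\<tau>\<in>set l. \<tau> < 7"
        using wf_tight_configs(1)[OF T] by (auto simp: wf_config_def)
      have r: "(\<exists>L\<in>set (row_patterns Q g). contains n \<sigma> L) \<longleftrightarrow>
          (\<exists>R K. conf n \<sigma> Q R K \<and> row_gap n (length (fst Q)) R g)" if "g \<in> set rg" for g
        by (rule conf_iff_patterns(2)[OF \<sigma> True w]) (use wf_tight_configs(2)[OF T] that in auto)
      have c: "(\<exists>L\<in>set (col_patterns Q g). contains n \<sigma> L) \<longleftrightarrow>
          (\<exists>R K. conf n \<sigma> Q R K \<and> col_gap (snd Q) K g)" if "g \<in> set cg" for g
        by (rule conf_iff_patterns(3)[OF \<sigma> True w]) (use wf_tight_configs(3)[OF T] that in auto)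
      have "(\<forall>L\<in>set (concat (map (row_patterns Q) rg) @ concat (map (col_patterns Q) cg)). \<not> contains n \<sigma> L)
        \<longleftrightarrow> (\<forall>g\<in>set rg. \<not> (\<exists>L\<in>set (row_patterns Q g). contains n \<sigma> L)) \<and>
            (\<forall>g\<in>set cg. \<not> (\<exists>L\<in>set (col_patterns Q g). contains n \<sigma> L))"
        by auto
      also have "\<dots> \<longleftrightarrow> gap_free n \<sigma> (Q, rg, cg)"
        using r c unfolding gap_free_def prod.case by blast
      finally show ?thesis .
    qed
    then show ?thesis unfolding tightness_patterns_def ball_concat_map
      by (intro ball_cong refl) (simp only: split_paired_all prod.case)
  qed
  ultimately show ?thesis
    using avoids_block_patterns[OF \<sigma>] True
    unfolding forbidden_def admissible_def set_append ball_Un by blast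
qed

lemma contains_start_patterns:
  assumes "\<sigma> permutes {..<n}" "tight n \<sigma>"
  shows "(\<exists>L\<in>start_patterns. contains n \<sigma> L) \<longleftrightarrow> started n \<sigma>"
  unfolding start_patterns_def started_def
  by (rule conf_iff_patterns(1)[OF assms]) (use wf_start in \<open>auto simp: wf_config_def\<close>)

definition run_perms :: "nat \<Rightarrow> (nat \<Rightarrow> nat) set" where
  "run_perms n = {\<sigma>. \<sigma> permutes {..<n} \<and> admissible n \<sigma> \<and> started n \<sigma>}"

lemma finite_run_perms: "finite (run_perms n)"
  using finite_subset[OF _ finite_permutations[of "{..<n}"]] by (auto simp: run_perms_def)

lemma C_difference: "C forbidden n = C (forbidden \<union> start_patterns) n + card (run_perms n)"
proof -
  have "(\<forall>L\<in>forbidden \<union> start_patterns. \<not> contains n \<sigma> L) \<longleftrightarrow> admissible n \<sigma> \<and> \<not> started n \<sigma>"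
    if "\<sigma> permutes {..<n}" for \<sigma>
    using avoids_forbidden[OF that] contains_start_patterns[OF that]
    unfolding ball_Un admissible_def by blast
  then have B: "C (forbidden \<union> start_patterns) n = card {\<sigma>. \<sigma> permutes {..<n} \<and> admissible n \<sigma> \<and> \<not> started n \<sigma>}"
    unfolding C_def by (metis (no_types, lifting))
  have A: "C forbidden n = card {\<sigma>. \<sigma> permutes {..<n} \<and> admissible n \<sigma>}"
    unfolding C_def using avoids_forbidden by (metis (no_types, lifting))
  have "{\<sigma>. \<sigma> permutes {..<n} \<and> admissible n \<sigma>} =
      {\<sigma>. \<sigma> permutes {..<n} \<and> admissible n \<sigma> \<and> \<not> started n \<sigma>} \<union> run_perms n"
    unfolding run_perms_def by blast
  moreover have "finite {\<sigma>. \<sigma> permutes {..<n} \<and> admissible n \<sigma> \<and> \<not> started n \<sigma>}"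
    by (rule finite_subset[OF _ finite_permutations[of "{..<n}"]]) auto
  ultimately show ?thesis
    unfolding A B using finite_run_perms by (simp add: card_Un_disjoint run_perms_def disjoint_iff)
qed

section \<open>Size and number of the patterns\<close>

lemma word_bij_config:
  assumes "distinct (snd Q)" "set (snd Q) = {..<length (fst Q)}" "\<forall>l\<in>set (fst Q). \<forall>\<tau>\<in>set l. \<tau> < 7"
    and "f \<in> set (words Q)"
  shows "bij_betw f {..<size_of Q} {..<size_of Q}"
proof -
  obtain ts where ts: "f = word ts (snd Q)" "list_all2 (\<lambda>x ys. x \<in> set ys) ts (fst Q)"
    using assms(4) by (auto simp: words_def product_lists_set)
  then have "length ts = length (fst Q)" by (simp add: list_all2_lengthD)
  moreover have "\<forall>\<tau>\<in>set ts. \<tau> < 7"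
  proof
    fix \<tau> assume "\<tau> \<in> set ts"
    then obtain j where j: "j < length ts" "ts ! j = \<tau>" by (auto simp: in_set_conv_nth)
    then have "\<tau> \<in> set (fst Q ! j)" "fst Q ! j \<in> set (fst Q)"
      using ts(2) list_all2_nthD[OF ts(2), of j] list_all2_lengthD[OF ts(2)] by auto
    then show "\<tau> < 7" using assms(3) by blast
  qed
  ultimately show ?thesis
    using word_bij[OF assms(1,2)] ts(1) by (simp add: size_of_def)
qed

lemma forbidden_patterns_small:
  assumes "L \<in> forbidden \<union> start_patterns"
  shows "partial_pattern L \<and> prows L \<le> 80 \<and> pcols L \<le> 80"
proof -
  have cfg: "partial_pattern L' \<and> prows L' \<le> 80 \<and> pcols L' \<le> 80"
    if "L' \<in> set (plain_patterns Q) \<union> set (row_patterns Q g) \<union> set (col_patterns Q g)"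
      "distinct (snd Q)" "set (snd Q) = {..<length (fst Q)}" "\<forall>l\<in>set (fst Q). \<forall>\<tau>\<in>set l. \<tau> < 7"
      "length (fst Q) \<le> 9" for L' Q g
    using that(1,5) partial_patterns[OF word_bij_config[OF that(2-4)]]
    by (auto simp: plain_patterns_def row_patterns_def col_patterns_def pattern_sizes size_of_def)
  have wf: "partial_pattern L' \<and> prows L' \<le> 80 \<and> pcols L' \<le> 80"
    if "L' \<in> set (plain_patterns Q) \<union> set (row_patterns Q g) \<union> set (col_patterns Q g)" "wf_config Q" for L' Q g
    using cfg[OF that(1)] that(2) by (auto simp: wf_config_def)
  consider "L \<in> set block_patterns" | "L \<in> set rule_patterns" | "L \<in> set tightness_patterns"
    | "L \<in> set (plain_patterns start_config)"
    using assms by (auto simp: forbidden_def start_patterns_def)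
  then show ?thesis
  proof cases
    case 1
    then show ?thesis
      using partial_patterns[OF letter_bij] by (auto simp: block_patterns_def pattern_sizes)
  next
    case 2
    have "L \<in> (\<Union>Cd\<in>set rules. set (plain_patterns (special Cd)))"
      using 2 unfolding rule_patterns_def by simp
    then obtain Q d where Cd: "(Q, d) \<in> set rules" "L \<in> set (plain_patterns (special (Q, d)))"
      by fastforce
    have w: "wf_config Q" using wf_rules Cd by simp
    have "\<forall>l\<in>set (fst (special (Q, d))). \<forall>\<tau>\<in>set l. \<tau> < 7"
      using w set_update_subset_insert[of "fst Q" d "[5]"] by (fastforce simp: wf_config_def special_def)
    then show ?thesis using cfg[of L "special (Q, d)" 0] Cd w by (auto simp: wf_config_def special_def)
  next
    case 3
    have "\<forall>L\<in>set tightness_patterns. partial_pattern L \<and> prows L \<le> 80 \<and> pcols L \<le> 80"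
      unfolding tightness_patterns_def ball_concat_map
    proof (intro ballI)
      fix T L assume T: "T \<in> set tight_configs"
        and L: "L \<in> set ((\<lambda>(Q, rg, cg). concat (map (row_patterns Q) rg) @ concat (map (col_patterns Q) cg)) T)"
      obtain Q rg cg where [simp]: "T = (Q, rg, cg)" by (cases T)
      have "\<exists>g. L \<in> set (row_patterns Q g) \<union> set (col_patterns Q g)" using L by (auto simp del: split_paired_Ex)
      then show "partial_pattern L \<and> prows L \<le> 80 \<and> pcols L \<le> 80"
        using wf[of L Q] wf_tight_configs(1)[of Q rg cg] T by auto
    qed
    with 3 show ?thesis by blast
  next
    case 4
    then show ?thesis using wf[of L start_config 0] wf_start by blast
  qed
qed

text \<open>The lists have lengths 84 (letters with an inner empty line), 17 (rules with type 5),
  244 (configurations with an empty line) and 2 (start patterns).\<close>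

lemma card_forbidden: "card (forbidden \<union> start_patterns) \<le> 6854"
proof -
  have "forbidden \<union> start_patterns =
      set (block_patterns @ rule_patterns @ tightness_patterns @ plain_patterns start_config)"
    by (auto simp: forbidden_def start_patterns_def)
  then have "card (forbidden \<union> start_patterns) \<le>
      length (block_patterns @ rule_patterns @ tightness_patterns @ plain_patterns start_config)"
    by (metis card_length)
  also have "\<dots> \<le> 6854"
    by (simp add: block_patterns_def rule_patterns_def tightness_patterns_def length_concat
      plain_patterns_def row_patterns_def col_patterns_def words_def rules_def tight_configs_def
      special_def config_defs upt_rec)
  finally show ?thesis .
qed

section \<open>Toggling the first bad block\<close>

lemma even_card_involution:
  assumes "finite S" "\<And>x. x \<in> S \<Longrightarrow> f x \<in> S" "\<And>x. x \<in> S \<Longrightarrow> f (f x) = x" "\<And>x. x \<in> S \<Longrightarrow> f x \<noteq> x"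
  shows "even (card S)"
  using assms
proof (induction "card S" arbitrary: S rule: less_induct)
  case less
  show ?case
  proof (cases "S = {}")
    case False
    then obtain x where x: "x \<in> S" by blast
    let ?T = "S - {x, f x}"
    have sub: "{x, f x} \<subseteq> S" "card {x, f x} = 2" using x less.prems(2,4)[OF x] by auto
    then have card: "card S = card ?T + 2"
      using less.prems(1) card_mono[of S "{x, f x}"] by (simp add: card_Diff_subset)
    have "even (card ?T)"
    proof (rule less.hyps)
      show "card ?T < card S" using card by simp
      show "finite ?T" using less.prems(1) by simp
      fix y assume y: "y \<in> ?T"
      then show "f (f y) = y" "f y \<noteq> y" using less.prems by auto
      have "f y \<noteq> x" "f y \<noteq> f x" using y less.prems(3)[of y] less.prems(3)[OF x] by auto
      then show "f y \<in> ?T" using y less.prems(2) by auto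
    qed
    then show ?thesis using card by simp
  qed simp
qed

lemma card_smaller_values:
  fixes f :: "nat \<Rightarrow> nat"
  assumes f: "bij_betw f {..<m} {..<m}" and i: "i < m"
  shows "card {j. j < m \<and> f j < f i} = f i"
proof -
  have img: "f ` {..<m} = {..<m}" using f by (simp add: bij_betw_def)
  have "f ` {j. j < m \<and> f j < f i} = {..<f i}"
  proof
    show "{..<f i} \<subseteq> f ` {j. j < m \<and> f j < f i}"
    proof
      fix v assume v: "v \<in> {..<f i}"
      moreover have "f i < m" using img i by blast
      ultimately have "v \<in> f ` {..<m}" using img by simp
      then show "v \<in> f ` {j. j < m \<and> f j < f i}" using v by auto
    qed
  qed auto
  moreover have "inj_on f {j. j < m \<and> f j < f i}"
    by (rule inj_on_subset[of f "{..<m}"]) (use f in \<open>auto simp: bij_betw_def\<close>)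
  ultimately show ?thesis using card_image[of f "{j. j < m \<and> f j < f i}"] by simp
qed

text \<open>The value of a permutation at \<open>i\<close> is the number of smaller values, so the
  relative order determines it.\<close>

lemma bij_order_eqD:
  fixes f g :: "nat \<Rightarrow> nat"
  assumes f: "bij_betw f {..<m} {..<m}" and g: "bij_betw g {..<m} {..<m}"
    and order: "\<And>i j. i < m \<Longrightarrow> j < m \<Longrightarrow> f i < f j \<Longrightarrow> g i < g j" and i: "i < m"
  shows "f i = g i"
proof -
  have "f j < f i \<longleftrightarrow> g j < g i" if j: "j < m" for j
  proof (cases "j = i")
    case False
    then have "f i \<noteq> f j" using f i j by (auto simp: bij_betw_def dest: inj_onD)
    then have "f i < f j \<or> f j < f i" by linarith
    then show ?thesis using order[OF i j] order[OF j i] by linarith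
  qed simp
  then have "{j. j < m \<and> f j < f i} = {j. j < m \<and> g j < g i}" by blast
  then show ?thesis
    using card_smaller_values[OF f i] card_smaller_values[OF g i] by simp
qed

lemma letter_order_eqD:
  assumes "\<tau> < 7" "\<tau>' < 7" "\<And>i j. i < 7 \<Longrightarrow> j < 7 \<Longrightarrow> letter \<tau> i < letter \<tau> j \<Longrightarrow> letter \<tau>' i < letter \<tau>' j"
  shows "\<tau> = \<tau>'"
  using bij_order_eqD[OF letter_bij[OF assms(1)] letter_bij[OF assms(2)] assms(3)] letter_eqD[OF assms(1,2)] by blast

definition flip :: "nat \<Rightarrow> nat" where
  "flip \<tau> = (if \<tau> = 4 then 5 else if \<tau> = 5 then 4 else \<tau>)"

definition rewrite_block :: "nat \<Rightarrow> nat \<Rightarrow> nat \<Rightarrow> (nat \<Rightarrow> nat) \<Rightarrow> nat \<Rightarrow> nat" where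
  "rewrite_block \<tau> r c \<sigma> x = (if r \<le> x \<and> x < r + 7 then c + letter \<tau> (x - r) else \<sigma> x)"

section \<open>Replacing the letter in one block\<close>

context
  fixes n :: nat and \<sigma> :: "nat \<Rightarrow> nat" and \<tau>0 \<tau>1 r0 c0 :: nat
  assumes \<sigma>: "\<sigma> permutes {..<n}" and b0: "blk n \<sigma> \<tau>0 r0 c0" and \<tau>1: "\<tau>1 < 7"
begin

abbreviation rewritten :: "nat \<Rightarrow> nat" where "rewritten \<equiv> rewrite_block \<tau>1 r0 c0 \<sigma>"

lemma rewrite_outside: "\<not> (r0 \<le> x \<and> x < r0 + 7) \<Longrightarrow> rewritten x = \<sigma> x"
  by (auto simp: rewrite_block_def)

lemma rewrite_inside: "i < 7 \<Longrightarrow> rewritten (r0 + i) = c0 + letter \<tau>1 i"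
  by (auto simp: rewrite_block_def)

lemma rewrite_range: "(r0 \<le> x \<and> x < r0 + 7) \<longleftrightarrow> (c0 \<le> rewritten x \<and> rewritten x < c0 + 7)"
proof (cases "r0 \<le> x \<and> x < r0 + 7")
  case True
  then have "x - r0 < 7" by linarith
  then show ?thesis using True letter_less[OF \<tau>1, of "x - r0"] by (simp add: rewrite_block_def)
next
  case False
  then show ?thesis using blk_mem[OF \<sigma> b0, of x] rewrite_outside[OF False] by simp
qed

lemma rewrite_permutes: "rewritten permutes {..<n}"
proof (rule bij_imp_permutes)
  have inside: "r0 \<le> x \<and> x < r0 + 7 \<Longrightarrow> x < n" for x using blk_row[OF b0] by linarith
  have "rewritten x < n" if "x < n" for x
  proof (cases "r0 \<le> x \<and> x < r0 + 7")
    case True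
    then show ?thesis using rewrite_range[of x] blk_cols[OF \<sigma> b0] by linarith
  next
    case False
    then show ?thesis using rewrite_outside[OF False] permutes_lessThan_iff[OF \<sigma>] that by simp
  qed
  moreover have "inj_on rewritten {..<n}"
  proof (rule inj_onI)
    fix x y assume eq: "rewritten x = rewritten y"
    show "x = y"
    proof (cases "r0 \<le> x \<and> x < r0 + 7")
      case True
      then have y: "r0 \<le> y \<and> y < r0 + 7" using rewrite_range[of x] rewrite_range[of y] eq by simp
      then have "letter \<tau>1 (x - r0) = letter \<tau>1 (y - r0)" using True eq by (simp add: rewrite_block_def)
      moreover have "x - r0 < 7" "y - r0 < 7" using True y by linarith+
      ultimately have "x - r0 = y - r0" using letter_inj[OF \<tau>1] by blast
      then show ?thesis using True y by linarith
    next
      case False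
      then have y: "\<not> (r0 \<le> y \<and> y < r0 + 7)" using rewrite_range[of x] rewrite_range[of y] eq by simp
      then show ?thesis using eq rewrite_outside[OF False] rewrite_outside[OF y] permutes_eq_iff[OF \<sigma>] by simp
    qed
  qed
  ultimately show "bij_betw rewritten {..<n} {..<n}" by (simp add: bij_betw_def endo_inj_surj image_subset_iff)
  show "rewritten x = x" if "x \<notin> {..<n}" for x
    using that rewrite_outside[of x] inside[of x] permutes_not_in[OF \<sigma>] by auto
qed

lemma rewrite_blk0: "blk n rewritten \<tau>1 r0 c0"
  using blk_row[OF b0] \<tau>1 rewrite_inside by (simp add: blk_def)

lemma rewrite_blk:
  "blk n rewritten \<tau> r c \<longleftrightarrow> (if r = r0 then \<tau> = \<tau>1 \<and> c = c0 else blk n \<sigma> \<tau> r c)"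
proof (cases "r = r0")
  case True
  then show ?thesis using blk_unique[of n rewritten \<tau> r0 c \<tau>1 c0] rewrite_blk0 by auto
next
  case False
  have "blk n rewritten \<tau> r c \<longleftrightarrow> blk n \<sigma> \<tau> r c" if "r + 7 \<le> r0 \<or> r0 + 7 \<le> r"
  proof -
    have "rewritten (r + i) = \<sigma> (r + i)" if "i < 7" for i
      by (rule rewrite_outside) (use that \<open>r + 7 \<le> r0 \<or> r0 + 7 \<le> r\<close> in linarith)
    then show ?thesis by (simp add: blk_def)
  qed
  moreover have "r + 7 \<le> r0 \<or> r0 + 7 \<le> r" if "blk n \<sigma> \<tau> r c"
    using blk_disjoint_rows[OF \<sigma> that b0] blk_disjoint_rows[OF \<sigma> b0 that] False by linarith
  moreover have "r + 7 \<le> r0 \<or> r0 + 7 \<le> r" if "blk n rewritten \<tau> r c"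
    using blk_disjoint_rows[OF rewrite_permutes that rewrite_blk0]
      blk_disjoint_rows[OF rewrite_permutes rewrite_blk0 that] False by linarith
  ultimately show ?thesis using False by auto
qed

text \<open>An occurrence after the change that has two points in the new block is that block.
  Otherwise at most one of its points was moved, and only within the seven columns of the block, so
  comparisons with points outside are unchanged and it already was an occurrence in
  \<open>\<sigma>\<close>.\<close>

lemma rewrite_tight:
  assumes t: "tight n \<sigma>"
  shows "tight n rewritten"
  unfolding tight_def
proof (intro allI impI)
  fix \<tau> s assume \<tau>: "\<tau> < 7" and s: "occ n rewritten 7 (letter \<tau>) s"
  let ?I = "\<lambda>x. r0 \<le> x \<and> x < r0 + 7"
  show "(\<forall>i<7. s i = s 0 + i) \<and> (\<exists>c. blk n rewritten \<tau> (s 0) c)"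
  proof (cases "\<exists>i j. i < j \<and> j < 7 \<and> ?I (s i) \<and> ?I (s j)")
    case True
    then obtain i j where ij: "i < j" "j < 7" "r0 \<le> s i" "s i < r0 + 7" "r0 \<le> s j" "s j < r0 + 7" by blast
    have sk: "s k = r0 + k" if "k < 7" for k
      by (rule occ_meets_block[OF rewrite_permutes s \<tau> rewrite_blk0 ij that])
    have "letter \<tau>1 i < letter \<tau>1 j" if "i < 7" "j < 7" "letter \<tau> i < letter \<tau> j" for i j
      using occ_value[OF s that] sk[OF that(1)] sk[OF that(2)] rewrite_inside[OF that(1)] rewrite_inside[OF that(2)]
      by simp
    then have "\<tau> = \<tau>1" by (rule letter_order_eqD[OF \<tau> \<tau>1])
    moreover have "s 0 = r0" using sk[of 0] by simp
    ultimately show ?thesis using sk rewrite_blk0 by simp blast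
  next
    case False
    then have single: "\<not> (?I (s i) \<and> ?I (s j))" if "i < 7" "j < 7" "i \<noteq> j" for i j
      using False that by (cases "i < j") (blast, metis nat_neq_iff)
    have "occ n \<sigma> 7 (letter \<tau>) s"
    proof (rule occI)
      fix i j assume ij: "i < (7::nat)" "j < (7::nat)" "letter \<tau> i < letter \<tau> j"
      then have lt: "rewritten (s i) < rewritten (s j)" by (rule occ_value[OF s])
      have "i \<noteq> j" using ij by auto
      note m = blk_mem[OF \<sigma> b0, of "s i"] blk_mem[OF \<sigma> b0, of "s j"]
        rewrite_range[of "s i"] rewrite_range[of "s j"]
      consider "?I (s i)" "\<not> ?I (s j)" | "\<not> ?I (s i)" "?I (s j)" | "\<not> ?I (s i)" "\<not> ?I (s j)"
        using single[OF ij(1,2) \<open>i \<noteq> j\<close>] by blast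
      then show "\<sigma> (s i) < \<sigma> (s j)"
      proof cases
        case 1
        then have "rewritten (s j) = \<sigma> (s j)" by (intro rewrite_outside)
        then show ?thesis using m 1 lt by linarith
      next
        case 2
        then have "rewritten (s i) = \<sigma> (s i)" by (intro rewrite_outside)
        then show ?thesis using m 2 lt by linarith
      next
        case 3
        then show ?thesis using lt rewrite_outside[of "s i"] rewrite_outside[of "s j"] by simp
      qed
    qed (simp_all add: occ_mono[OF s] occ_less[OF s])
    then obtain c where rows: "\<And>i. i < 7 \<Longrightarrow> s i = s 0 + i" and c: "blk n \<sigma> \<tau> (s 0) c"
      using t \<tau> unfolding tight_def by blast
    have "s 0 \<noteq> r0" using single[of 0 1] rows[of 1] by auto
    then have "blk n rewritten \<tau> (s 0) c" using rewrite_blk c by simp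
    then show ?thesis using rows by blast
  qed
qed

lemma rewrite_confocc:
  assumes "\<forall>l\<in>set cls. \<tau>0 \<in> set l \<longleftrightarrow> \<tau>1 \<in> set l"
  shows "confocc n rewritten cls co R K \<longleftrightarrow> confocc n \<sigma> cls co R K"
proof -
  have "(\<exists>\<tau>\<in>set (cls ! j). blk n rewritten \<tau> (R j) (K j)) \<longleftrightarrow> (\<exists>\<tau>\<in>set (cls ! j). blk n \<sigma> \<tau> (R j) (K j))"
    if j: "j < length cls" for j
  proof (cases "R j = r0")
    case True
    have "blk n \<sigma> \<tau> r0 c \<longleftrightarrow> \<tau> = \<tau>0 \<and> c = c0" for \<tau> c
      using blk_unique[OF b0, of \<tau> c] b0 by auto
    then show ?thesis using True assms nth_mem[OF j] by (auto simp: rewrite_blk)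
  next
    case False
    then show ?thesis by (simp add: rewrite_blk)
  qed
  then show ?thesis by (simp add: confocc_def)
qed

end

lemma flip_simps [simp]: "flip 4 = 5" "flip 5 = 4"
  by (simp_all add: flip_def)

lemma rule_config_wf: "(Q, d) \<in> set rules \<Longrightarrow> wf_config Q" "(Q, rg, cg) \<in> set tight_configs \<Longrightarrow> wf_config Q"
  by (fact wf_rules(1) wf_tight_configs(1))+

section \<open>Exchanging types 4 and 5\<close>

context
  fixes n :: nat and \<sigma> :: "nat \<Rightarrow> nat" and \<tau> r c :: nat
  assumes \<sigma>: "\<sigma> permutes {..<n}" and b: "blk n \<sigma> \<tau> r c" and \<tau>: "\<tau> \<in> {4, 5}"
begin

lemma toggle_conf:
  assumes "wf_config Q"
  shows "conf n (rewrite_block (flip \<tau>) r c \<sigma>) Q R K \<longleftrightarrow> conf n \<sigma> Q R K"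
  unfolding conf_def
  by (rule rewrite_confocc[OF \<sigma> b]) (use assms \<tau> in \<open>auto simp: wf_config_def\<close>)

lemma toggle_good: "good n (rewrite_block (flip \<tau>) r c \<sigma>) r' \<longleftrightarrow> good n \<sigma> r'"
  unfolding good_def using toggle_conf rule_config_wf(1) by fastforce

lemma toggle_started: "started n (rewrite_block (flip \<tau>) r c \<sigma>) \<longleftrightarrow> started n \<sigma>"
  unfolding started_def using toggle_conf[OF wf_start] by blast

lemma toggle_blk:
  "blk n (rewrite_block (flip \<tau>) r c \<sigma>) \<tau>' r' c' \<longleftrightarrow> (if r' = r then \<tau>' = flip \<tau> \<and> c' = c else blk n \<sigma> \<tau>' r' c')"
  by (rule rewrite_blk[OF \<sigma> b]) (use \<tau> in auto)

lemma toggle_toggle: "rewrite_block \<tau> r c (rewrite_block (flip \<tau>) r c \<sigma>) = \<sigma>"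
proof
  fix x
  show "rewrite_block \<tau> r c (rewrite_block (flip \<tau>) r c \<sigma>) x = \<sigma> x"
  proof (cases "r \<le> x \<and> x < r + 7")
    case True
    then have "x - r < 7" by linarith
    then show ?thesis using blkD[OF b, of "x - r"] True by (simp add: rewrite_block_def)
  qed (auto simp: rewrite_block_def)
qed

lemma toggle_neq: "rewrite_block (flip \<tau>) r c \<sigma> \<noteq> \<sigma>"
proof
  assume "rewrite_block (flip \<tau>) r c \<sigma> = \<sigma>"
  then have "blk n \<sigma> (flip \<tau>) r c" using toggle_blk[of "flip \<tau>" r c] by simp
  then show False using blk_unique[OF b, of "flip \<tau>" c] \<tau> by auto
qed

lemma conf_special_imp:
  assumes "(Q, d) \<in> set rules" "conf m \<rho> (special (Q, d)) R K"
  shows "conf m \<rho> Q R K"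
proof -
  have "fst Q ! d = [4, 5]" "d < length (fst Q)" using wf_rules assms by auto
  then have "\<exists>\<tau>\<in>set (fst Q ! j). blk m \<rho> \<tau> (R j) (K j)"
    if "j < length (fst Q)" "\<exists>\<tau>\<in>set ((fst Q)[d := [5]] ! j). blk m \<rho> \<tau> (R j) (K j)" for j
    using that by (cases "j = d") auto
  then show ?thesis using assms(2) by (simp add: conf_def confocc_def special_def)
qed

text \<open>A forbidden special configuration created by toggling would have to use the toggled block as its own pointer,
  which would make that block good.\<close>

lemma toggle_admissible:
  assumes adm: "admissible n \<sigma>" and bad: "\<not> good n \<sigma> r"
  shows "admissible n (rewrite_block (flip \<tau>) r c \<sigma>)"
proof -
  let ?\<sigma> = "rewrite_block (flip \<tau>) r c \<sigma>"
  have "tight n ?\<sigma>"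
    by (rule rewrite_tight[OF \<sigma> b]) (use adm \<tau> in \<open>auto simp: admissible_def\<close>)
  moreover have "gap_free n ?\<sigma> T" if T: "T \<in> set tight_configs" for T
  proof -
    obtain Q rg cg where [simp]: "T = (Q, rg, cg)" by (cases T)
    have "gap_free n \<sigma> T" using adm T by (auto simp: admissible_def)
    then show ?thesis using toggle_conf[OF rule_config_wf(2)[of Q rg cg]] T by (simp add: gap_free_def)
  qed
  moreover have False if Cd: "Cd \<in> set rules" and cf: "conf n ?\<sigma> (special Cd) R K" for Cd R K
  proof -
    obtain Q d where [simp]: "Cd = (Q, d)" by (cases Cd)
    note w = wf_rules[of Q d]
    have d: "d < length (fst Q)" "wf_config Q" using w Cd by auto
    have cs: "conf n \<sigma> Q R K"
      using conf_special_imp[of Q d n ?\<sigma> R K] cf Cd toggle_conf[OF d(2), of R K] by simp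
    then have "R d \<noteq> r" using bad Cd by (auto simp: good_def)
    moreover have "blk n ?\<sigma> 5 (R d) (K d)"
      using cf d(1) by (auto simp: conf_def confocc_def special_def dest!: spec[of _ d])
    ultimately have "blk n \<sigma> 5 (R d) (K d)" using toggle_blk by simp
    then have "\<exists>\<tau>\<in>set ((fst Q)[d := [5]] ! j). blk n \<sigma> \<tau> (R j) (K j)" if "j < length (fst Q)" for j
      using cs that by (cases "j = d") (auto simp: conf_def confocc_def)
    then have "conf n \<sigma> (special Cd) R K" using cs by (simp add: conf_def confocc_def special_def)
    then show False using adm Cd unfolding admissible_def by blast
  qed
  ultimately show ?thesis unfolding admissible_def by blast
qed

end

definition bad :: "nat \<Rightarrow> (nat \<Rightarrow> nat) \<Rightarrow> nat \<Rightarrow> bool" where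
  "bad n \<sigma> r \<longleftrightarrow> (\<exists>\<tau>\<in>{4, 5}. \<exists>c. blk n \<sigma> \<tau> r c) \<and> \<not> good n \<sigma> r"

text \<open>The first column of the block is recovered from its first entry, which keeps the map a
  function of the permutation alone.\<close>

definition toggle_first :: "nat \<Rightarrow> (nat \<Rightarrow> nat) \<Rightarrow> (nat \<Rightarrow> nat)" where
  "toggle_first n \<sigma> = (let r = (LEAST r. bad n \<sigma> r) in
     if blk n \<sigma> 4 r (\<sigma> r - letter 4 0) then rewrite_block 5 r (\<sigma> r - letter 4 0) \<sigma>
     else rewrite_block 4 r (\<sigma> r - letter 5 0) \<sigma>)"

definition perfect_runs :: "nat \<Rightarrow> (nat \<Rightarrow> nat) set" where
  "perfect_runs n = {\<sigma> \<in> run_perms n. \<forall>r. \<not> bad n \<sigma> r}"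

lemma toggle_first_eq:
  assumes "\<tau> \<in> {4, 5}" "blk n \<sigma> \<tau> r c" "r = (LEAST r. bad n \<sigma> r)"
  shows "toggle_first n \<sigma> = rewrite_block (flip \<tau>) r c \<sigma>"
proof -
  have c: "c = \<sigma> r - letter \<tau> 0" using blkD[OF assms(2), of 0] by simp
  show ?thesis
  proof (cases "\<tau> = 4")
    case True
    then show ?thesis using assms(2,3) c by (simp add: toggle_first_def Let_def)
  next
    case False
    then have "\<tau> = 5" using assms(1) by simp
    moreover have "\<not> blk n \<sigma> 4 r (\<sigma> r - letter 4 0)"
      using blk_unique[OF assms(2), of 4 "\<sigma> r - letter 4 0"] \<open>\<tau> = 5\<close> by linarith
    ultimately show ?thesis using assms(3) c by (simp add: toggle_first_def Let_def)
  qed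
qed

lemma card_run_perms_parity: "even (card (run_perms n)) \<longleftrightarrow> even (card (perfect_runs n))"
proof -
  define S where "S = {\<sigma> \<in> run_perms n. \<exists>r. bad n \<sigma> r}"
  have key: "toggle_first n \<sigma> \<in> S \<and> toggle_first n (toggle_first n \<sigma>) = \<sigma> \<and> toggle_first n \<sigma> \<noteq> \<sigma>"
    if "\<sigma> \<in> S" for \<sigma>
  proof -
    define r where "r = (LEAST r. bad n \<sigma> r)"
    have r: "bad n \<sigma> r" using that LeastI_ex[of "bad n \<sigma>"] by (auto simp: S_def r_def)
    then obtain \<tau> c where \<tau>: "\<tau> \<in> {4, 5}" and b: "blk n \<sigma> \<tau> r c" and ng: "\<not> good n \<sigma> r"
      unfolding bad_def by blast
    have \<sigma>: "\<sigma> permutes {..<n}" "admissible n \<sigma>" "started n \<sigma>" using that by (auto simp: S_def run_perms_def)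
    have tf: "toggle_first n \<sigma> = rewrite_block (flip \<tau>) r c \<sigma>"
      by (rule toggle_first_eq[OF \<tau> b r_def])
    have fl: "flip \<tau> \<in> {4, 5}" "flip \<tau> < 7" "flip (flip \<tau>) = \<tau>" using \<tau> by auto
    let ?\<sigma> = "rewrite_block (flip \<tau>) r c \<sigma>"
    have b': "blk n ?\<sigma> (flip \<tau>) r c" using toggle_blk[OF \<sigma>(1) b \<tau>] by simp
    have "(\<exists>\<tau>\<in>{4, 5}. \<exists>c. blk n ?\<sigma> \<tau> r' c) \<longleftrightarrow> (\<exists>\<tau>\<in>{4, 5}. \<exists>c. blk n \<sigma> \<tau> r' c)" for r'
    proof (cases "r' = r")
      case True
      then show ?thesis using b b' \<tau> fl(1) by blast
    next
      case False
      then show ?thesis using toggle_blk[OF \<sigma>(1) b \<tau>] by simp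
    qed
    \<comment> \<open>Neither the rows of pointer blocks nor their justification depends on the
      choice between 4 and 5. Hence the same least row is selected again and the map is an
      involution.\<close>
    then have bad_eq: "bad n ?\<sigma> = bad n \<sigma>"
      using toggle_good[OF \<sigma>(1) b \<tau>] by (auto simp: bad_def fun_eq_iff)
    have S: "?\<sigma> \<in> S"
      using rewrite_permutes[OF \<sigma>(1) b fl(2)] toggle_admissible[OF \<sigma>(1) b \<tau> \<sigma>(2) ng]
        toggle_started[OF \<sigma>(1) b \<tau>] \<sigma>(3) r bad_eq by (auto simp: S_def run_perms_def)
    have "toggle_first n ?\<sigma> = rewrite_block (flip (flip \<tau>)) r c ?\<sigma>"
      by (rule toggle_first_eq[OF fl(1) b']) (unfold bad_eq, rule r_def)
    then have "toggle_first n ?\<sigma> = \<sigma>" using toggle_toggle[OF \<sigma>(1) b \<tau>] fl(3) by simp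
    then show ?thesis using S tf toggle_neq[OF \<sigma>(1) b \<tau>] by simp
  qed
  have "finite S" using finite_run_perms by (simp add: S_def)
  then have "even (card S)" by (rule even_card_involution[where f = "toggle_first n"]) (use key in auto)
  moreover have "run_perms n = S \<union> perfect_runs n" "S \<inter> perfect_runs n = {}"
    by (auto simp: S_def perfect_runs_def)
  moreover have "finite (perfect_runs n)" using finite_run_perms by (simp add: perfect_runs_def)
  ultimately show ?thesis using \<open>finite S\<close> by (simp add: card_Un_disjoint)
qed

section \<open>The positions of the blocks\<close>

text \<open>Letter \<open>t\<close> is a marker iff \<open>t + 2\<close> is triangular, and \<open>ptr t\<close> is the read position at time \<open>t\<close>. Two pointers with the
  same read position (which happens after a marker) are distinguished by \<open>\<delta>\<close>.\<close>

definition marked :: "nat \<Rightarrow> bool" where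
  "marked t \<longleftrightarrow> (\<exists>k. t + 2 = tri k)"

text \<open>The first four letters are given by the start, so the read position stays at 0 up to
  time 3.\<close>

primrec ptr :: "nat \<Rightarrow> nat" where
  "ptr 0 = 0"
| "ptr (Suc t) = ptr t + (if t < 3 \<or> marked t then 0 else 1)"

definition \<delta> :: "nat \<Rightarrow> nat" where
  "\<delta> t = (if \<not> marked t \<and> marked (t - 1) then 2 else 1)"

definition letter_at :: "nat \<Rightarrow> nat" where
  "letter_at t = (if t = 0 then 0 else if marked t then 2 else 1)"

section \<open>Arithmetic of the read position\<close>

lemma tri_between: "t = tri k + j \<Longrightarrow> j \<le> k \<Longrightarrow> (\<exists>m. t = tri m) \<longleftrightarrow> j = 0"
proof
  assume t: "t = tri k + j" "j \<le> k" and "\<exists>m. t = tri m"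
  then obtain m where m: "tri m = tri k + j" by auto
  show "j = 0"
  proof (rule ccontr)
    assume "j \<noteq> 0"
    then have "k < m" using m tri_strict[of k m] by simp
    then show False using tri_less[of k m] m t(2) by simp
  qed
qed auto

lemma marked_iff: "t + 2 = tri k + j \<Longrightarrow> j \<le> k \<Longrightarrow> marked t \<longleftrightarrow> j = 0"
  unfolding marked_def by (rule tri_between)

text \<open>\<open>k\<close> counts the triangular numbers passed and \<open>j\<close> the steps
  since the last marker. The distance from the read position to \<open>t\<close> is \<open>k\<close>
  at a marker and \<open>k + 1\<close> between markers: it grows by one because the step after a
  marker does not advance the read position.\<close>

lemma tri_form:
  assumes "3 \<le> t"
  shows "\<exists>k j. t + 2 = tri k + j \<and> j \<le> k \<and> 2 \<le> k \<and> ptr t + k + (if j = 0 then 0 else 1) = t"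
  using assms
proof (induction t rule: nat_induct_at_least)
  case base
  have "(3::nat) + 2 = tri 2 + 2" "ptr 3 = 0" by (simp_all add: eval_nat_numeral)
  then show ?case by (intro exI[of _ 2] conjI) auto
next
  case (Suc t)
  then obtain k j where kj: "t + 2 = tri k + j" "j \<le> k" "2 \<le> k" "ptr t + k + (if j = 0 then 0 else 1) = t" by blast
  have marked: "marked t \<longleftrightarrow> j = 0" by (rule marked_iff[OF kj(1,2)])
  show ?case
  proof (cases "j = k")
    case True
    then have "Suc t + 2 = tri (Suc k) + 0 \<and> 0 \<le> Suc k \<and> 2 \<le> Suc k \<and> ptr (Suc t) + Suc k + (if (0::nat) = 0 then 0 else 1) = Suc t"
      using kj marked Suc(1) by auto
    then show ?thesis by blast
  next
    case False
    then have "Suc t + 2 = tri k + Suc j \<and> Suc j \<le> k \<and> 2 \<le> k \<and> ptr (Suc t) + k + (if Suc j = 0 then 0 else 1) = Suc t"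
      using kj marked Suc(1) by auto
    then show ?thesis by blast
  qed
qed

lemma ptr_le:
  assumes "3 \<le> t"
  shows "ptr t + 3 \<le> t"
proof -
  obtain k j where kj: "t + 2 = tri k + j" "j \<le> k" "2 \<le> k" "ptr t + k + (if j = 0 then 0 else 1) = t"
    using tri_form[OF assms] by blast
  have "k \<noteq> 2" if "j = 0"
    using kj(1) that assms by (auto simp: eval_nat_numeral)
  then show ?thesis using kj(3,4) by (auto split: if_splits)
qed

text \<open>Copying is consistent with the triangular rule. If \<open>t + 2 = tri k + j\<close> with
  \<open>0 < j\<close>, then \<open>ptr t + 3 = tri (k - 1) + j\<close>: the letter to be read has
  the same offset with respect to the preceding triangular number, and both letters are markers
  exactly for \<open>j = k\<close>.\<close>

lemma marked_Suc_iff: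
  assumes "3 \<le> t" "\<not> marked t"
  shows "marked (Suc t) \<longleftrightarrow> marked (Suc (ptr t))"
proof -
  obtain k j where kj: "t + 2 = tri k + j" "j \<le> k" "2 \<le> k" "ptr t + k + (if j = 0 then 0 else 1) = t"
    using tri_form[OF assms(1)] by blast
  have j: "j \<noteq> 0" using marked_iff[OF kj(1,2)] assms(2) by blast
  obtain k' where k': "k = Suc k'" using kj(3) by (cases k) auto
  have pt: "Suc (ptr t) + 2 = tri k' + j" using kj j k' by auto
  show ?thesis
  proof (cases "j = k")
    case True
    then have "Suc t + 2 = tri (Suc k)" "Suc (ptr t) + 2 = tri k" using kj(1) pt k' by auto
    then show ?thesis unfolding marked_def by metis
  next
    case False
    have "\<not> marked (Suc t)"
      using marked_iff[of "Suc t" k "Suc j"] kj(1,2) False by simp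
    moreover have "\<not> marked (Suc (ptr t))"
      using marked_iff[OF pt] kj(2) False k' j by simp
    ultimately show ?thesis by simp
  qed
qed

lemma marked_not_Suc:
  assumes "0 < t" "marked t"
  shows "\<not> marked (Suc t)"
proof -
  obtain k where k: "t + 2 = tri k" using assms(2) by (auto simp: marked_def)
  have "k \<noteq> 0" using k by (cases k) auto
  then show ?thesis using marked_iff[of "Suc t" k 1] k by simp
qed

lemma marked_small: "\<not> marked 0" "marked 1" "\<not> marked 2" "\<not> marked 3"
  using marked_iff[of 0 1 1] marked_iff[of 1 2 0] marked_iff[of 2 2 1] marked_iff[of 3 2 2] by (simp_all add: eval_nat_numeral)

lemma ptr_3: "ptr 3 = 0" and \<delta>_3: "\<delta> 3 = 1"
  using marked_small by (simp_all add: eval_nat_numeral \<delta>_def)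

lemma \<delta>_cases: "\<delta> t = 1 \<or> \<delta> t = 2"
  by (simp add: \<delta>_def)

lemma \<delta>_neq_0 [simp]: "\<delta> t \<noteq> 0"
  by (simp add: \<delta>_def)

lemma \<delta>_twoD:
  assumes "3 \<le> t" "\<delta> t = 2"
  shows "3 \<le> t - 1" "marked (t - 1)" "ptr (t - 1) = ptr t" "\<delta> (t - 1) = 1"
proof -
  have "t \<noteq> 3" using assms(2) \<delta>_3 by auto
  then show t: "3 \<le> t - 1" using assms(1) by simp
  show m: "marked (t - 1)" using assms(2) by (auto simp: \<delta>_def split: if_splits)
  show "ptr (t - 1) = ptr t" using ptr.simps(2)[of "t - 1"] m t by simp
  show "\<delta> (t - 1) = 1" using m by (simp add: \<delta>_def)
qed

lemma ptr_\<delta>_step: "3 \<le> t \<Longrightarrow> 4 * ptr t + \<delta> t < 4 * ptr (Suc t) + \<delta> (Suc t)"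
  using \<delta>_cases[of t] \<delta>_cases[of "Suc t"] marked_not_Suc[of t] by (auto simp: \<delta>_def)

lemma ptr_\<delta>_strict:
  assumes "3 \<le> i" "i < j"
  shows "4 * ptr i + \<delta> i < 4 * ptr j + \<delta> j"
proof -
  have "i + 1 \<le> j" using assms(2) by simp
  then show ?thesis
  proof (induction j rule: nat_induct_at_least)
    case base
    then show ?case using ptr_\<delta>_step[OF assms(1)] by simp
  next
    case (Suc j)
    then show ?case using ptr_\<delta>_step[of j] assms(1) by simp
  qed
qed

text \<open>The blocks of a perfect run: letters, separators, pointers and the end block. Block \<open>b\<close> is number \<open>row b\<close> from the top,
  and \<open>key\<close> orders the blocks by column.\<close>

datatype name = LA nat | LB nat | LD nat | LZ nat

text \<open>From letter 3 on, letter, pointer and separator occupy three consecutive block rows. The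
  end block \<open>LZ t\<close> takes the row in which letter \<open>t + 1\<close> would
  stand.\<close>

fun row :: "name \<Rightarrow> nat" where
  "row (LA t) = (if t < 2 then t else if t = 2 then 3 else 3 * t - 4)"
| "row (LB t) = (if t < 3 then 2 * t else 3 * t - 2)"
| "row (LD t) = 3 * t - 3"
| "row (LZ t) = 3 * t - 1"

text \<open>The remainder modulo 4 is 1 for the letter of the slot, 2 or 3 for pointers reading
  there, and 0 for what precedes the letter. The separator of letter \<open>t\<close> belongs to
  slot \<open>t - 1\<close>, which ties consecutive letters together; \<open>LZ t\<close> takes the
  place of the separator of letter \<open>t + 1\<close>.\<close>

fun key :: "name \<Rightarrow> nat" where
  "key (LA t) = 4 * t + 1"
| "key (LB t) = 4 * (t - 1)"
| "key (LD t) = 4 * ptr t + 1 + \<delta> t"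
| "key (LZ t) = 4 * t"

fun ty :: "name \<Rightarrow> nat" where
  "ty (LA t) = letter_at t"
| "ty (LB t) = 3"
| "ty (LD t) = 4"
| "ty (LZ t) = 6"

definition prefix :: "nat \<Rightarrow> name set" where
  "prefix t = {LA i | i. i \<le> t} \<union> {LB i | i. 1 \<le> i \<and> i \<le> t} \<union> {LD i | i. 3 \<le> i \<and> i \<le> t}"

definition full :: "nat \<Rightarrow> name set" where
  "full t = insert (LZ t) (prefix t)"

section \<open>Rows and column keys of the named blocks\<close>

lemma ty_less: "ty b < 7"
  by (cases b) (auto simp: letter_at_def)

lemma prefix_simps [simp]:
  "LA i \<in> prefix t \<longleftrightarrow> i \<le> t" "LB i \<in> prefix t \<longleftrightarrow> 1 \<le> i \<and> i \<le> t"
  "LD i \<in> prefix t \<longleftrightarrow> 3 \<le> i \<and> i \<le> t" "LZ i \<notin> prefix t"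
  by (auto simp: prefix_def)

lemma full_simps [simp]:
  "LA i \<in> full t \<longleftrightarrow> i \<le> t" "LB i \<in> full t \<longleftrightarrow> 1 \<le> i \<and> i \<le> t"
  "LD i \<in> full t \<longleftrightarrow> 3 \<le> i \<and> i \<le> t" "LZ i \<in> full t \<longleftrightarrow> i = t"
  by (auto simp: full_def)

lemma prefix_Suc: "3 \<le> t \<Longrightarrow> prefix (Suc t) = prefix t \<union> {LA (Suc t), LB (Suc t), LD (Suc t)}"
  by (auto simp: prefix_def le_Suc_eq)

lemma finite_full: "finite (full t)"
proof -
  have "prefix t = LA ` {..t} \<union> LB ` {1..t} \<union> LD ` {3..t}" by (auto simp: prefix_def)
  then show ?thesis by (simp add: full_def)
qed

lemma row_prefix:
  assumes "3 \<le> t"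
  shows "row ` prefix t = {..<3 * t - 1}"
  using assms
proof (induction t rule: nat_induct_at_least)
  case base
  have "prefix 3 = {LA 0, LA 1, LA 2, LA 3, LB 1, LB 2, LB 3, LD 3}"
    by (auto simp: prefix_def le_Suc_eq eval_nat_numeral)
  then show ?case by (auto simp: lessThan_nat_numeral lessThan_Suc)
next
  case (Suc t)
  have "row ` prefix (Suc t) = row ` prefix t \<union> {row (LA (Suc t)), row (LB (Suc t)), row (LD (Suc t))}"
    unfolding prefix_Suc[OF Suc(1)] by auto
  also have "\<dots> = {..<3 * t - 1} \<union> {3 * t - 1, 3 * t + 1, 3 * t}"
    using Suc by auto
  also have "\<dots> = {..<3 * Suc t - 1}" using Suc(1) by auto
  finally show ?case .
qed

lemma row_full:
  assumes "3 \<le> t"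
  shows "row ` full t = {..<3 * t}"
proof -
  have "row ` full t = insert (3 * t - 1) {..<3 * t - 1}"
    using row_prefix[OF assms] by (simp add: full_def)
  also have "\<dots> = {..<3 * t}" using assms by auto
  finally show ?thesis .
qed

lemma row_order:
  "row (LA i) < row (LA j) \<longleftrightarrow> i < j"
  "1 \<le> k \<Longrightarrow> row (LA i) < row (LB k) \<longleftrightarrow> i \<le> k"
  "1 \<le> k \<Longrightarrow> row (LB k) < row (LA i) \<longleftrightarrow> k < i"
  "1 \<le> k \<Longrightarrow> 1 \<le> k' \<Longrightarrow> row (LB k) < row (LB k') \<longleftrightarrow> k < k'"
  "3 \<le> u \<Longrightarrow> row (LA i) < row (LD u) \<longleftrightarrow> i \<le> u"
  "3 \<le> u \<Longrightarrow> row (LD u) < row (LA i) \<longleftrightarrow> u < i"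
  "1 \<le> k \<Longrightarrow> 3 \<le> u \<Longrightarrow> row (LD u) < row (LB k) \<longleftrightarrow> u \<le> k"
  "1 \<le> k \<Longrightarrow> 3 \<le> u \<Longrightarrow> row (LB k) < row (LD u) \<longleftrightarrow> k < u"
  "3 \<le> u \<Longrightarrow> 3 \<le> u' \<Longrightarrow> row (LD u) < row (LD u') \<longleftrightarrow> u < u'"
  by (auto split: if_splits)

lemma row_inj:
  assumes b: "b \<in> full t" "b' \<in> full t" "row b = row b'" and t: "3 \<le> t"
  shows "b = b'"
proof -
  have Z: "row x \<noteq> row (LZ t)" if "x \<in> prefix t" for x
    using imageI[OF that, of row] by (simp add: row_prefix[OF t])
  have neq: "\<not> row b < row b'" "\<not> row b' < row b" using b(3) by simp_all
  consider "b \<in> prefix t" "b' \<in> prefix t" | "b \<in> prefix t" "b' = LZ t" | "b = LZ t" "b' \<in> prefix t" | "b = b'"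
    using b by (auto simp: full_def)
  then show ?thesis
  proof cases
    case 1
    then show ?thesis
      using neq by (cases b; cases b') (auto simp: row_order simp del: row.simps)
  qed (use Z[of b] Z[of b'] b(3) in auto)
qed

lemma key_div_mod:
  "key (LA i) div 4 = i" "key (LA i) mod 4 = 1" "key (LB i) div 4 = i - 1" "key (LB i) mod 4 = 0"
  "key (LD i) div 4 = ptr i" "key (LD i) mod 4 = 1 + \<delta> i" "key (LZ i) div 4 = i" "key (LZ i) mod 4 = 0"
  using \<delta>_cases[of i] by auto

lemma key_LD_inj:
  assumes "3 \<le> i" "3 \<le> j" "key (LD i) = key (LD j)"
  shows "i = j"
  using ptr_\<delta>_strict[of i j] ptr_\<delta>_strict[of j i] assms by (cases i j rule: linorder_cases) auto

lemma key_inj: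
  assumes "b \<in> full t" "b' \<in> full t" "key b = key b'"
  shows "b = b'"
proof -
  have "key b div 4 = key b' div 4" "key b mod 4 = key b' mod 4" using assms(3) by simp_all
  then show ?thesis
    using assms key_LD_inj
    by (cases b; cases b') (auto simp: key_div_mod simp del: key.simps)
qed

text \<open>Blocks with different first rows have disjoint rows, so a block that starts inside a
  region filled with blocks must be one of them.\<close>

lemma blk_in_tiling:
  assumes \<sigma>: "\<sigma> permutes {..<n}" and tiles: "\<And>b. b \<in> S \<Longrightarrow> blk n \<sigma> (ty b) (7 * row b) (K b)"
    and rows: "row ` S = {..<m}" and b: "blk n \<sigma> \<tau> r c" and r: "r < 7 * m"
  shows "\<exists>b\<in>S. r = 7 * row b \<and> \<tau> = ty b \<and> c = K b"
proof -
  have "r div 7 \<in> row ` S" using rows r by auto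
  then obtain b' where b': "b' \<in> S" "row b' = r div 7" by auto
  have "r = 7 * row b'"
  proof (rule ccontr)
    assume "r \<noteq> 7 * row b'"
    then have "7 * row b' < r" "r < 7 * row b' + 7" using b'(2) by linarith+
    then show False using blk_disjoint_rows[OF \<sigma> tiles[OF b'(1)] b] by linarith
  qed
  then show ?thesis using blk_unique[OF b, of "ty b'" "K b'"] tiles[OF b'(1)] b'(1) by auto
qed

text \<open>All keys with the same quotient by 4 form a slot around one letter, and the remainder tells the offset to the column
  of that letter in units of 7.\<close>

definition slotted :: "nat \<Rightarrow> (name \<Rightarrow> nat) \<Rightarrow> name \<Rightarrow> bool" where
  "slotted t K b \<longleftrightarrow> key b div 4 \<le> t \<and> K b + 7 = K (LA (key b div 4)) + 7 * (key b mod 4) \<and>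
     (key b mod 4 = 0 \<longrightarrow> (\<forall>j<key b div 4. K (LA j) + 14 \<le> K (LA (key b div 4)))) \<and>
     (2 \<le> key b mod 4 \<longrightarrow> key b div 4 < t \<and> K b + 14 \<le> K (LA (Suc (key b div 4))))"

text \<open>The part of the run identified so far. Rows are known exactly, columns only through
  local relations, because unidentified points may still lie between the blocks.\<close>

definition layout :: "nat \<Rightarrow> (nat \<Rightarrow> nat) \<Rightarrow> nat \<Rightarrow> (name \<Rightarrow> nat) \<Rightarrow> bool" where
  "layout n \<sigma> t K \<longleftrightarrow> 3 \<le> t \<and> (\<forall>b\<in>prefix t. blk n \<sigma> (ty b) (7 * row b) (K b)) \<and>
     (\<forall>i<t. K (LA i) < K (LA (Suc i)) \<and> K (LB (Suc i)) + 7 = K (LA i)) \<and>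
     (\<forall>i. 3 \<le> i \<longrightarrow> i \<le> t \<longrightarrow> K (LD i) = K (LA (ptr i)) + 7 * \<delta> i)"

lemma slotted_order:
  assumes mono: "\<And>i j. i < j \<Longrightarrow> j \<le> t \<Longrightarrow> K (LA i) + 7 \<le> K (LA j)"
    and b: "slotted t K b" "slotted t K b'" and less: "key b < key b'"
  shows "K b < K b'"
proof (cases "key b div 4 = key b' div 4")
  case True
  then have "key b mod 4 < key b' mod 4" using less div_mult_mod_eq[of "key b" 4] div_mult_mod_eq[of "key b'" 4] by linarith
  then show ?thesis using True b unfolding slotted_def by auto
next
  case False
  then have d: "key b div 4 < key b' div 4" using div_le_mono[of "key b" "key b'" 4] less by linarith
  have t: "key b' div 4 \<le> t" and K: "K b + 7 = K (LA (key b div 4)) + 7 * (key b mod 4)"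
    and K': "K b' + 7 = K (LA (key b' div 4)) + 7 * (key b' mod 4)"
    and z: "key b' mod 4 = 0 \<Longrightarrow> K (LA (key b div 4)) + 14 \<le> K (LA (key b' div 4))"
    and u: "2 \<le> key b mod 4 \<Longrightarrow> K b + 14 \<le> K (LA (Suc (key b div 4)))"
    using b d unfolding slotted_def by auto
  have m: "K (LA (key b div 4)) + 7 \<le> K (LA (key b' div 4))" using mono[OF d t] .
  show ?thesis
  proof (cases "2 \<le> key b mod 4")
    case True
    have "K (LA (Suc (key b div 4))) \<le> K (LA (key b' div 4))"
      using mono[of "Suc (key b div 4)" "key b' div 4"] d t by (cases "Suc (key b div 4) = key b' div 4") auto
    then show ?thesis using u[OF True] K' by linarith
  next
    case False
    then show ?thesis using m z K K' by (cases "key b' mod 4 = 0") linarith+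
  qed
qed

section \<open>Column order forced by local relations\<close>

context
  fixes n :: nat and \<sigma> :: "nat \<Rightarrow> nat" and t :: nat and K :: "name \<Rightarrow> nat"
  assumes \<sigma>: "\<sigma> permutes {..<n}" and lay: "layout n \<sigma> t K"
begin

lemma layout_blk: "b \<in> prefix t \<Longrightarrow> blk n \<sigma> (ty b) (7 * row b) (K b)"
  and layout_less: "i < t \<Longrightarrow> K (LA i) < K (LA (Suc i))"
  and layout_sep: "i < t \<Longrightarrow> K (LB (Suc i)) + 7 = K (LA i)"
  and layout_ptr: "3 \<le> i \<Longrightarrow> i \<le> t \<Longrightarrow> K (LD i) = K (LA (ptr i)) + 7 * \<delta> i"
  and layout_size: "3 \<le> t"
  using lay by (auto simp: layout_def)

lemma layout_disjoint:
  assumes "b \<in> prefix t" "b' \<in> prefix t" "K b \<le> K b'" "b \<noteq> b'"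
  shows "K b + 7 \<le> K b'"
proof -
  have "row b \<noteq> row b'" using row_inj[of b t b'] assms layout_size by (auto simp: full_def)
  then have "K b \<noteq> K b'" using blk_neq_cols[OF \<sigma> layout_blk[OF assms(1)] layout_blk[OF assms(2)]] by simp
  then show ?thesis
    using blk_disjoint_cols[OF \<sigma> layout_blk[OF assms(1)] layout_blk[OF assms(2)]] assms(3) by simp
qed

lemma layout_mono:
  assumes "i < j" "j \<le> t"
  shows "K (LA i) + 7 \<le> K (LA j)"
proof -
  have "Suc i \<le> j" using assms(1) by simp
  then have "K (LA i) < K (LA j)"
    using assms(2)
  proof (induction j rule: nat_induct_at_least)
    case base
    then show ?case using layout_less[of i] by simp
  next
    case (Suc j)
    then show ?case using layout_less[of j] by simp
  qed
  then show ?thesis using layout_disjoint[of "LA i" "LA j"] assms by simp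
qed

lemma layout_gap:
  assumes "i < j" "j < t"
  shows "K (LA i) + 14 \<le> K (LA j)"
proof -
  have "K (LB (Suc j)) + 7 = K (LA j)" using layout_sep[OF assms(2)] .
  moreover have "K (LA i) + 7 \<le> K (LB (Suc j))"
    by (rule layout_disjoint) (use layout_mono[of i j] calculation assms in auto)
  ultimately show ?thesis by simp
qed

text \<open>The separator immediately left of the letter after the read position is a block of its
  own. A pointer left of that letter must therefore be left of this separator too, which improves
  the distance from 7 to 14. For \<open>\<delta> u = 2\<close> this is applied after the bound for
  the preceding pointer, which stands immediately to the left.\<close>

lemma ptr_below_sep:
  assumes "3 \<le> u" "u \<le> t"
  shows "K (LD u) + 14 \<le> K (LA (Suc (ptr u)))"
proof -
  have one: "K (LD u) + 14 \<le> K (LA (Suc (ptr u)))"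
    if u: "3 \<le> u" "u \<le> t" "K (LD u) + 7 \<le> K (LA (Suc (ptr u)))" for u
  proof -
    have s: "Suc (ptr u) < t" using ptr_le[OF u(1)] u(2) by simp
    have "K (LB (Suc (Suc (ptr u)))) + 7 = K (LA (Suc (ptr u)))" using layout_sep[OF s] .
    moreover have "K (LD u) + 7 \<le> K (LB (Suc (Suc (ptr u))))"
      by (rule layout_disjoint) (use u s calculation in auto)
    ultimately show ?thesis by simp
  qed
  have simple: "K (LD u) + 14 \<le> K (LA (Suc (ptr u)))" if u: "3 \<le> u" "u \<le> t" "\<delta> u = 1" for u
  proof (rule one[OF u(1,2)])
    have "Suc (ptr u) < t" using ptr_le[OF u(1)] u(2) by simp
    then have "K (LA (ptr u)) + 14 \<le> K (LA (Suc (ptr u)))" by (intro layout_gap) auto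
    then show "K (LD u) + 7 \<le> K (LA (Suc (ptr u)))" using layout_ptr[OF u(1,2)] u(3) by simp
  qed
  show ?thesis
  proof (cases "\<delta> u = 1")
    case False
    then have \<delta>: "\<delta> u = 2" using \<delta>_cases by blast
    note d = \<delta>_twoD[OF assms(1) \<delta>]
    have "K (LD (u - 1)) + 14 \<le> K (LA (Suc (ptr u)))" using simple[of "u - 1"] d assms by simp
    moreover have "K (LD (u - 1)) = K (LA (ptr u)) + 7" using layout_ptr[of "u - 1"] d assms by simp
    ultimately show ?thesis using one[OF assms] layout_ptr[OF assms] \<delta> by simp
  qed (use simple assms in blast)
qed

lemma prefix_slotted:
  assumes "b \<in> prefix t"
  shows "slotted t K b"
proof (cases b)
  case (LA i)
  then show ?thesis using assms by (simp add: slotted_def key_div_mod del: key.simps)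
next
  case (LB i)
  then have i: "1 \<le> i" "i \<le> t" "i - 1 < t" using assms by auto
  then have "K (LB i) + 7 = K (LA (i - 1))" using layout_sep[of "i - 1"] by simp
  moreover have "K (LA j) + 14 \<le> K (LA (i - 1))" if "j < i - 1" for j
    using layout_gap[OF that i(3)] .
  ultimately show ?thesis using LB i by (simp add: slotted_def key_div_mod del: key.simps)
next
  case (LD i)
  then have i: "3 \<le> i" "i \<le> t" using assms by auto
  show ?thesis using LD layout_ptr[OF i] ptr_below_sep[OF i] ptr_le[OF i(1)] i(2)
    by (simp add: slotted_def key_div_mod del: key.simps)
qed (use assms in auto)

lemma prefix_key_iff:
  assumes "b \<in> prefix t" "b' \<in> prefix t"
  shows "K b < K b' \<longleftrightarrow> key b < key b'"
proof -
  have imp: "K b < K b'" if "key b < key b'" "b \<in> prefix t" "b' \<in> prefix t" for b b'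
    by (rule slotted_order[OF layout_mono prefix_slotted prefix_slotted]) (use that in auto)
  show ?thesis
  proof (cases "key b = key b'")
    case True
    then have "b = b'" using key_inj[of b t b'] assms by (auto simp: full_def)
    then show ?thesis by simp
  next
    case False
    then show ?thesis using imp[OF _ assms] imp[OF _ assms(2,1)] by linarith
  qed
qed

lemma prefix_tiles:
  "blk n \<sigma> \<tau> r c \<Longrightarrow> r < 7 * (3 * t - 1) \<Longrightarrow> \<exists>b\<in>prefix t. r = 7 * row b \<and> \<tau> = ty b \<and> c = K b"
  by (rule blk_in_tiling[OF \<sigma> layout_blk row_prefix[OF layout_size]])

end

section \<open>Uniqueness of perfect runs\<close>

text \<open>Blocks in order are at least 7 apart by disjointness, and the forbidden empty line
  excludes any larger distance.\<close>

lemma conf_gaps: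
  assumes \<sigma>: "\<sigma> permutes {..<n}" and adm: "admissible n \<sigma>" and T: "(Q, rg, cg) \<in> set tight_configs"
    and cf: "conf n \<sigma> Q R K"
  shows "Suc g \<in> set rg \<Longrightarrow> Suc g < length (fst Q) \<Longrightarrow> R (Suc g) = R g + 7"
    "Suc g \<in> set cg \<Longrightarrow> K (snd Q ! Suc g) = K (snd Q ! g) + 7"
proof -
  have bl: "\<exists>\<tau>. blk n \<sigma> \<tau> (R j) (K j)" if "j < length (fst Q)" for j
    using cf that unfolding conf_def confocc_def by blast
  have free: "\<And>g. g \<in> set rg \<Longrightarrow> \<not> row_gap n (length (fst Q)) R g" "\<And>g. g \<in> set cg \<Longrightarrow> \<not> col_gap (snd Q) K g"
    using adm T cf unfolding admissible_def gap_free_def by fastforce+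
  show "R (Suc g) = R g + 7" if g: "Suc g \<in> set rg" "Suc g < length (fst Q)"
  proof -
    have "R g < R (Suc g)" using cf g(2) by (simp add: conf_def confocc_def)
    moreover obtain \<tau> \<tau>' where "blk n \<sigma> \<tau> (R g) (K g)" "blk n \<sigma> \<tau>' (R (Suc g)) (K (Suc g))"
      using bl[of g] bl[of "Suc g"] g(2) by auto
    ultimately have "R g + 7 \<le> R (Suc g)" using blk_disjoint_rows[OF \<sigma>] by blast
    moreover have "\<not> R g + 7 < R (Suc g)" using free(1)[OF g(1)] g(2) by (simp add: row_gap_def)
    ultimately show ?thesis by simp
  qed
  show "K (snd Q ! Suc g) = K (snd Q ! g) + 7" if g: "Suc g \<in> set cg"
  proof -
    note w = wf_tight_configs[OF T]
    have g': "Suc g < length (fst Q)" using w(3) g by auto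
    have "length (snd Q) = length (fst Q)"
      using w(1) distinct_card[of "snd Q"] by (simp add: wf_config_def)
    then have in_range: "snd Q ! h < length (fst Q)" if "h < length (fst Q)" for h
      using w(1) nth_mem[of h "snd Q"] that by (simp add: wf_config_def)
    have "K (snd Q ! g) < K (snd Q ! Suc g)" using cf g' by (simp add: conf_def confocc_def)
    moreover obtain \<tau> \<tau>' where "blk n \<sigma> \<tau> (R (snd Q ! g)) (K (snd Q ! g))"
      "blk n \<sigma> \<tau>' (R (snd Q ! Suc g)) (K (snd Q ! Suc g))"
      using bl[OF in_range[of g]] bl[OF in_range[of "Suc g"]] g' by auto
    ultimately have "K (snd Q ! g) + 7 \<le> K (snd Q ! Suc g)" using blk_disjoint_cols[OF \<sigma>] by blast
    moreover have "\<not> K (snd Q ! g) + 7 < K (snd Q ! Suc g)" using free(2)[OF g] by (simp add: col_gap_def)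
    ultimately show ?thesis by simp
  qed
qed

section \<open>The configurations written out\<close>

lemma conf_copy:
  "conf n \<sigma> (copy_config x) R K \<longleftrightarrow>
    (\<exists>\<tau>\<in>{0, 1, 2}. blk n \<sigma> \<tau> (R 0) (K 0)) \<and> blk n \<sigma> x (R 1) (K 1) \<and> blk n \<sigma> 3 (R 2) (K 2) \<and>
    blk n \<sigma> 1 (R 3) (K 3) \<and> (\<exists>\<tau>\<in>{4, 5}. blk n \<sigma> \<tau> (R 4) (K 4)) \<and> blk n \<sigma> 3 (R 5) (K 5) \<and>
    blk n \<sigma> x (R 6) (K 6) \<and> (\<exists>\<tau>\<in>{4, 5}. blk n \<sigma> \<tau> (R 7) (K 7)) \<and> blk n \<sigma> 3 (R 8) (K 8) \<and>
    R 0 < R 1 \<and> R 1 < R 2 \<and> R 2 < R 3 \<and> R 3 < R 4 \<and> R 4 < R 5 \<and> R 5 < R 6 \<and> R 6 < R 7 \<and> R 7 < R 8 \<and>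
    K 2 < K 0 \<and> K 0 < K 4 \<and> K 4 < K 1 \<and> K 1 < K 7 \<and> K 7 < K 5 \<and> K 5 < K 8 \<and> K 8 < K 3 \<and> K 3 < K 6"
  by (simp add: conf_def confocc_def copy_config_def All_less_Suc eval_nat_numeral) blast

lemma conf_after_marker:
  "conf n \<sigma> after_marker_config R K \<longleftrightarrow>
    blk n \<sigma> 2 (R 0) (K 0) \<and> (\<exists>\<tau>\<in>{4, 5}. blk n \<sigma> \<tau> (R 1) (K 1)) \<and> blk n \<sigma> 3 (R 2) (K 2) \<and>
    blk n \<sigma> 1 (R 3) (K 3) \<and> (\<exists>\<tau>\<in>{4, 5}. blk n \<sigma> \<tau> (R 4) (K 4)) \<and> blk n \<sigma> 3 (R 5) (K 5) \<and>
    R 0 < R 1 \<and> R 1 < R 2 \<and> R 2 < R 3 \<and> R 3 < R 4 \<and> R 4 < R 5 \<and>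
    K 1 < K 4 \<and> K 4 < K 2 \<and> K 2 < K 5 \<and> K 5 < K 0 \<and> K 0 < K 3"
  by (simp add: conf_def confocc_def after_marker_config_def All_less_Suc eval_nat_numeral) blast

lemma conf_end:
  "conf n \<sigma> end_config R K \<longleftrightarrow>
    (\<exists>\<tau>\<in>{0, 1, 2}. blk n \<sigma> \<tau> (R 0) (K 0)) \<and> blk n \<sigma> 2 (R 1) (K 1) \<and> blk n \<sigma> 3 (R 2) (K 2) \<and>
    blk n \<sigma> 1 (R 3) (K 3) \<and> (\<exists>\<tau>\<in>{4, 5}. blk n \<sigma> \<tau> (R 4) (K 4)) \<and> blk n \<sigma> 3 (R 5) (K 5) \<and>
    blk n \<sigma> 6 (R 6) (K 6) \<and>
    R 0 < R 1 \<and> R 1 < R 2 \<and> R 2 < R 3 \<and> R 3 < R 4 \<and> R 4 < R 5 \<and> R 5 < R 6 \<and>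
    K 2 < K 0 \<and> K 0 < K 4 \<and> K 4 < K 1 \<and> K 1 < K 5 \<and> K 5 < K 6 \<and> K 6 < K 3"
  by (simp add: conf_def confocc_def end_config_def All_less_Suc eval_nat_numeral) blast

lemma conf_start:
  "conf n \<sigma> start_config R K \<longleftrightarrow>
    blk n \<sigma> 0 (R 0) (K 0) \<and> blk n \<sigma> 2 (R 1) (K 1) \<and> blk n \<sigma> 3 (R 2) (K 2) \<and> blk n \<sigma> 1 (R 3) (K 3) \<and>
    blk n \<sigma> 3 (R 4) (K 4) \<and> blk n \<sigma> 1 (R 5) (K 5) \<and> (\<exists>\<tau>\<in>{4, 5}. blk n \<sigma> \<tau> (R 6) (K 6)) \<and> blk n \<sigma> 3 (R 7) (K 7) \<and>
    R 0 < R 1 \<and> R 1 < R 2 \<and> R 2 < R 3 \<and> R 3 < R 4 \<and> R 4 < R 5 \<and> R 5 < R 6 \<and> R 6 < R 7 \<and>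
    K 2 < K 0 \<and> K 0 < K 6 \<and> K 6 < K 4 \<and> K 4 < K 1 \<and> K 1 < K 7 \<and> K 7 < K 3 \<and> K 3 < K 5"
  by (simp add: conf_def confocc_def start_config_def All_less_Suc eval_nat_numeral) blast

lemma conf_single: "conf n \<sigma> ([[\<tau>]], [0]) R K \<longleftrightarrow> blk n \<sigma> \<tau> (R 0) (K 0)"
  by (simp add: conf_def confocc_def)

lemma ty_cases:
  "ty b \<le> 2 \<Longrightarrow> \<exists>i. b = LA i" "ty b = 3 \<Longrightarrow> \<exists>i. b = LB i" "ty b \<in> {4, 5} \<Longrightarrow> \<exists>i. b = LD i" "ty b = 6 \<Longrightarrow> \<exists>i. b = LZ i"
  by (cases b; simp add: letter_at_def split: if_splits)+

lemma letter_at_iff: "letter_at t = 2 \<longleftrightarrow> marked t" "letter_at t = 1 \<longleftrightarrow> t \<noteq> 0 \<and> \<not> marked t" "letter_at t = 0 \<longleftrightarrow> t = 0"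
  using marked_small(1) by (auto simp: letter_at_def)

text \<open>The separator right below the letter \<open>q'\<close> and left of \<open>q\<close> forces \<open>q, q'\<close> to be consecutive letters,
  and then the pointer lies between them.\<close>

lemma consecutive_letters:
  assumes "3 \<le> u" "1 \<le> k" "row (LA i) < row (LA j)" "row (LA j) < row (LB k)" "key (LB k) < key (LA i)"
    "key (LA i) < key (LD u)" "key (LD u) < key (LA j)"
  shows "i = ptr u \<and> j = Suc (ptr u) \<and> k = Suc (ptr u)"
proof -
  have "i < j" "j \<le> k" using assms(3,4) row_order(1,2) assms(2) by blast+
  moreover have "k \<le> Suc i" using assms(5) by simp
  ultimately have "j = Suc i" "k = Suc i" by simp_all
  then show ?thesis using assms(6,7) \<delta>_cases[of u] by auto
qed

text \<open>A pointer of type 5 at the site of a rule would complete the forbidden special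
  configuration of that rule.\<close>

lemma perfect_ptr:
  assumes "\<sigma> \<in> perfect_runs n" "\<tau> \<in> {4, 5}" "blk n \<sigma> \<tau> r c"
  shows "\<tau> = 4 \<and> good n \<sigma> r"
proof -
  have g: "good n \<sigma> r" using assms unfolding perfect_runs_def bad_def by blast
  then obtain Q d R K where Qd: "(Q, d) \<in> set rules" "conf n \<sigma> Q R K" "R d = r"
    unfolding good_def by blast
  have d: "d < length (fst Q)" "fst Q ! d = [4, 5]" using wf_rules[OF Qd(1)] by auto
  have "\<tau> \<noteq> 5"
  proof
    assume "\<tau> = 5"
    obtain \<tau>' where "blk n \<sigma> \<tau>' r (K d)" using Qd(2,3) d(1) unfolding conf_def confocc_def by blast
    then have "blk n \<sigma> 5 (R d) (K d)" using blk_unique[OF assms(3)] assms(3) \<open>\<tau> = 5\<close> Qd(3) by metis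
    then have "\<exists>\<tau>\<in>set ((fst Q)[d := [5]] ! j). blk n \<sigma> \<tau> (R j) (K j)" if "j < length (fst Q)" for j
      using Qd(2) that by (cases "j = d") (auto simp: conf_def confocc_def)
    then have "conf n \<sigma> (special (Q, d)) R K" using Qd(2) by (simp add: conf_def confocc_def special_def)
    then show False using assms(1) Qd(1) unfolding perfect_runs_def run_perms_def admissible_def by blast
  qed
  then show ?thesis using assms(2) g by blast
qed

section \<open>Growth of a perfect run\<close>

lemma layout_extend:
  assumes lay: "layout n \<sigma> t K" and a: "blk n \<sigma> (letter_at (Suc t)) (7 * row (LA (Suc t))) a"
    and d: "blk n \<sigma> 4 (7 * row (LD (Suc t))) d" and b: "blk n \<sigma> 3 (7 * row (LB (Suc t))) b"
    and cols: "K (LA t) < a" "b + 7 = K (LA t)" "d = K (LA (ptr (Suc t))) + 7 * \<delta> (Suc t)"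
  shows "\<exists>K'. layout n \<sigma> (Suc t) K'"
proof -
  have t: "3 \<le> t" using lay by (simp add: layout_def)
  define K' where "K' = K(LA (Suc t) := a, LB (Suc t) := b, LD (Suc t) := d)"
  have "blk n \<sigma> (ty x) (7 * row x) (K' x)" if x: "x \<in> prefix (Suc t)" for x
  proof (cases "x \<in> prefix t")
    case True
    then have "K' x = K x" by (auto simp: K'_def)
    then show ?thesis using lay True by (simp add: layout_def)
  next
    case False
    then consider "x = LA (Suc t)" | "x = LB (Suc t)" | "x = LD (Suc t)" using x prefix_Suc[OF t] by blast
    then show ?thesis using a b d by cases (auto simp: K'_def simp del: row.simps)
  qed
  moreover have "K' (LA i) < K' (LA (Suc i)) \<and> K' (LB (Suc i)) + 7 = K' (LA i)" if "i < Suc t" for i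
    using lay cols that by (cases "i = t") (auto simp: K'_def layout_def)
  moreover have "K' (LD i) = K' (LA (ptr i)) + 7 * \<delta> i" if i: "3 \<le> i" "i \<le> Suc t" for i
  proof -
    have "ptr i \<noteq> Suc t" using ptr_le[OF i(1)] i(2) by simp
    then show ?thesis using lay cols i by (cases "i = Suc t") (auto simp: K'_def layout_def)
  qed
  ultimately show ?thesis using t unfolding layout_def by (intro exI[of _ K']) simp
qed

definition finished :: "nat \<Rightarrow> (nat \<Rightarrow> nat) \<Rightarrow> nat \<Rightarrow> bool" where
  "finished n \<sigma> t \<longleftrightarrow> marked (Suc t) \<and> n = 21 * t \<and>
     (\<exists>K. layout n \<sigma> t K \<and> blk n \<sigma> 6 (7 * row (LZ t)) (K (LZ t)) \<and> K (LZ t) + 7 = K (LA t))"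

text \<open>The reading part of a rule could a priori lie anywhere above letter \<open>t\<close>.
  Those rows are already tiled by known blocks, and the separator together with the pointer leaves
  only the letters around the read position.\<close>

lemma queue_read:
  assumes \<sigma>: "\<sigma> permutes {..<n}" and lay: "layout n \<sigma> t K"
    and bl: "\<exists>\<tau>\<in>{0, 1, 2}. blk n \<sigma> \<tau> r0 c0" "blk n \<sigma> x r1 c1" "x \<in> {1, 2}" "blk n \<sigma> 3 r2 c2"
    and rows: "r0 < r1" "r1 < r2" "r2 < 7 * row (LA t)"
    and cols: "c2 < c0" "c0 < K (LD t)" "K (LD t) < c1"
  shows "x = letter_at (Suc (ptr t)) \<and> c1 = K (LA (Suc (ptr t)))"
proof -
  have t: "3 \<le> t" using lay by (simp add: layout_def)
  have tile: "\<exists>b\<in>prefix t. r = 7 * row b \<and> \<tau> = ty b \<and> c = K b" if "blk n \<sigma> \<tau> r c" "r \<le> r2" for \<tau> r c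
    by (rule prefix_tiles[OF \<sigma> lay that(1)]) (use that(2) rows(3) t in \<open>simp split: if_splits\<close>)
  obtain q where q: "q \<in> prefix t" "r0 = 7 * row q" "ty q \<le> 2" "c0 = K q"
    using bl(1) tile[of _ r0 c0] rows by fastforce
  obtain q' where q': "q' \<in> prefix t" "r1 = 7 * row q'" "x = ty q'" "c1 = K q'"
    using tile[OF bl(2)] rows by auto
  obtain s where s: "s \<in> prefix t" "r2 = 7 * row s" "ty s = 3" "c2 = K s"
    using tile[OF bl(4)] by auto
  obtain i j k where ijk: "q = LA i" "q' = LA j" "s = LB k"
    using ty_cases(1)[OF q(3)] ty_cases(1)[of q'] ty_cases(2)[OF s(3)] q'(3) bl(3) by auto
  have D: "LD t \<in> prefix t" using t by simp
  have "i = ptr t \<and> j = Suc (ptr t) \<and> k = Suc (ptr t)"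
  proof (rule consecutive_letters)
    show "key (LB k) < key (LA i)" "key (LA i) < key (LD t)" "key (LD t) < key (LA j)"
      using prefix_key_iff[OF \<sigma> lay] q q' s ijk cols D by metis+
    show "row (LA i) < row (LA j)" "row (LA j) < row (LB k)" using rows q q' s ijk by simp_all
  qed (use t s ijk in auto)
  then show ?thesis using q' ijk by simp
qed

text \<open>The pointer of letter \<open>t\<close> is justified, so it is the pointer of some rule.
  The rule fixes the three blocks that follow, or the end block; gap conditions place them in the
  next rows, and the type of letter \<open>t\<close> decides between copying or ending and the step
  after a marker.\<close>

lemma next_stage:
  assumes \<sigma>: "\<sigma> \<in> perfect_runs n" and lay: "layout n \<sigma> t K"
  shows "(\<exists>K'. layout n \<sigma> (Suc t) K') \<or> finished n \<sigma> t"
proof -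
  have perm: "\<sigma> permutes {..<n}" and adm: "admissible n \<sigma>"
    using \<sigma> by (auto simp: perfect_runs_def run_perms_def)
  have t: "3 \<le> t" using lay by (simp add: layout_def)
  have bA: "blk n \<sigma> (letter_at t) (7 * row (LA t)) (K (LA t))"
    and bB: "blk n \<sigma> 3 (7 * row (LB t)) (K (LB t))" and bD: "blk n \<sigma> 4 (7 * row (LD t)) (K (LD t))"
    using lay t unfolding layout_def by (metis prefix_simps ty.simps order.refl order_trans one_le_numeral)+
  have rowsA: "7 * row (LA t) + 7 = 7 * row (LD t)" and rowsB: "7 * row (LB t) = 7 * row (LD t) + 7"
    and rowsA': "7 * row (LA (Suc t)) = 7 * row (LB t) + 7"
    and rowsD': "7 * row (LD (Suc t)) = 7 * row (LA (Suc t)) + 7"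
    and rowsB': "7 * row (LB (Suc t)) = 7 * row (LD (Suc t)) + 7"
    and rowsZ: "7 * row (LZ t) = 7 * row (LB t) + 7"
    using t by auto
  have p: "K (LD t) = K (LA (ptr t)) + 7 * \<delta> t" using lay t by (simp add: layout_def)
  have "good n \<sigma> (7 * row (LD t))" using perfect_ptr[OF \<sigma> _ bD] by simp
  then obtain Q d R K' where Qd: "(Q, d) \<in> set rules" "conf n \<sigma> Q R K'" "R d = 7 * row (LD t)"
    unfolding good_def by blast
  have copy: ?thesis if Q: "Q = copy_config x" "d = 4" "x \<in> {1, 2}" for x
  proof -
    note cf = Qd(2)[unfolded Q conf_copy]
    have T: "(copy_config x, [4,5,6,7,8], [4,7]) \<in> set tight_configs" using Q(3) by (auto simp: tight_configs_def)
    note gap = conf_gaps[OF perm adm T Qd(2)[unfolded Q(1)]]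
    have rows: "R 4 = R 3 + 7" "R 5 = R 4 + 7" "R 6 = R 5 + 7" "R 7 = R 6 + 7" "R 8 = R 7 + 7"
      using gap(1)[of 3] gap(1)[of 4] gap(1)[of 5] gap(1)[of 6] gap(1)[of 7] by (simp_all add: copy_config_def)
    have cols: "K' 7 = K' 1 + 7" "K' 3 = K' 8 + 7"
      using gap(2)[of 3] gap(2)[of 6] by (simp_all add: copy_config_def)
    have R: "R 3 = 7 * row (LA t)" "R 5 = 7 * row (LB t)" "R 6 = 7 * row (LA (Suc t))"
      "R 7 = 7 * row (LD (Suc t))" "R 8 = 7 * row (LB (Suc t))"
      using rows Qd(3)[unfolded Q(2)] rowsA rowsB rowsA' rowsD' rowsB' by linarith+
    have "1 = letter_at t \<and> K' 3 = K (LA t)" by (rule blk_unique[OF _ bA]) (use cf R in metis)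
    then have A: "letter_at t = 1" "K' 3 = K (LA t)" by simp_all
    obtain \<tau> where "blk n \<sigma> \<tau> (7 * row (LD t)) (K' 4)" using cf Qd(3) Q(2) by metis
    then have D: "K' 4 = K (LD t)" using blk_unique[OF _ bD] by blast
    have x: "x = letter_at (Suc (ptr t)) \<and> K' 1 = K (LA (Suc (ptr t)))"
      by (rule queue_read[OF perm lay, of "R 0" "K' 0" x "R 1" "K' 1" "R 2" "K' 2"]) (use cf R D Q(3) in auto)
    have marked: "\<not> marked t" using A(1) letter_at_iff(2) by simp
    \<comment> \<open>The letter copied from the queue is the one prescribed by the triangular
      numbers.\<close>
    have x': "x = letter_at (Suc t)" using x marked_Suc_iff[OF t marked] by (simp add: letter_at_def)
    have p': "ptr (Suc t) = Suc (ptr t)" "\<delta> (Suc t) = 1" using marked t by (auto simp: \<delta>_def)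
    obtain \<tau>' where \<tau>': "\<tau>' \<in> {4, 5}" "blk n \<sigma> \<tau>' (R 7) (K' 7)" using cf by blast
    then have d': "blk n \<sigma> 4 (R 7) (K' 7)" using perfect_ptr[OF \<sigma> \<tau>'] by simp
    have "\<exists>K'. layout n \<sigma> (Suc t) K'"
    proof (rule layout_extend[OF lay])
      show "blk n \<sigma> (letter_at (Suc t)) (7 * row (LA (Suc t))) (K' 6)" using cf R x' by metis
      show "blk n \<sigma> 4 (7 * row (LD (Suc t))) (K' 7)" using d' R by simp
      show "blk n \<sigma> 3 (7 * row (LB (Suc t))) (K' 8)" using cf R by metis
      show "K (LA t) < K' 6" "K' 8 + 7 = K (LA t)" using cf A cols by simp_all
      show "K' 7 = K (LA (ptr (Suc t))) + 7 * \<delta> (Suc t)" unfolding p' using cols x by simp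
    qed
    then show ?thesis ..
  qed
  consider "Q = copy_config 1" "d = 4" | "Q = copy_config 2" "d = 4" | "Q = after_marker_config" "d = 1"
    | "Q = end_config" "d = 4"
    using Qd(1) by (auto simp: rules_def)
  then show ?thesis
  proof cases
    case 1
    then show ?thesis using copy by blast
  next
    case 2
    then show ?thesis using copy by blast
  next
    case 3
    note cf = Qd(2)[unfolded 3 conf_after_marker]
    have T: "(after_marker_config, [1,2,3,4,5], [1,4]) \<in> set tight_configs" by (auto simp: tight_configs_def)
    note gap = conf_gaps[OF perm adm T Qd(2)[unfolded 3(1)]]
    have rows: "R 1 = R 0 + 7" "R 2 = R 1 + 7" "R 3 = R 2 + 7" "R 4 = R 3 + 7" "R 5 = R 4 + 7"
      using gap(1)[of 0] gap(1)[of 1] gap(1)[of 2] gap(1)[of 3] gap(1)[of 4] by (simp_all add: after_marker_config_def eval_nat_numeral)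
    have cols: "K' 4 = K' 1 + 7" "K' 0 = K' 5 + 7"
      using gap(2)[of 0] gap(2)[of 3] by (simp_all add: after_marker_config_def)
    have R: "R 0 = 7 * row (LA t)" "R 2 = 7 * row (LB t)" "R 3 = 7 * row (LA (Suc t))"
      "R 4 = 7 * row (LD (Suc t))" "R 5 = 7 * row (LB (Suc t))"
      using rows Qd(3)[unfolded 3(2)] rowsA rowsB rowsA' rowsD' rowsB' by linarith+
    have "2 = letter_at t \<and> K' 0 = K (LA t)" by (rule blk_unique[OF _ bA]) (use cf R in metis)
    then have A: "letter_at t = 2" "K' 0 = K (LA t)" by simp_all
    obtain \<tau> where "blk n \<sigma> \<tau> (7 * row (LD t)) (K' 1)" using cf Qd(3) 3(2) by metis
    then have D: "K' 1 = K (LD t)" using blk_unique[OF _ bD] by blast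
    have marked: "marked t" "\<not> marked (Suc t)" using A(1) letter_at_iff(1) marked_not_Suc t by auto
    have x': "letter_at (Suc t) = 1" using marked by (simp add: letter_at_def)
    have p': "ptr (Suc t) = ptr t" "\<delta> (Suc t) = 2" "\<delta> t = 1" using marked by (auto simp: \<delta>_def)
    obtain \<tau>' where \<tau>': "\<tau>' \<in> {4, 5}" "blk n \<sigma> \<tau>' (R 4) (K' 4)" using cf by blast
    then have d': "blk n \<sigma> 4 (R 4) (K' 4)" using perfect_ptr[OF \<sigma> \<tau>'] by simp
    have "\<exists>K'. layout n \<sigma> (Suc t) K'"
    proof (rule layout_extend[OF lay])
      show "blk n \<sigma> (letter_at (Suc t)) (7 * row (LA (Suc t))) (K' 3)" using cf R x' by metis
      show "blk n \<sigma> 4 (7 * row (LD (Suc t))) (K' 4)" using d' R by simp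
      show "blk n \<sigma> 3 (7 * row (LB (Suc t))) (K' 5)" using cf R by metis
      show "K (LA t) < K' 3" "K' 5 + 7 = K (LA t)" using cf A cols by simp_all
      show "K' 4 = K (LA (ptr (Suc t))) + 7 * \<delta> (Suc t)" unfolding p' using cols D p p'(3) by simp
    qed
    then show ?thesis ..
  next
    case 4
    note cf = Qd(2)[unfolded 4 conf_end]
    have T: "(end_config, [4,5,6], [6]) \<in> set tight_configs" by (auto simp: tight_configs_def)
    note gap = conf_gaps[OF perm adm T Qd(2)[unfolded 4(1)]]
    have rows: "R 4 = R 3 + 7" "R 5 = R 4 + 7" "R 6 = R 5 + 7"
      using gap(1)[of 3] gap(1)[of 4] gap(1)[of 5] by (simp_all add: end_config_def)
    have cols: "K' 3 = K' 6 + 7"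
      using gap(2)[of 5] by (simp add: end_config_def)
    have R: "R 3 = 7 * row (LA t)" "R 5 = 7 * row (LB t)" "R 6 = 7 * row (LZ t)"
      using rows Qd(3)[unfolded 4(2)] rowsA rowsB rowsZ by linarith+
    have "1 = letter_at t \<and> K' 3 = K (LA t)" by (rule blk_unique[OF _ bA]) (use cf R in metis)
    then have A: "letter_at t = 1" "K' 3 = K (LA t)" by simp_all
    obtain \<tau> where "blk n \<sigma> \<tau> (7 * row (LD t)) (K' 4)" using cf Qd(3) 4(2) by metis
    then have D: "K' 4 = K (LD t)" using blk_unique[OF _ bD] by blast
    have x: "2 = letter_at (Suc (ptr t)) \<and> K' 1 = K (LA (Suc (ptr t)))"
      by (rule queue_read[OF perm lay, of "R 0" "K' 0" 2 "R 1" "K' 1" "R 2" "K' 2"]) (use cf R D in auto)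
    have "\<not> marked t" using A(1) letter_at_iff(2) by simp
    then have marked: "marked (Suc t)" using x marked_Suc_iff[OF t] letter_at_iff(1)[of "Suc (ptr t)"] by simp
    have Z: "blk n \<sigma> 6 (7 * row (LZ t)) (K' 6)" using cf R by metis
    have T': "(([[6]], [0]), [1], []) \<in> set tight_configs" by (auto simp: tight_configs_def)
    have "conf n \<sigma> ([[6]], [0]) (\<lambda>_. 7 * row (LZ t)) (\<lambda>_. K' 6)" using Z by (simp add: conf_single)
    then have "\<not> row_gap n 1 (\<lambda>_. 7 * row (LZ t)) 1"
      using adm T' unfolding admissible_def gap_free_def by fastforce
    then have "\<not> 7 * row (LZ t) + 7 < n" by (simp add: row_gap_def)
    \<comment> \<open>No row may follow the end block, and its block row \<open>3 * t - 1\<close>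
      then fixes the size.\<close>
    then have n: "n = 21 * t" using blk_row[OF Z] t by simp
    define K'' where "K'' = K(LZ t := K' 6)"
    have lay'': "layout n \<sigma> t K''"
    proof -
      have "K'' b = K b" if "b \<in> prefix t" for b using that by (auto simp: K''_def)
      then show ?thesis using lay unfolding layout_def by (simp add: K''_def)
    qed
    have "finished n \<sigma> t"
      unfolding finished_def using marked n lay'' Z A cols
      by (intro conjI exI[of _ K'']) (simp_all add: K''_def del: row.simps)
    then show ?thesis ..
  qed
qed

lemma first_stage:
  assumes \<sigma>: "\<sigma> \<in> perfect_runs n"
  shows "\<exists>K. layout n \<sigma> 3 K"
proof -
  have perm: "\<sigma> permutes {..<n}" and adm: "admissible n \<sigma>"
    using \<sigma> by (auto simp: perfect_runs_def run_perms_def)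
  obtain R K' where conf: "conf n \<sigma> start_config R K'"
    using \<sigma> by (auto simp: perfect_runs_def run_perms_def started_def)
  note cf = conf[unfolded conf_start]
  have T: "(start_config, [1,2,3,4,5,6,7], [1,2,4,6]) \<in> set tight_configs" by (auto simp: tight_configs_def)
  note gap = conf_gaps[OF perm adm T conf]
  have rows: "R 1 = R 0 + 7" "R 2 = R 1 + 7" "R 3 = R 2 + 7" "R 4 = R 3 + 7" "R 5 = R 4 + 7" "R 6 = R 5 + 7" "R 7 = R 6 + 7"
    using gap(1)[of 0] gap(1)[of 1] gap(1)[of 2] gap(1)[of 3] gap(1)[of 4] gap(1)[of 5] gap(1)[of 6]
    by (simp_all add: start_config_def eval_nat_numeral)
  have cols: "K' 0 = K' 2 + 7" "K' 6 = K' 0 + 7" "K' 1 = K' 4 + 7" "K' 3 = K' 7 + 7"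
    using gap(2)[of 0] gap(2)[of 1] gap(2)[of 3] gap(2)[of 5] by (simp_all add: start_config_def)
  \<comment> \<open>No row may precede a block of type 0, so the run starts in row 0 and all later
    rows are absolute.\<close>
  have T': "(([[0]], [0]), [0], []) \<in> set tight_configs" by (auto simp: tight_configs_def)
  have "conf n \<sigma> ([[0]], [0]) (\<lambda>_. R 0) (\<lambda>_. K' 0)" using cf by (simp add: conf_single)
  then have "\<not> row_gap n 1 (\<lambda>_. R 0) 0"
    using adm T' unfolding admissible_def gap_free_def by fastforce
  then have R0: "R 0 = 0" by (simp add: row_gap_def)
  have R: "R 1 = 7" "R 2 = 14" "R 3 = 21" "R 4 = 28" "R 5 = 35" "R 6 = 42" "R 7 = 49"
    using rows R0 by simp_all
  obtain \<tau> where \<tau>: "\<tau> \<in> {4, 5}" "blk n \<sigma> \<tau> (R 6) (K' 6)" using cf by blast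
  then have d: "blk n \<sigma> 4 (R 6) (K' 6)" using perfect_ptr[OF \<sigma> \<tau>] by simp
  \<comment> \<open>The lists translate names into indices of \<open>start_config\<close>. Index 6
    is its pointer \<open>LD 3\<close>; the entry for \<open>LB 0\<close> is a filler, since no such
    separator belongs to the prefix.\<close>
  define K where "K = (\<lambda>b. K' (case b of LA i \<Rightarrow> [0, 1, 3, 5] ! i | LB i \<Rightarrow> [0, 2, 4, 7] ! i | _ \<Rightarrow> 6))"
  have pre: "prefix 3 = {LA 0, LA 1, LA 2, LA 3, LB 1, LB 2, LB 3, LD 3}"
    by (auto simp: prefix_def le_Suc_eq eval_nat_numeral)
  have L: "letter_at 0 = 0" "letter_at 1 = 2" "letter_at 2 = 1" "letter_at 3 = 1"
    using marked_small by (simp_all add: letter_at_def)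
  have "\<forall>b\<in>prefix 3. blk n \<sigma> (ty b) (7 * row b) (K b)"
    unfolding pre using cf R R0 d L by (simp add: K_def eval_nat_numeral)
  moreover have "K (LA i) < K (LA (Suc i)) \<and> K (LB (Suc i)) + 7 = K (LA i)" if less: "i < 3" for i
  proof -
    consider "i = 0" | "i = 1" | "i = 2" using less by linarith
    then show ?thesis using cf cols by cases (simp_all add: K_def)
  qed
  moreover have "K (LD i) = K (LA (ptr i)) + 7 * \<delta> i" if "3 \<le> i" "i \<le> 3" for i
  proof -
    have "i = 3" using that by simp
    then show ?thesis using cols ptr_3 \<delta>_3 by (simp add: K_def)
  qed
  ultimately show ?thesis unfolding layout_def by (intro exI[of _ K]) simp
qed

lemma perfect_finished:
  assumes \<sigma>: "\<sigma> \<in> perfect_runs n"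
  shows "\<exists>t. finished n \<sigma> t"
proof (rule ccontr)
  assume no: "\<nexists>t. finished n \<sigma> t"
  have "\<exists>K. layout n \<sigma> t K" if "3 \<le> t" for t
    using that
  proof (induction t rule: nat_induct_at_least)
    case base
    show ?case by (rule first_stage[OF \<sigma>])
  next
    case (Suc t)
    then show ?case using next_stage[OF \<sigma>] no by blast
  qed
  \<comment> \<open>A run that never ends would need blocks below row \<open>n\<close>.\<close>
  from this[of "n + 3"] obtain K where "layout n \<sigma> (n + 3) K" by auto
  then have "blk n \<sigma> (ty (LA (n + 3))) (7 * row (LA (n + 3))) (K (LA (n + 3)))"
    unfolding layout_def by (metis prefix_simps(1) order.refl)
  from blk_row[OF this] show False by simp
qed

section \<open>A finished run determines the permutation\<close>

lemma finished_blk: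
  assumes \<sigma>: "\<sigma> permutes {..<n}" and f: "finished n \<sigma> t"
  shows "3 \<le> t \<and> marked (Suc t) \<and> n = 21 * t \<and> (\<exists>K. (\<forall>b\<in>full t. blk n \<sigma> (ty b) (7 * row b) (K b)) \<and>
    (\<forall>b\<in>full t. \<forall>b'\<in>full t. key b < key b' \<longrightarrow> K b < K b'))"
proof -
  obtain K where K: "layout n \<sigma> t K" "blk n \<sigma> 6 (7 * row (LZ t)) (K (LZ t))" "K (LZ t) + 7 = K (LA t)"
    using f by (auto simp: finished_def)
  have t: "3 \<le> t" using K(1) by (simp add: layout_def)
  have bl: "blk n \<sigma> (ty b) (7 * row b) (K b)" if "b \<in> full t" for b
    using that K(1,2) by (auto simp: full_def layout_def)
  have "slotted t K (LZ t)"
  proof -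
    have "K (LA j) + 14 \<le> K (LA t)" if j: "j < t" for j
    proof -
      have "K (LA j) + 7 \<le> K (LA t)" using layout_mono[OF \<sigma> K(1) j] by simp
      then have le: "K (LA j) \<le> K (LZ t)" using K(3) by linarith
      have b: "blk n \<sigma> (ty (LA j)) (7 * row (LA j)) (K (LA j))" using bl[of "LA j"] j by simp
      have "row (LA j) \<noteq> row (LZ t)" using row_inj[of "LA j" t "LZ t"] j t by auto
      then have "K (LA j) \<noteq> K (LZ t)" using blk_neq_cols[OF \<sigma> b K(2)] by simp
      then show ?thesis using blk_disjoint_cols[OF \<sigma> b K(2)] le K(3) by linarith
    qed
    then show ?thesis using K(3) by (simp add: slotted_def key_div_mod del: key.simps)
  qed
  then have "slotted t K b" if "b \<in> full t" for b
    using prefix_slotted[OF \<sigma> K(1)] that by (auto simp: full_def)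
  then have "K b < K b'" if "b \<in> full t" "b' \<in> full t" "key b < key b'" for b b'
    using slotted_order[of t K b b'] layout_mono[OF \<sigma> K(1)] that by blast
  then show ?thesis using t bl f unfolding finished_def by blast
qed

text \<open>The size determines \<open>t\<close>, and the \<open>3 * t\<close> blocks fill all rows.
  Types, rows and the column order by \<open>key\<close> are then the same for both permutations, so
  any two entries compare in the same way.\<close>

lemma perfect_unique:
  assumes "\<sigma> \<in> perfect_runs n" "\<rho> \<in> perfect_runs n"
  shows "\<sigma> = \<rho>"
proof -
  have perm: "\<sigma> permutes {..<n}" "\<rho> permutes {..<n}" using assms by (auto simp: perfect_runs_def run_perms_def)
  obtain t where t: "finished n \<sigma> t" using perfect_finished[OF assms(1)] by blast
  obtain t' where t': "finished n \<rho> t'" using perfect_finished[OF assms(2)] by blast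
  have n: "3 \<le> t" "n = 21 * t" "t' = t" using finished_blk[OF perm(1) t] finished_blk[OF perm(2) t'] by auto
  obtain K where K: "\<And>b. b \<in> full t \<Longrightarrow> blk n \<sigma> (ty b) (7 * row b) (K b)"
    "\<And>b b'. b \<in> full t \<Longrightarrow> b' \<in> full t \<Longrightarrow> key b < key b' \<Longrightarrow> K b < K b'"
    using finished_blk[OF perm(1) t] by blast
  obtain K' where K': "\<And>b. b \<in> full t \<Longrightarrow> blk n \<rho> (ty b) (7 * row b) (K' b)"
    "\<And>b b'. b \<in> full t \<Longrightarrow> b' \<in> full t \<Longrightarrow> key b < key b' \<Longrightarrow> K' b < K' b'"
    using finished_blk[OF perm(2) t'] n(3) by blast
  have tile: "\<exists>b\<in>full t. \<exists>i<7. x = 7 * row b + i" if "x < n" for x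
  proof -
    have "x div 7 \<in> row ` full t" using row_full[OF n(1)] n(2) that by auto
    then obtain b where "b \<in> full t" "row b = x div 7" by auto
    then show ?thesis by (intro bexI[of _ b] exI[of _ "x mod 7"]) auto
  qed
  have "\<rho> x < \<rho> y" if xy: "x < n" "y < n" "\<sigma> x < \<sigma> y" for x y
  proof -
    obtain b i where b: "b \<in> full t" "i < 7" "x = 7 * row b + i" using tile[OF xy(1)] by blast
    obtain b' j where b': "b' \<in> full t" "j < 7" "y = 7 * row b' + j" using tile[OF xy(2)] by blast
    note l = letter_less[OF ty_less b(2), of b] letter_less[OF ty_less b'(2), of b']
    have s: "\<sigma> x = K b + letter (ty b) i" "\<sigma> y = K b' + letter (ty b') j"
      using blkD[OF K(1)] b b' by simp_all
    have s': "\<rho> x = K' b + letter (ty b) i" "\<rho> y = K' b' + letter (ty b') j"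
      using blkD[OF K'(1)] b b' by simp_all
    show ?thesis
    proof (cases "b = b'")
      case True
      then show ?thesis using s s' xy(3) by simp
    next
      case False
      then have "key b \<noteq> key b'" using key_inj[OF b(1) b'(1)] by blast
      moreover have "\<not> key b' < key b"
      proof
        assume less: "key b' < key b"
        then have "K b' + 7 \<le> K b"
          using blk_disjoint_cols[OF perm(1) K(1)[OF b'(1)] K(1)[OF b(1)]] K(2)[OF b'(1) b(1)] by simp
        then show False using s l xy(3) by linarith
      qed
      ultimately have "K' b < K' b'" using K'(2)[OF b(1) b'(1)] by simp
      then have "K' b + 7 \<le> K' b'"
        using blk_disjoint_cols[OF perm(2) K'(1)[OF b(1)] K'(1)[OF b'(1)]] by simp
      then show ?thesis using s' l by linarith
    qed
  qed
  then have eq: "\<sigma> x = \<rho> x" if "x < n" for x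
    using bij_order_eqD[of \<sigma> n \<rho> x] permutes_imp_bij[OF perm(1)] permutes_imp_bij[OF perm(2)] that by blast
  show ?thesis
  proof
    fix x
    show "\<sigma> x = \<rho> x"
      using eq permutes_not_in[OF perm(1), of x] permutes_not_in[OF perm(2), of x] by (cases "x < n") auto
  qed
qed

section \<open>Existence of perfect runs\<close>

definition rank :: "nat \<Rightarrow> name \<Rightarrow> nat" where
  "rank t b = card {b' \<in> full t. key b' < key b}"

definition run :: "nat \<Rightarrow> nat \<Rightarrow> nat" where
  "run t x = (if x < 21 * t then
     7 * rank t (inv_into (full t) row (x div 7)) + letter (ty (inv_into (full t) row (x div 7))) (x mod 7) else x)"

text \<open>Together with \<open>rank_Suc\<close> this replaces columns by keys: the run is packed
  without free columns, so blocks with consecutive keys are adjacent.\<close>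

lemma rank_less: "b \<in> full t \<Longrightarrow> key b < key b' \<Longrightarrow> rank t b < rank t b'"
  unfolding rank_def by (rule psubset_card_mono) (use finite_full in auto)

lemma rank_Suc:
  assumes "b \<in> full t" "key b' = Suc (key b)"
  shows "rank t b' = Suc (rank t b)"
proof -
  have "{c \<in> full t. key c < key b'} = insert b {c \<in> full t. key c < key b}"
    using assms key_inj[OF _ assms(1)] by (auto simp: less_Suc_eq)
  then show ?thesis using finite_full by (simp add: rank_def)
qed

text \<open>Three chains, each increasing in rows and columns. The end block joins the separators
  because it sits below and to the right of all of them.\<close>

fun kind :: "name \<Rightarrow> nat" where
  "kind (LA _) = 0"
| "kind (LB _) = 1"
| "kind (LD _) = 2"
| "kind (LZ _) = 1"

lemma kind_increasing:
  assumes "b \<in> full t" "b' \<in> full t" "kind b = kind b'" "row b < row b'" "3 \<le> t"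
  shows "key b < key b'"
proof (cases b)
  case (LA i)
  then show ?thesis using assms by (cases b') (auto simp: row_order simp del: row.simps)
next
  case (LB i)
  then show ?thesis using assms by (cases b') (auto simp: row_order(4) simp del: row.simps(2))
next
  case (LD i)
  then obtain j where j: "b' = LD j" using assms(3) by (cases b') auto
  then have "i < j" using assms LD by (simp add: row_order del: row.simps)
  then show ?thesis using ptr_\<delta>_strict[of i j] LD j assms(1) by simp
next
  case (LZ i)
  have "row b' \<in> {..<3 * t}" using imageI[OF assms(2), of row] row_full[OF assms(5)] by simp
  then show ?thesis using LZ assms by simp
qed

lemma row_steps:
  assumes "3 \<le> a"
  shows "row (LD a) = Suc (row (LA a))" "row (LB a) = Suc (row (LD a))" "row (LZ a) = Suc (row (LB a))"
    "row (LA (Suc a)) = Suc (row (LB a))" "row (LD (Suc a)) = Suc (row (LA (Suc a)))" "row (LB (Suc a)) = Suc (row (LD (Suc a)))"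
  using assms by auto

text \<open>The writing half of a rule can only occur at two consecutive letters of the run: the
  rows give \<open>a \<le> u \<le> v < w \<le> y \<le> z\<close>, while the last separator left of
  letter \<open>a\<close> gives \<open>z \<le> a + 1\<close>.\<close>

lemma write_order:
  assumes "3 \<le> u" "1 \<le> v" "3 \<le> y" "1 \<le> z" "row (LA a) < row (LD u)" "row (LD u) < row (LB v)"
    "row (LB v) < row (LA w)" "row (LA w) < row (LD y)" "row (LD y) < row (LB z)" "key (LB z) < key (LA a)"
  shows "u = a \<and> v = a \<and> w = Suc a \<and> y = Suc a \<and> z = Suc a \<and> 3 \<le> a"
proof -
  have "a \<le> u" "u \<le> v" "v < w" "w \<le> y" "y \<le> z"
    using assms(5-9) row_order(5)[OF assms(1), of a] row_order(7)[OF assms(2,1)] row_order(3)[OF assms(2), of w]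
      row_order(5)[OF assms(3), of w] row_order(7)[OF assms(4,3)] by blast+
  moreover have "z \<le> Suc a" using assms(10) by simp
  ultimately show ?thesis using assms(1) by auto
qed

section \<open>Admissibility of the canonical run\<close>

context
  fixes t :: nat
  assumes t: "3 \<le> t"
begin

lemma inv_row: "b \<in> full t \<Longrightarrow> inv_into (full t) row (row b) = b"
  by (rule inv_into_f_f) (use row_inj t in \<open>auto intro: inj_onI\<close>)

lemma row_less: "b \<in> full t \<Longrightarrow> row b < 3 * t"
  using row_full[OF t] by blast

lemma run_at: "b \<in> full t \<Longrightarrow> i < 7 \<Longrightarrow> run t (7 * row b + i) = 7 * rank t b + letter (ty b) i"
  using row_less[of b] inv_row[of b] by (simp add: run_def)

lemma run_tile:
  assumes "x < 21 * t"
  shows "\<exists>b\<in>full t. \<exists>i<7. x = 7 * row b + i"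
proof -
  have "x div 7 \<in> row ` full t" using row_full[OF t] assms by auto
  then obtain b where "b \<in> full t" "row b = x div 7" by auto
  then show ?thesis by (intro bexI[of _ b] exI[of _ "x mod 7"]) auto
qed

lemma rank_bound: "b \<in> full t \<Longrightarrow> rank t b < 3 * t"
proof -
  assume b: "b \<in> full t"
  have "rank t b < card (full t)"
    unfolding rank_def by (rule psubset_card_mono[OF finite_full]) (use b in auto)
  also have "\<dots> = card (row ` full t)"
    by (rule card_image[symmetric]) (use row_inj t in \<open>auto intro: inj_onI\<close>)
  finally show ?thesis using row_full[OF t] by simp
qed

lemma rank_iff:
  assumes "b \<in> full t" "b' \<in> full t"
  shows "rank t b < rank t b' \<longleftrightarrow> key b < key b'"
proof (cases "key b = key b'")
  case True
  then show ?thesis using key_inj[OF assms] by simp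
next
  case False
  then show ?thesis using rank_less[OF assms(1), of b'] rank_less[OF assms(2), of b] by linarith
qed

lemma run_permutes: "run t permutes {..<21 * t}"
proof (rule bij_imp_permutes)
  have "run t x < 21 * t" if x: "x < 21 * t" for x
  proof -
    obtain b i where b: "b \<in> full t" "i < 7" "x = 7 * row b + i" using run_tile[OF x] by blast
    then show ?thesis using run_at[OF b(1,2)] letter_less[OF ty_less b(2), of b] rank_bound[OF b(1)] by simp
  qed
  moreover have "inj_on (run t) {..<21 * t}"
  proof (rule inj_onI)
    fix x y assume "x \<in> {..<21 * t}" "y \<in> {..<21 * t}" and eq: "run t x = run t y"
    then obtain b i b' j where b: "b \<in> full t" "i < 7" "x = 7 * row b + i" and b': "b' \<in> full t" "j < 7" "y = 7 * row b' + j"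
      using run_tile by (metis lessThan_iff)
    have eq: "7 * rank t b + letter (ty b) i = 7 * rank t b' + letter (ty b') j"
      using eq run_at b b' by simp
    note l = letter_less[OF ty_less b(2), of b] letter_less[OF ty_less b'(2), of b']
    have "rank t b = rank t b'" using eq l by linarith
    then have "key b = key b'" using rank_iff[OF b(1) b'(1)] rank_iff[OF b'(1) b(1)] by simp
    then have "b = b'" by (rule key_inj[OF b(1) b'(1)])
    then show "x = y" using eq b b' letter_inj[OF ty_less] by simp
  qed
  ultimately show "bij_betw (run t) {..<21 * t} {..<21 * t}" by (simp add: bij_betw_def endo_inj_surj image_subset_iff)
qed (simp add: run_def)

lemma run_blk: "b \<in> full t \<Longrightarrow> blk (21 * t) (run t) (ty b) (7 * row b) (7 * rank t b)"
  using row_less[of b] ty_less[of b] run_at[of b] by (simp add: blk_def)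

lemma run_blkD:
  assumes "blk (21 * t) (run t) \<tau> r c"
  shows "\<exists>b\<in>full t. r = 7 * row b \<and> \<tau> = ty b \<and> c = 7 * rank t b"
  by (rule blk_in_tiling[where K = "\<lambda>b. 7 * rank t b", OF run_permutes run_blk row_full[OF t] assms])
    (use blk_row[OF assms] in simp_all)

text \<open>The arrangement of the blocks is a union of three increasing sequences, so the decreasing sequence of length 4 in a letter
  must have two points in the same block.\<close>

lemma run_tight: "tight (21 * t) (run t)"
  unfolding tight_def
proof (intro allI impI)
  fix \<tau> s assume \<tau>: "\<tau> < 7" and s: "occ (21 * t) (run t) 7 (letter \<tau>) s"
  define P where "P x b \<longleftrightarrow> b \<in> full t \<and> 7 * row b \<le> s x \<and> s x < 7 * row b + 7" for x b
  have ex: "\<exists>b. P x b" if x: "x < 7" for x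
  proof -
    obtain b i where "b \<in> full t" "i < 7" "s x = 7 * row b + i" using run_tile[OF occ_less[OF s x]] by blast
    then show ?thesis by (intro exI[of _ b]) (simp add: P_def)
  qed
  show "(\<forall>i<7. s i = s 0 + i) \<and> (\<exists>c. blk (21 * t) (run t) \<tau> (s 0) c)"
  proof (cases "\<exists>i j b. i < j \<and> j < 7 \<and> P i b \<and> P j b")
    case True
    then obtain i j b where ij: "i < j" "j < 7" "P i b" "P j b" by blast
    then have b: "b \<in> full t" by (simp add: P_def)
    have sk: "s k = 7 * row b + k" if "k < 7" for k
      by (rule occ_meets_block[OF run_permutes s \<tau> run_blk[OF b] ij(1,2) _ _ _ _ that]) (use ij in \<open>auto simp: P_def\<close>)
    have "letter (ty b) x < letter (ty b) y" if "x < 7" "y < 7" "letter \<tau> x < letter \<tau> y" for x y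
      using occ_value[OF s that] sk[OF that(1)] sk[OF that(2)] run_at[OF b that(1)] run_at[OF b that(2)] by simp
    then have "\<tau> = ty b" by (rule letter_order_eqD[OF \<tau> ty_less])
    moreover have "s 0 = 7 * row b" using sk[of 0] by simp
    ultimately show ?thesis using sk run_blk[OF b] by simp blast
  next
    case False
    have dec: "kind b \<noteq> kind b'"
      if xy: "x < y" "y < 7" "letter \<tau> y < letter \<tau> x" and P: "P x b" "P y b'" for x y b b'
    proof
      assume kind: "kind b = kind b'"
      have f: "b \<in> full t" "b' \<in> full t" using P by (auto simp: P_def)
      have "b \<noteq> b'" using False xy P by blast
      then have "row b \<noteq> row b'" using row_inj[OF f _ t] by blast
      moreover have "s x < s y" using occ_mono[OF s xy(1,2)] .
      ultimately have "row b < row b'" using P unfolding P_def by linarith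
      then have "key b < key b'" by (rule kind_increasing[OF f kind _ t])
      then have "rank t b < rank t b'" using rank_iff[OF f] by simp
      moreover have "run t (s y) < run t (s x)" using occ_value[OF s] xy by simp
      moreover have "run t (s x) < 7 * rank t b + 7" "7 * rank t b' \<le> run t (s y)"
        using blk_mem[OF run_permutes run_blk[OF f(1)], of "s x"] blk_mem[OF run_permutes run_blk[OF f(2)], of "s y"]
          P by (auto simp: P_def)
      ultimately show False by linarith
    qed
    obtain i j k l where ijkl: "i < j" "j < k" "k < l" "l < 7"
      "letter \<tau> l < letter \<tau> k" "letter \<tau> k < letter \<tau> j" "letter \<tau> j < letter \<tau> i"
      using letter_decreasing[OF \<tau>] by blast
    obtain bi where bi: "P i bi" using ex[of i] ijkl by auto
    obtain bj where bj: "P j bj" using ex[of j] ijkl by auto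
    obtain bk where bk: "P k bk" using ex[of k] ijkl by auto
    obtain bl where bl: "P l bl" using ex[of l] ijkl by auto
    have "kind bi \<noteq> kind bj" "kind bj \<noteq> kind bk" "kind bk \<noteq> kind bl" "kind bi \<noteq> kind bk" "kind bi \<noteq> kind bl" "kind bj \<noteq> kind bl"
      using dec[OF _ _ _ bi bj] dec[OF _ _ _ bj bk] dec[OF _ _ _ bk bl] dec[OF _ _ _ bi bk] dec[OF _ _ _ bi bl]
        dec[OF _ _ _ bj bl] ijkl by auto
    moreover have "kind b < 3" for b by (cases b) auto
    ultimately have False by (metis One_nat_def less_2_cases_iff less_Suc_eq numeral_2_eq_2 numeral_3_eq_3)
    then show ?thesis ..
  qed
qed

lemma run_letters:
  assumes "blk (21 * t) (run t) \<tau> r c"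
  shows "\<tau> \<le> 2 \<Longrightarrow> \<exists>i\<le>t. r = 7 * row (LA i) \<and> c = 7 * rank t (LA i) \<and> \<tau> = letter_at i"
    "\<tau> = 3 \<Longrightarrow> \<exists>i. 1 \<le> i \<and> i \<le> t \<and> r = 7 * row (LB i) \<and> c = 7 * rank t (LB i)"
    "\<tau> \<in> {4, 5} \<Longrightarrow> \<exists>i. 3 \<le> i \<and> i \<le> t \<and> r = 7 * row (LD i) \<and> c = 7 * rank t (LD i)"
    "\<tau> = 6 \<Longrightarrow> r = 7 * row (LZ t) \<and> c = 7 * rank t (LZ t)"
    "\<tau> \<noteq> 5"
proof -
  obtain b where b: "b \<in> full t" "r = 7 * row b" "\<tau> = ty b" "c = 7 * rank t b" using run_blkD[OF assms] by blast
  show "\<tau> \<le> 2 \<Longrightarrow> \<exists>i\<le>t. r = 7 * row (LA i) \<and> c = 7 * rank t (LA i) \<and> \<tau> = letter_at i"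
    using b ty_cases(1)[of b] by (metis full_simps(1) ty.simps(1))
  show "\<tau> = 3 \<Longrightarrow> \<exists>i. 1 \<le> i \<and> i \<le> t \<and> r = 7 * row (LB i) \<and> c = 7 * rank t (LB i)"
    using b ty_cases(2)[of b] by (metis full_simps(2))
  show "\<tau> \<in> {4, 5} \<Longrightarrow> \<exists>i. 3 \<le> i \<and> i \<le> t \<and> r = 7 * row (LD i) \<and> c = 7 * rank t (LD i)"
    using b ty_cases(3)[of b] by (metis full_simps(3))
  show "\<tau> = 6 \<Longrightarrow> r = 7 * row (LZ t) \<and> c = 7 * rank t (LZ t)"
    using b ty_cases(4)[of b] by (metis full_simps(4))
  show "\<tau> \<noteq> 5" using b(3) by (cases b) (auto simp: letter_at_def)
qed

text \<open>Every occurrence of the configuration in the run is an intended one: its reading half is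
  fixed by \<open>consecutive_letters\<close> and its writing half by \<open>write_order\<close>.
  The required adjacencies are then consecutive rows or consecutive keys.\<close>

lemma run_copy_gaps:
  assumes x: "x \<in> {1, 2}" and cf: "conf (21 * t) (run t) (copy_config x) R K'"
  shows "R 4 = R 3 + 7 \<and> R 5 = R 4 + 7 \<and> R 6 = R 5 + 7 \<and> R 7 = R 6 + 7 \<and> R 8 = R 7 + 7 \<and>
    K' 7 = K' 1 + 7 \<and> K' 3 = K' 8 + 7"
proof -
  note c = cf[unfolded conf_copy]
  have x2: "x \<le> 2" using x by auto
  obtain \<tau> where q0: "\<tau> \<in> {0, 1, 2}" "blk (21 * t) (run t) \<tau> (R 0) (K' 0)" using c by blast
  obtain i where q: "i \<le> t" "R 0 = 7 * row (LA i)" "K' 0 = 7 * rank t (LA i)"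
    using q0 run_letters(1)[OF q0(2)] by auto
  obtain j where q': "j \<le> t" "R 1 = 7 * row (LA j)" "K' 1 = 7 * rank t (LA j)"
    using c x2 run_letters(1)[of x "R 1" "K' 1"] by blast
  obtain k where s: "1 \<le> k" "k \<le> t" "R 2 = 7 * row (LB k)" "K' 2 = 7 * rank t (LB k)"
    using c run_letters(2)[of 3 "R 2" "K' 2"] by blast
  obtain a where a: "a \<le> t" "R 3 = 7 * row (LA a)" "K' 3 = 7 * rank t (LA a)" "1 = letter_at a"
    using c run_letters(1)[of 1 "R 3" "K' 3"] by auto
  obtain u where u: "3 \<le> u" "u \<le> t" "R 4 = 7 * row (LD u)" "K' 4 = 7 * rank t (LD u)"
    using c run_letters(3)[of _ "R 4" "K' 4"] by blast
  obtain v where v: "1 \<le> v" "v \<le> t" "R 5 = 7 * row (LB v)" "K' 5 = 7 * rank t (LB v)"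
    using c run_letters(2)[of 3 "R 5" "K' 5"] by blast
  obtain w where w: "w \<le> t" "R 6 = 7 * row (LA w)" "K' 6 = 7 * rank t (LA w)"
    using c x2 run_letters(1)[of x "R 6" "K' 6"] by blast
  obtain y where y: "3 \<le> y" "y \<le> t" "R 7 = 7 * row (LD y)" "K' 7 = 7 * rank t (LD y)"
    using c run_letters(3)[of _ "R 7" "K' 7"] by blast
  obtain z where z: "1 \<le> z" "z \<le> t" "R 8 = 7 * row (LB z)" "K' 8 = 7 * rank t (LB z)"
    using c run_letters(2)[of 3 "R 8" "K' 8"] by blast
  have rows: "row (LA i) < row (LA j)" "row (LA j) < row (LB k)" "row (LA a) < row (LD u)" "row (LD u) < row (LB v)"
    "row (LB v) < row (LA w)" "row (LA w) < row (LD y)" "row (LD y) < row (LB z)"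
    using c q(2) q'(2) s(3) a(2) u(3) v(3) w(2) y(3) z(3) by linarith+
  have "rank t (LB k) < rank t (LA i)" "rank t (LA i) < rank t (LD u)" "rank t (LD u) < rank t (LA j)"
    "rank t (LB z) < rank t (LA a)"
    using c q(3) q'(3) s(4) a(3) u(4) z(4) by linarith+
  then have keys: "key (LB k) < key (LA i)" "key (LA i) < key (LD u)" "key (LD u) < key (LA j)" "key (LB z) < key (LA a)"
    using q(1) q'(1) s(1,2) a(1) u(1,2) z(1,2) by (simp_all only: rank_iff full_simps)
  have r: "i = ptr u" "j = Suc (ptr u)" "k = Suc (ptr u)"
    using consecutive_letters[OF u(1) s(1) rows(1,2) keys(1-3)] by blast+
  have w': "u = a" "v = a" "w = Suc a" "y = Suc a" "z = Suc a" "3 \<le> a"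
    using write_order[OF u(1) v(1) y(1) z(1) rows(3-7) keys(4)] by blast+
  have "\<not> marked a" using a(4) letter_at_iff(2)[of a] by simp
  \<comment> \<open>Letter \<open>a\<close> is plain, so the next pointer moves to the following
    slot and has the first place after its letter.\<close>
  then have "key (LD y) = Suc (key (LA j))" using r w' by (simp add: \<delta>_def)
  then have "rank t (LD y) = Suc (rank t (LA j))" using q'(1) by (intro rank_Suc) auto
  moreover have "rank t (LA a) = Suc (rank t (LB z))" using z w' by (intro rank_Suc) auto
  ultimately show ?thesis
    using a(2,3) u(3) v(3) w(2) y(3,4) z(3,4) q'(3) row_steps[OF w'(6)] unfolding w' by (simp del: row.simps)
qed

lemma run_after_marker_gaps:
  assumes cf: "conf (21 * t) (run t) after_marker_config R K'"
  shows "R 1 = R 0 + 7 \<and> R 2 = R 1 + 7 \<and> R 3 = R 2 + 7 \<and> R 4 = R 3 + 7 \<and> R 5 = R 4 + 7 \<and>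
    K' 4 = K' 1 + 7 \<and> K' 0 = K' 5 + 7"
proof -
  note c = cf[unfolded conf_after_marker]
  obtain a where a: "a \<le> t" "R 0 = 7 * row (LA a)" "K' 0 = 7 * rank t (LA a)" "2 = letter_at a"
    using c run_letters(1)[of 2 "R 0" "K' 0"] by auto
  obtain u where u: "3 \<le> u" "u \<le> t" "R 1 = 7 * row (LD u)" "K' 1 = 7 * rank t (LD u)"
    using c run_letters(3)[of _ "R 1" "K' 1"] by blast
  obtain v where v: "1 \<le> v" "v \<le> t" "R 2 = 7 * row (LB v)" "K' 2 = 7 * rank t (LB v)"
    using c run_letters(2)[of 3 "R 2" "K' 2"] by blast
  obtain w where w: "w \<le> t" "R 3 = 7 * row (LA w)" "K' 3 = 7 * rank t (LA w)"
    using c run_letters(1)[of 1 "R 3" "K' 3"] by fastforce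
  obtain y where y: "3 \<le> y" "y \<le> t" "R 4 = 7 * row (LD y)" "K' 4 = 7 * rank t (LD y)"
    using c run_letters(3)[of _ "R 4" "K' 4"] by blast
  obtain z where z: "1 \<le> z" "z \<le> t" "R 5 = 7 * row (LB z)" "K' 5 = 7 * rank t (LB z)"
    using c run_letters(2)[of 3 "R 5" "K' 5"] by blast
  have rows: "row (LA a) < row (LD u)" "row (LD u) < row (LB v)"
    "row (LB v) < row (LA w)" "row (LA w) < row (LD y)" "row (LD y) < row (LB z)"
    using c a(2) u(3) v(3) w(2) y(3) z(3) by linarith+
  have keys: "key (LB z) < key (LA a)"
    using c a z rank_iff by (metis full_simps mult_less_cancel1)
  have w': "u = a" "v = a" "w = Suc a" "y = Suc a" "z = Suc a" "3 \<le> a"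
    using write_order[OF u(1) v(1) y(1) z(1) rows keys] by blast+
  have "marked a" "\<not> marked (Suc a)" using a(4) letter_at_iff(1)[of a] marked_not_Suc[of a] w' by auto
  \<comment> \<open>Letter \<open>a\<close> is a marker, so the slot stays the same while
    \<open>\<delta>\<close> rises from 1 to 2.\<close>
  then have "key (LD y) = Suc (key (LD u))" using w' by (simp add: \<delta>_def)
  then have "rank t (LD y) = Suc (rank t (LD u))" using u by (intro rank_Suc) auto
  moreover have "rank t (LA a) = Suc (rank t (LB z))" using z w' by (intro rank_Suc) auto
  ultimately show ?thesis
    using a(2,3) u(3,4) v(3) w(2) y(3,4) z(3,4) row_steps[OF w'(6)] unfolding w' by (simp del: row.simps)
qed

lemma run_end_gaps:
  assumes cf: "conf (21 * t) (run t) end_config R K'"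
  shows "R 4 = R 3 + 7 \<and> R 5 = R 4 + 7 \<and> R 6 = R 5 + 7 \<and> K' 3 = K' 6 + 7"
proof -
  note c = cf[unfolded conf_end]
  obtain a where a: "a \<le> t" "R 3 = 7 * row (LA a)" "K' 3 = 7 * rank t (LA a)"
    using c run_letters(1)[of 1 "R 3" "K' 3"] by fastforce
  obtain u where u: "3 \<le> u" "u \<le> t" "R 4 = 7 * row (LD u)" "K' 4 = 7 * rank t (LD u)"
    using c run_letters(3)[of _ "R 4" "K' 4"] by blast
  obtain v where v: "1 \<le> v" "v \<le> t" "R 5 = 7 * row (LB v)" "K' 5 = 7 * rank t (LB v)"
    using c run_letters(2)[of 3 "R 5" "K' 5"] by blast
  have z: "R 6 = 7 * row (LZ t)" "K' 6 = 7 * rank t (LZ t)"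
    using c run_letters(4)[of 6 "R 6" "K' 6"] by blast+
  have rows: "row (LA a) < row (LD u)" "row (LD u) < row (LB v)"
    using c a(2) u(3) v(3) by linarith+
  have "key (LZ t) < key (LA a)"
    using c a z rank_iff[of "LZ t" "LA a"] by simp
  \<comment> \<open>Only the last letter has a key above that of the end block.\<close>
  then have "t \<le> a" by simp
  moreover have "a \<le> u" "u \<le> v" using rows row_order(5)[OF u(1), of a] row_order(7)[OF v(1) u(1)] by blast+
  ultimately have eq: "a = t" "u = t" "v = t" using v(2) by linarith+
  have "rank t (LA t) = Suc (rank t (LZ t))" by (intro rank_Suc) auto
  then show ?thesis using a(2,3) u(3) v(3) z row_steps[OF t] unfolding eq by (simp del: row.simps)
qed

lemma run_start_gaps:
  assumes cf: "conf (21 * t) (run t) start_config R K'"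
  shows "R 1 = R 0 + 7 \<and> R 2 = R 1 + 7 \<and> R 3 = R 2 + 7 \<and> R 4 = R 3 + 7 \<and> R 5 = R 4 + 7 \<and> R 6 = R 5 + 7 \<and>
    R 7 = R 6 + 7 \<and> K' 0 = K' 2 + 7 \<and> K' 6 = K' 0 + 7 \<and> K' 1 = K' 4 + 7 \<and> K' 3 = K' 7 + 7"
proof -
  note c = cf[unfolded conf_start]
  have s: "R 0 = 7 * row (LA 0)" "K' 0 = 7 * rank t (LA 0)"
    using c run_letters(1)[of 0 "R 0" "K' 0"] letter_at_iff(3) by auto
  obtain i where a1: "i \<le> t" "R 1 = 7 * row (LA i)" "K' 1 = 7 * rank t (LA i)"
    using c run_letters(1)[of 2 "R 1" "K' 1"] by fastforce
  obtain k where b1: "1 \<le> k" "k \<le> t" "R 2 = 7 * row (LB k)" "K' 2 = 7 * rank t (LB k)"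
    using c run_letters(2)[of 3 "R 2" "K' 2"] by blast
  obtain i2 where a2: "i2 \<le> t" "R 3 = 7 * row (LA i2)" "K' 3 = 7 * rank t (LA i2)"
    using c run_letters(1)[of 1 "R 3" "K' 3"] by fastforce
  obtain k2 where b2: "1 \<le> k2" "k2 \<le> t" "R 4 = 7 * row (LB k2)" "K' 4 = 7 * rank t (LB k2)"
    using c run_letters(2)[of 3 "R 4" "K' 4"] by blast
  obtain i3 where a3: "i3 \<le> t" "R 5 = 7 * row (LA i3)" "K' 5 = 7 * rank t (LA i3)"
    using c run_letters(1)[of 1 "R 5" "K' 5"] by fastforce
  obtain u where d: "3 \<le> u" "u \<le> t" "R 6 = 7 * row (LD u)" "K' 6 = 7 * rank t (LD u)"
    using c run_letters(3)[of _ "R 6" "K' 6"] by blast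
  obtain k3 where b3: "1 \<le> k3" "k3 \<le> t" "R 7 = 7 * row (LB k3)" "K' 7 = 7 * rank t (LB k3)"
    using c run_letters(2)[of 3 "R 7" "K' 7"] by blast
  have rows: "row (LA 0) < row (LA i)" "row (LA i) < row (LB k)" "row (LB k) < row (LA i2)" "row (LA i2) < row (LB k2)"
    "row (LB k2) < row (LA i3)" "row (LA i3) < row (LD u)" "row (LD u) < row (LB k3)"
    using c s(1) a1(2) b1(3) a2(2) b2(3) a3(2) d(3) b3(3) by linarith+
  then have r: "0 < i" "i \<le> k" "k < i2" "i2 \<le> k2" "k2 < i3" "i3 \<le> u" "u \<le> k3"
    using row_order(1)[of 0 i] row_order(2)[OF b1(1), of i] row_order(3)[OF b1(1), of i2] row_order(2)[OF b2(1), of i2]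
      row_order(3)[OF b2(1), of i3] row_order(5)[OF d(1), of i3] row_order(7)[OF b3(1) d(1)] by blast+
  have "key (LB k) < key (LA 0)" "key (LB k2) < key (LA i)" "key (LB k3) < key (LA i2)"
    using c s b1 a1 b2 b3 a2 rank_iff by (metis full_simps mult_less_cancel1 le0)+
  then have le: "k \<le> 1" "k2 \<le> i + 1" "k3 \<le> i2 + 1" by simp_all
  \<comment> \<open>Rows bound the indices from below, and each separator lying left of an earlier
    letter bounds them from above; the two chains leave a single choice.\<close>
  have eq: "i = 1" "k = 1" "i2 = 2" "k2 = 2" "i3 = 3" "u = 3" "k3 = 3" using r le by linarith+
  have "rank t (LA 0) = Suc (rank t (LB 1))" "rank t (LD 3) = Suc (rank t (LA 0))"
    "rank t (LA 1) = Suc (rank t (LB 2))" "rank t (LA 2) = Suc (rank t (LB 3))"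
    using t ptr_3 \<delta>_3 by (intro rank_Suc; simp)+
  then show ?thesis using s a1 b1 a2 b2 a3 d b3 unfolding eq by simp
qed

lemma run_gap_free:
  assumes T: "T \<in> set tight_configs"
  shows "gap_free (21 * t) (run t) T"
proof -
  have gf: "gap_free (21 * t) (run t) (Q, rg, cg)"
    if "\<And>R K'. conf (21 * t) (run t) Q R K' \<Longrightarrow> (\<forall>g\<in>set rg. \<not> row_gap (21 * t) (length (fst Q)) R g) \<and> (\<forall>g\<in>set cg. \<not> col_gap (snd Q) K' g)"
    for Q rg cg using that unfolding gap_free_def by blast
  have copy: "gap_free (21 * t) (run t) (copy_config x, [4,5,6,7,8], [4,7])" if x: "x \<in> {1, 2}" for x
  proof (rule gf)
    fix R K' assume "conf (21 * t) (run t) (copy_config x) R K'"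
    from run_copy_gaps[OF x this]
    show "(\<forall>g\<in>set [4,5,6,7,8]. \<not> row_gap (21 * t) (length (fst (copy_config x))) R g) \<and>
        (\<forall>g\<in>set [4,7]. \<not> col_gap (snd (copy_config x)) K' g)"
      by (simp add: row_gap_def col_gap_def copy_config_def)
  qed
  have after: "gap_free (21 * t) (run t) (after_marker_config, [1,2,3,4,5], [1,4])"
  proof (rule gf)
    fix R K' assume "conf (21 * t) (run t) after_marker_config R K'"
    from run_after_marker_gaps[OF this]
    show "(\<forall>g\<in>set [1,2,3,4,5]. \<not> row_gap (21 * t) (length (fst after_marker_config)) R g) \<and>
        (\<forall>g\<in>set [1,4]. \<not> col_gap (snd after_marker_config) K' g)"
      by (simp add: row_gap_def col_gap_def after_marker_config_def)
  qed
  have final: "gap_free (21 * t) (run t) (end_config, [4,5,6], [6])"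
  proof (rule gf)
    fix R K' assume "conf (21 * t) (run t) end_config R K'"
    from run_end_gaps[OF this]
    show "(\<forall>g\<in>set [4,5,6]. \<not> row_gap (21 * t) (length (fst end_config)) R g) \<and>
        (\<forall>g\<in>set [6]. \<not> col_gap (snd end_config) K' g)"
      by (simp add: row_gap_def col_gap_def end_config_def)
  qed
  have start: "gap_free (21 * t) (run t) (start_config, [1,2,3,4,5,6,7], [1,2,4,6])"
  proof (rule gf)
    fix R K' assume "conf (21 * t) (run t) start_config R K'"
    from run_start_gaps[OF this]
    show "(\<forall>g\<in>set [1,2,3,4,5,6,7]. \<not> row_gap (21 * t) (length (fst start_config)) R g) \<and>
        (\<forall>g\<in>set [1,2,4,6]. \<not> col_gap (snd start_config) K' g)"
      by (simp add: row_gap_def col_gap_def start_config_def)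
  qed
  have first: "gap_free (21 * t) (run t) (([[0]], [0]), [0], [])"
  proof (rule gf)
    fix R K' assume "conf (21 * t) (run t) ([[0]], [0]) R K'"
    then have "R 0 = 0" using run_letters(1)[of 0 "R 0" "K' 0"] letter_at_iff(3) by (fastforce simp: conf_single)
    then show "(\<forall>g\<in>set [0]. \<not> row_gap (21 * t) (length (fst ([[0::nat]], [0::nat]))) R g) \<and>
        (\<forall>g\<in>set []. \<not> col_gap (snd ([[0::nat]], [0::nat])) K' g)"
      by (simp add: row_gap_def)
  qed
  have last: "gap_free (21 * t) (run t) (([[6]], [0]), [1], [])"
  proof (rule gf)
    fix R K' assume "conf (21 * t) (run t) ([[6]], [0]) R K'"
    then have "R 0 = 7 * row (LZ t)" using run_letters(4)[of 6 "R 0" "K' 0"] by (simp add: conf_single)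
    then show "(\<forall>g\<in>set [1]. \<not> row_gap (21 * t) (length (fst ([[6::nat]], [0::nat]))) R g) \<and>
        (\<forall>g\<in>set []. \<not> col_gap (snd ([[6::nat]], [0::nat])) K' g)"
      using t by (simp add: row_gap_def)
  qed
  from T show ?thesis
    unfolding tight_configs_def list.set insert_iff empty_iff
    by (elim disjE FalseE) (simp_all only: copy after final start first last insert_iff simp_thms)
qed

lemma run_admissible: "admissible (21 * t) (run t)"
proof -
  have False if Cd: "Cd \<in> set rules" and cf: "conf (21 * t) (run t) (special Cd) R K'" for Cd R K'
  proof -
    obtain Q d where [simp]: "Cd = (Q, d)" by (cases Cd)
    have "d < length (fst Q)" using wf_rules[of Q d] Cd by simp
    then have "blk (21 * t) (run t) 5 (R d) (K' d)"
      using cf by (auto simp: conf_def confocc_def special_def dest!: spec[of _ d])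
    then show False using run_letters(5) by blast
  qed
  then show ?thesis using run_tight run_gap_free unfolding admissible_def by blast
qed

section \<open>Justification of all pointers of the run\<close>

lemma run_blocks:
  "i \<le> t \<Longrightarrow> blk (21 * t) (run t) (letter_at i) (7 * row (LA i)) (7 * rank t (LA i))"
  "1 \<le> i \<Longrightarrow> i \<le> t \<Longrightarrow> blk (21 * t) (run t) 3 (7 * row (LB i)) (7 * rank t (LB i))"
  "3 \<le> i \<Longrightarrow> i \<le> t \<Longrightarrow> blk (21 * t) (run t) 4 (7 * row (LD i)) (7 * rank t (LD i))"
  "blk (21 * t) (run t) 6 (7 * row (LZ t)) (7 * rank t (LZ t))"
  using run_blk[of "LA i"] run_blk[of "LB i"] run_blk[of "LD i"] run_blk[of "LZ t"] by simp_all

lemma run_started: "started (21 * t) (run t)"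
proof -
  define b where "b = (\<lambda>j. [LA 0, LA 1, LB 1, LA 2, LB 2, LA 3, LD 3, LB 3] ! j)"
  have L: "letter_at 0 = 0" "letter_at 1 = 2" "letter_at 2 = 1" "letter_at 3 = 1"
    using marked_small by (simp_all add: letter_at_def)
  have "conf (21 * t) (run t) start_config (\<lambda>j. 7 * row (b j)) (\<lambda>j. 7 * rank t (b j))"
    unfolding conf_start b_def
    using run_blocks(1)[of 0] run_blocks(1)[of 1] run_blocks(1)[of 2] run_blocks(1)[of 3] run_blocks(2)[of 1]
      run_blocks(2)[of 2] run_blocks(2)[of 3] run_blocks(3)[of 3] t L ptr_3 \<delta>_3 by (simp add: rank_iff)
  then show ?thesis unfolding started_def by blast
qed

text \<open>The last pointer is justified by the end rule, a pointer at a marker by the rule after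
  markers, and every other pointer by copying. The hypothesis on \<open>Suc t\<close> serves the
  last pointer: the end rule reads a marker.\<close>

lemma run_good:
  assumes u: "3 \<le> u" "u \<le> t" and marked: "marked (Suc t)"
  shows "good (21 * t) (run t) (7 * row (LD u))"
proof -
  have goodI: "good (21 * t) (run t) (R d)" if "(Q, d) \<in> set rules" "conf (21 * t) (run t) Q R K'" for Q d R K'
    using that unfolding good_def by blast
  note p = ptr_le[OF u(1)]
  have p': "ptr u \<le> t" "Suc (ptr u) \<le> t" using p u by simp_all
  have q: "\<exists>\<tau>\<in>{0, 1, 2}. blk (21 * t) (run t) \<tau> (7 * row (LA i)) (7 * rank t (LA i))" if "i \<le> t" for i
    using run_blocks(1)[OF that] by (auto simp: letter_at_def split: if_splits)
  have D: "\<exists>\<tau>\<in>{4, 5}. blk (21 * t) (run t) \<tau> (7 * row (LD i)) (7 * rank t (LD i))" if "3 \<le> i" "i \<le> t" for i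
    using run_blocks(3)[OF that] by blast
  have d: "0 < \<delta> u" "\<delta> u \<le> 2" using \<delta>_cases[of u] by auto
  have rows: "row (LA (ptr u)) < row (LA (Suc (ptr u)))" "row (LA (Suc (ptr u))) < row (LB (Suc (ptr u)))"
    "row (LB (Suc (ptr u))) < row (LA u)" "row (LA u) < row (LD u)" "row (LD u) < row (LB u)"
    "row (LB u) < row (LZ u)" "row (LB u) < row (LA (Suc u))" "row (LA (Suc u)) < row (LD (Suc u))"
    "row (LD (Suc u)) < row (LB (Suc u))"
    using p u by auto
  have ranks: "rank t (LB (Suc (ptr u))) < rank t (LA (ptr u))" "rank t (LA (ptr u)) < rank t (LD u)"
    "rank t (LD u) < rank t (LA (Suc (ptr u)))" "rank t (LA (Suc (ptr u))) < rank t (LB u)"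
    using p p' u d by (intro rank_less; simp)+
  consider "u = t" | "u < t" "marked u" | "u < t" "\<not> marked u" using u by linarith
  then show ?thesis
  proof cases
    case 1
    \<comment> \<open>The next letter would be a marker, so the last one is plain, and by the
      consistency of copying the letter to be read is a marker.\<close>
    have marked': "\<not> marked u" "marked (Suc (ptr u))" using 1 marked marked_not_Suc[of u] marked_Suc_iff[OF u(1)] u by auto
    then have L: "letter_at (Suc (ptr u)) = 2" "letter_at u = 1" using letter_at_iff u by auto
    define b where "b = (\<lambda>j. [LA (ptr u), LA (Suc (ptr u)), LB (Suc (ptr u)), LA u, LD u, LB u, LZ u] ! j)"
    have b: "b 0 = LA (ptr u)" "b 1 = LA (Suc (ptr u))" "b 2 = LB (Suc (ptr u))" "b 3 = LA u" "b 4 = LD u" "b 5 = LB u" "b 6 = LZ u"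
      by (simp_all add: b_def)
    have "rank t (LB u) < rank t (LZ u)" "rank t (LZ u) < rank t (LA u)" using u 1 by (intro rank_less; simp)+
    moreover have "blk (21 * t) (run t) 2 (7 * row (LA (Suc (ptr u)))) (7 * rank t (LA (Suc (ptr u))))"
      "blk (21 * t) (run t) 3 (7 * row (LB (Suc (ptr u)))) (7 * rank t (LB (Suc (ptr u))))"
      "blk (21 * t) (run t) 1 (7 * row (LA u)) (7 * rank t (LA u))"
      "blk (21 * t) (run t) 3 (7 * row (LB u)) (7 * rank t (LB u))"
      "blk (21 * t) (run t) 6 (7 * row (LZ u)) (7 * rank t (LZ u))"
      using run_blocks(1)[OF p'(2)] run_blocks(2)[of "Suc (ptr u)"] run_blocks(1)[of u] run_blocks(2)[of u] run_blocks(4) L p' u 1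
      by (simp_all del: row.simps)
    ultimately have "conf (21 * t) (run t) end_config (\<lambda>j. 7 * row (b j)) (\<lambda>j. 7 * rank t (b j))"
      unfolding conf_end b using q[OF p'(1)] D[OF u] rows ranks by (simp del: row.simps)
    from goodI[OF _ this, of 4] show ?thesis by (simp add: rules_def b del: row.simps)
  next
    case 2
    have L: "letter_at u = 2" "letter_at (Suc u) = 1" using 2 letter_at_iff marked_not_Suc[of u] u by auto
    have e: "ptr (Suc u) = ptr u" "\<delta> (Suc u) = 2" "\<delta> u = 1" using 2 marked_not_Suc[of u] u by (auto simp: \<delta>_def)
    define b where "b = (\<lambda>j. [LA u, LD u, LB u, LA (Suc u), LD (Suc u), LB (Suc u)] ! j)"
    have b: "b 0 = LA u" "b 1 = LD u" "b 2 = LB u" "b 3 = LA (Suc u)" "b 4 = LD (Suc u)" "b 5 = LB (Suc u)"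
      by (simp_all add: b_def)
    have "rank t (LD u) < rank t (LD (Suc u))" "rank t (LD (Suc u)) < rank t (LB u)"
      "rank t (LB u) < rank t (LB (Suc u))" "rank t (LB (Suc u)) < rank t (LA u)" "rank t (LA u) < rank t (LA (Suc u))"
      using u 2(1) p e by (intro rank_less; simp del: ptr.simps)+
    moreover have "blk (21 * t) (run t) 2 (7 * row (LA u)) (7 * rank t (LA u))"
      "blk (21 * t) (run t) 3 (7 * row (LB u)) (7 * rank t (LB u))"
      "blk (21 * t) (run t) 1 (7 * row (LA (Suc u))) (7 * rank t (LA (Suc u)))"
      "blk (21 * t) (run t) 3 (7 * row (LB (Suc u))) (7 * rank t (LB (Suc u)))"
      using run_blocks(1)[of u] run_blocks(2)[of u] run_blocks(1)[of "Suc u"] run_blocks(2)[of "Suc u"] L u 2(1)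
      by (simp_all del: row.simps)
    moreover have "\<exists>\<tau>\<in>{4, 5}. blk (21 * t) (run t) \<tau> (7 * row (LD (Suc u))) (7 * rank t (LD (Suc u)))"
      by (rule D) (use u 2(1) in simp_all)
    ultimately have "conf (21 * t) (run t) after_marker_config (\<lambda>j. 7 * row (b j)) (\<lambda>j. 7 * rank t (b j))"
      unfolding conf_after_marker b using D[OF u] rows by (simp del: row.simps)
    from goodI[OF _ this, of 1] show ?thesis by (simp only: b) (simp add: rules_def del: row.simps)
  next
    case 3
    define x where "x = letter_at (Suc (ptr u))"
    have x: "x \<in> {1, 2}" "letter_at (Suc u) = x" "letter_at u = 1"
      using 3 marked_Suc_iff[OF u(1)] letter_at_iff u by (auto simp: x_def letter_at_def)
    have e: "ptr (Suc u) = Suc (ptr u)" "\<delta> (Suc u) = 1" using 3 u by (auto simp: \<delta>_def)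
    define b where "b = (\<lambda>j. [LA (ptr u), LA (Suc (ptr u)), LB (Suc (ptr u)), LA u, LD u, LB u,
      LA (Suc u), LD (Suc u), LB (Suc u)] ! j)"
    have b: "b 0 = LA (ptr u)" "b 1 = LA (Suc (ptr u))" "b 2 = LB (Suc (ptr u))" "b 3 = LA u" "b 4 = LD u" "b 5 = LB u"
      "b 6 = LA (Suc u)" "b 7 = LD (Suc u)" "b 8 = LB (Suc u)"
      by (simp_all add: b_def)
    have "rank t (LA (Suc (ptr u))) < rank t (LD (Suc u))" "rank t (LD (Suc u)) < rank t (LB u)"
      "rank t (LB u) < rank t (LB (Suc u))" "rank t (LB (Suc u)) < rank t (LA u)" "rank t (LA u) < rank t (LA (Suc u))"
      using u 3(1) p p' e by (intro rank_less; simp del: ptr.simps)+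
    moreover have "blk (21 * t) (run t) x (7 * row (LA (Suc (ptr u)))) (7 * rank t (LA (Suc (ptr u))))"
      "blk (21 * t) (run t) 3 (7 * row (LB (Suc (ptr u)))) (7 * rank t (LB (Suc (ptr u))))"
      "blk (21 * t) (run t) 1 (7 * row (LA u)) (7 * rank t (LA u))"
      "blk (21 * t) (run t) 3 (7 * row (LB u)) (7 * rank t (LB u))"
      "blk (21 * t) (run t) x (7 * row (LA (Suc u))) (7 * rank t (LA (Suc u)))"
      "blk (21 * t) (run t) 3 (7 * row (LB (Suc u))) (7 * rank t (LB (Suc u)))"
      using run_blocks(1)[OF p'(2)] run_blocks(2)[of "Suc (ptr u)"] run_blocks(1)[of u] run_blocks(2)[of u]
        run_blocks(1)[of "Suc u"] run_blocks(2)[of "Suc u"] x(2,3) p' u 3(1)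
      by (simp_all add: x_def del: row.simps)
    moreover have "\<exists>\<tau>\<in>{4, 5}. blk (21 * t) (run t) \<tau> (7 * row (LD (Suc u))) (7 * rank t (LD (Suc u)))"
      by (rule D) (use u 3(1) in simp_all)
    ultimately have "conf (21 * t) (run t) (copy_config x) (\<lambda>j. 7 * row (b j)) (\<lambda>j. 7 * rank t (b j))"
      unfolding conf_copy b using q[OF p'(1)] D[OF u] rows ranks by (simp del: row.simps)
    from goodI[OF _ this, of 4] x(1) show ?thesis by (simp only: b) (auto simp: rules_def simp del: row.simps)
  qed
qed

lemma run_perfect: "marked (Suc t) \<Longrightarrow> run t \<in> perfect_runs (21 * t)"
proof -
  assume marked: "marked (Suc t)"
  have "\<not> bad (21 * t) (run t) r" for r
  proof
    assume "bad (21 * t) (run t) r"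
    then obtain \<tau> c where \<tau>: "\<tau> \<in> {4, 5}" "blk (21 * t) (run t) \<tau> r c" "\<not> good (21 * t) (run t) r" unfolding bad_def by blast
    then obtain i where "3 \<le> i" "i \<le> t" "r = 7 * row (LD i)" using run_letters(3)[OF \<tau>(2) \<tau>(1)] by blast
    then show False using run_good[of i] marked \<tau>(3) by simp
  qed
  then show ?thesis using run_permutes run_admissible run_started unfolding perfect_runs_def run_perms_def by blast
qed

end

text \<open>\<open>marked (Suc v)\<close> says that \<open>v + 3\<close> is triangular, and
  \<open>3 \<le> v\<close> corresponds to \<open>3 \<le> k\<close> since
  \<open>tri 3 = 6\<close>.\<close>

lemma odd_card_perfect: "odd (card (perfect_runs (21 * v))) \<longleftrightarrow> (\<exists>k\<ge>3. v + 3 = tri k)"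
proof (cases "3 \<le> v \<and> marked (Suc v)")
  case True
  then have "perfect_runs (21 * v) = {run v}" using run_perfect[of v] perfect_unique by blast
  moreover obtain k where k: "v + 3 = tri k" using True by (auto simp: marked_def eval_nat_numeral)
  moreover have "3 \<le> k"
  proof (rule ccontr)
    assume "\<not> 3 \<le> k"
    then have "tri k \<le> tri 2" by (intro tri_mono) simp
    then show False using k True by (simp add: eval_nat_numeral)
  qed
  ultimately show ?thesis by auto
next
  case False
  have "perfect_runs (21 * v) = {}"
  proof (rule ccontr)
    assume "perfect_runs (21 * v) \<noteq> {}"
    then obtain \<sigma> where \<sigma>: "\<sigma> \<in> perfect_runs (21 * v)" by blast
    then have perm: "\<sigma> permutes {..<21 * v}" by (simp add: perfect_runs_def run_perms_def)
    obtain t where "finished (21 * v) \<sigma> t" using perfect_finished[OF \<sigma>] by blast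
    then show False using finished_blk[OF perm] False by auto
  qed
  moreover have "\<not> (\<exists>k\<ge>3. v + 3 = tri k)"
  proof
    assume "\<exists>k\<ge>3. v + 3 = tri k"
    then obtain k where k: "3 \<le> k" "v + 3 = tri k" by blast
    have "tri 3 \<le> tri k" using k(1) by (rule tri_mono)
    then have "3 \<le> v" using k(2) by (simp add: eval_nat_numeral)
    moreover have "marked (Suc v)" unfolding marked_def using k(2) by (intro exI[of _ k]) simp
    ultimately show False using False by blast
  qed
  ultimately show ?thesis by simp
qed

theorem theorem4p3:
  shows "\<exists>F :: pattern set. finite F \<and> card F \<le> 6854 \<and>
           (\<forall>L\<in>F. partial_pattern L \<and> prows L \<le> 80 \<and> pcols L \<le> 80) \<and>
           \<not> P_recursive (\<lambda>n. int (C F n))"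
proof -
  have fin: "finite (forbidden \<union> start_patterns)" by (simp add: forbidden_def start_patterns_def)
  have card: "card forbidden \<le> 6854"
    using card_mono[OF fin, of forbidden] card_forbidden by simp
  have "\<not> P_recursive (\<lambda>n. int (C forbidden n)) \<or> \<not> P_recursive (\<lambda>n. int (C (forbidden \<union> start_patterns) n))"
  proof (rule not_both_P_recursive[of 21])
    fix v
    show "odd (int (C forbidden (21 * v)) - int (C (forbidden \<union> start_patterns) (21 * v))) \<longleftrightarrow> (\<exists>k\<ge>3. v + 3 = tri k)"
      using card_run_perms_parity[of "21 * v"] odd_card_perfect[of v] unfolding C_difference[of "21 * v"] by simp
  qed simp
  then show ?thesis
    using fin card card_forbidden forbidden_patterns_small by (metis UnCI finite_Un)
qed

end
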